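(* Let $m\ge 1$ and $n\ge 1$ be integers, let $p^{\pm}(x,y)=\sum_{i+j=0}^{n}a_{i,j}^{\pm}x^iy^j$ and $q^{\pm}(x,y)=\sum_{i+j=0}^{n}b_{i,j}^{\pm}x^iy^j$ be arbitrary real polynomials of degree at most $n$, and for $0<|\varepsilon|\ll 1$ consider the piecewise smooth system $$(\dot x,\dot y)=\begin{cases}(y+\varepsilon p^+(x,y),\,-x+x^2+\varepsilon q^+(x,y)), & x>y^{2m},\\ (y+\varepsilon p^-(x,y),\,-x+x^2+\varepsilon q^-(x,y)), & x<y^{2m}.\end{cases}$$ Let $H(n)$ be the number of limit cycles, taking into account multiplicity, bifurcating from the period annulus around the origin of the unperturbed system, as obtained by the first order Melnikov function $M(h)$, $h\in(0,\tfrac16)$, in $\varepsilon$ (that is, when $M\not\equiv 0$, counted by the zeros of $M$ in $(0,\tfrac16)$ with multiplicity). Then: (i) if $m=1$ (switching curve $x=y^{2}$), then $H(n)\le 50n+52$; (ii) if $m\ge 2$ (switching curve $x=y^{2m}$), then $H(n)\le (39m+36)n+77m+21$.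
   Context: The unperturbed system ($\varepsilon=0$) is the Bogdanov–Takens Hamiltonian system $\dot x=y$, $\dot y=-x+x^2$ with first integral $H(x,y)=\frac12x^2+\frac12y^2-\frac13x^3$. It has a center at $(0,0)$ ($h=0$) and a saddle at $(1,0)$ ($h=\frac16$). For $h\in(0,\frac16)$ let $L_h$ be the closed orbit surrounding the origin contained in $\{H=h\}$, oriented clockwise (the direction of the flow); these orbits form the period annulus. Put $L_h^+=L_h\cap\{x>y^{2m}\}$ and $L_h^-=L_h\cap\{x<y^{2m}\}$ with the induced orientation. The first order Melnikov function is $$M(h)=\int_{L_h^+}\big(q^+\,dx-p^+\,dy\big)+\int_{L_h^-}\big(q^-\,dx-p^-\,dy\big),\qquad h\in(0,\tfrac16).$$ (If $M\not\equiv0$ has at most $k$ zeros in $(0,\frac16)$ counted with multiplicity, then at most $k$ limit cycles bifurcate from the period annulus for $0<|\varepsilon|\ll1$.) *)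

theory Defs
  imports "HOL-Analysis.Analysis" "HOL-Library.Extended_Nat"
begin

definition bt_field :: "real \<times> real \<Rightarrow> real \<times> real" where
  "bt_field = (\<lambda>(x, y). (y, - x + x\<^sup>2))"

definition bt_hamiltonian :: "real \<times> real \<Rightarrow> real" where
  "bt_hamiltonian = (\<lambda>(x, y). x\<^sup>2 / 2 + y\<^sup>2 / 2 - x ^ 3 / 3)"

text \<open>\<open>g\<close> is a periodic solution, with least period \<open>T\<close>, of the unperturbed system, whose
  trajectory lies on the level \<open>h\<close> and surrounds the origin. For \<open>0 < h < 1/6\<close> such a \<open>g\<close> exists
  and is unique up to a translation of time; its range is the oval \<open>L\<^sub>h\<close>, and increasing time
  gives the clockwise orientation.\<close>

definition closed_orbit :: "real \<Rightarrow> (real \<Rightarrow> real \<times> real) \<Rightarrow> real \<Rightarrow> bool" where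
  "closed_orbit h g T \<longleftrightarrow>
     (\<forall>t. (g has_vector_derivative bt_field (g t)) (at t)) \<and>
     T > 0 \<and> g T = g 0 \<and> inj_on g {0..<T} \<and>
     range g \<subseteq> {z. bt_hamiltonian z = h} \<and>
     (0, 0) \<in> inside (range g)"

text \<open>The integral of \<open>P dx + Q dy\<close> along the part of the curve \<open>g\<close>, \<open>0 \<le> t \<le> T\<close>, that lies
  in \<open>A\<close>, with the orientation induced by \<open>g\<close>.\<close>

definition curve_integral ::
  "(real \<Rightarrow> real \<times> real) \<Rightarrow> real \<Rightarrow> (real \<times> real) set \<Rightarrow>
   (real \<times> real \<Rightarrow> real) \<Rightarrow> (real \<times> real \<Rightarrow> real) \<Rightarrow> real" where
  "curve_integral g T A P Q =
     integral {t \<in> {0..T}. g t \<in> A}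
       (\<lambda>t. P (g t) * fst (vector_derivative g (at t)) + Q (g t) * snd (vector_derivative g (at t)))"

definition bipoly :: "nat \<Rightarrow> (nat \<Rightarrow> nat \<Rightarrow> real) \<Rightarrow> real \<times> real \<Rightarrow> real" where
  "bipoly n a = (\<lambda>(x, y). \<Sum>(i, j) \<in> {(i, j). i + j \<le> n}. a i j * x ^ i * y ^ j)"

text \<open>The first order Melnikov function, at \<open>\<epsilon> = 0\<close>, of the piecewise smooth system
  \<open>(x', y') = bt_field (x, y) + \<epsilon> (p, q)\<close>, where \<open>p\<close>, \<open>q\<close> have the coefficients \<open>ap\<close>, \<open>bp\<close> in the
  region \<open>x > y\<^sup>2\<^sup>m\<close> and \<open>am\<close>, \<open>bm\<close> in the region \<open>x < y\<^sup>2\<^sup>m\<close>. It is the integral of \<open>q dx - p dy\<close>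
  over \<open>L\<^sub>h\<close> and does not depend on the choice of the parametrization. It is meaningful for
  \<open>0 < h < 1/6\<close> only.\<close>

definition melnikov ::
  "nat \<Rightarrow> nat \<Rightarrow> (nat \<Rightarrow> nat \<Rightarrow> real) \<Rightarrow> (nat \<Rightarrow> nat \<Rightarrow> real) \<Rightarrow>
   (nat \<Rightarrow> nat \<Rightarrow> real) \<Rightarrow> (nat \<Rightarrow> nat \<Rightarrow> real) \<Rightarrow> real \<Rightarrow> real" where
  "melnikov m n ap bp am bm h =
     (let (g, T) = (SOME (g, T). closed_orbit h g T) in
        curve_integral g T {(x, y). x > y ^ (2 * m)} (bipoly n bp) (\<lambda>z. - bipoly n ap z) +
        curve_integral g T {(x, y). x < y ^ (2 * m)} (bipoly n bm) (\<lambda>z. - bipoly n am z))"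

text \<open>The order of vanishing at \<open>z\<close>, meant for functions that are smooth near \<open>z\<close> (the Melnikov
  functions are real analytic on the interval \<open>(0, 1/6)\<close>).\<close>

definition vanishing_order :: "(real \<Rightarrow> real) \<Rightarrow> real \<Rightarrow> enat" where
  "vanishing_order f z =
     (if \<exists>k. (deriv ^^ k) f z \<noteq> 0 then enat (LEAST k. (deriv ^^ k) f z \<noteq> 0) else \<infinity>)"

definition zero_count :: "(real \<Rightarrow> real) \<Rightarrow> real set \<Rightarrow> enat" where
  "zero_count f S =
     (if finite {z \<in> S. f z = 0} then \<Sum>z \<in> {z \<in> S. f z = 0}. vanishing_order f z else \<infinity>)"

text \<open>The number \<open>H(n)\<close>: the largest number of zeros in \<open>(0, 1/6)\<close>, with multiplicity, of a
  Melnikov function that does not vanish identically there, over all perturbations of degree at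
  most \<open>n\<close>.\<close>

definition melnikov_cyclicity :: "nat \<Rightarrow> nat \<Rightarrow> enat" where
  "melnikov_cyclicity m n =
     Sup {zero_count (melnikov m n ap bp am bm) {0<..<1/6} | ap bp am bm.
            \<exists>h \<in> {0<..<1/6}. melnikov m n ap bp am bm h \<noteq> 0}"

end

theory Submission
  imports Defs "HOL-Computational_Algebra.Polynomial_Factorial" "HOL-Computational_Algebra.Field_as_Ring"
begin

text \<open>For an energy \<open>h\<close> between \<open>0\<close> and \<open>1/6\<close> let \<open>(z ^ m, \<plusminus> v)\<close>, \<open>z = v\<^sup>2\<close>, be the points where the oval
  \<open>L\<^sub>h\<close> meets the switching curve. The Melnikov function is a combination of integrals of monomials
  over the whole oval and over its part to the right of the switching curve. Conservation of energy,
  the symmetry \<open>y \<mapsto> - y\<close> and the exactness of \<open>d (x ^ i y ^ j)\<close> reduce it to the form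
  \<open>M = a I\<^sub>0 + b I\<^sub>1 + c J\<^sub>0 + e J\<^sub>1 + v N(z)\<close>. Here \<open>I\<^sub>k\<close> and \<open>J\<^sub>k\<close> are the integrals of \<open>x\<^sup>k\<close> over the interior of
  the oval and over the part of the interior to the right of the switching curve, \<open>a\<close>, \<open>b\<close>, \<open>c\<close>, \<open>e\<close> are
  polynomials in \<open>h\<close> of degree at most \<open>d = (n - 1) div 2\<close>, and \<open>N\<close> is a polynomial of degree at most
  \<open>(3 d + 2) m\<close> (\<open>reducible_arc_melnikov\<close>).

  The complete integrals \<open>I\<^sub>0\<close>, \<open>I\<^sub>1\<close> satisfy a Picard-Fuchs system of rank two, and the incomplete integrals
  satisfy the same system up to algebraic terms. Hence \<open>a I\<^sub>0 + b I\<^sub>1\<close> is annihilated by a linear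
  differential operator of order two with polynomial coefficients, which maps the rest of \<open>M\<close> to a
  function \<open>c' J\<^sub>0 + e' J\<^sub>1 +\<close> algebraic terms. A second operator of this kind removes the incomplete
  integrals. The result is \<open>v N'(z)\<close> divided by a positive function, and its zeros are roots of a
  polynomial.

  Each operator is a composition of two first order operators \<open>F \<mapsto> b F' - c F\<close>. By Rolle's theorem such
  an operator diminishes the number of zeros by at most one more than the number of zeros of \<open>b\<close>, with
  multiplicities (\<open>rolle_first_order\<close>). The coefficients \<open>b\<close> that occur are, up to factors without zeros, the
  combination \<open>f\<close> of complete integrals which the operator annihilates and the leading
  coefficient \<open>P\<close> of the operator. The zeros of \<open>f\<close> are estimated in the same way. That \<open>P\<close> is not
  identically zero is shown by a comparison of the exponents of the Picard-Fuchs system at its three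
  singular points (\<open>wedge_nabla_nonzero\<close>). An operator whose pair of coefficients has degree at most
  \<open>e\<close> costs \<open>8 e + 7\<close> zeros (\<open>zeros_le_annihilator\<close>). The total is
  \<open>27 m d + 62 m + 32 d + 38\<close> (\<open>zeros_le_melnikov_form\<close>), which is smaller than the bounds of the theorem since
  \<open>n \<ge> 2 d + 1\<close>.

  The integrals are made explicit by the coordinate \<open>u = x sqrt (1 - 2 x / 3)\<close>, in which the Hamiltonian is
  \<open>(u\<^sup>2 + y\<^sup>2) / 2\<close>. The ovals become circles, and the angle parametrizes them, their arcs and, through
  the time as a function of the angle, the closed orbits.\<close>

section \<open>Smooth functions and orders of vanishing\<close>

text \<open>The recursion is on the derivative of the function, which makes the closure properties below
  inductions on the order with the usual rules of calculus as induction step.\<close>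

fun diff_times :: "nat \<Rightarrow> real set \<Rightarrow> (real \<Rightarrow> real) \<Rightarrow> bool" where
  "diff_times 0 S f \<longleftrightarrow> True"
| "diff_times (Suc k) S f \<longleftrightarrow> (\<forall>x\<in>S. f field_differentiable at x) \<and> diff_times k S (deriv f)"

definition smooth :: "real set \<Rightarrow> (real \<Rightarrow> real) \<Rightarrow> bool" where
  "smooth S f \<longleftrightarrow> (\<forall>k. diff_times k S f)"

fun vanish :: "(real \<Rightarrow> real) \<Rightarrow> nat \<Rightarrow> real \<Rightarrow> bool" where
  "vanish f 0 x \<longleftrightarrow> True"
| "vanish f (Suc k) x \<longleftrightarrow> f x = 0 \<and> vanish (deriv f) k x"

lemma deriv_cong_open:
  fixes f g :: "real \<Rightarrow> real"
  assumes "open S" "x \<in> S" "\<And>y. y \<in> S \<Longrightarrow> f y = g y"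
  shows "deriv f x = deriv g x"
  using assms by (intro deriv_cong_ev) (auto simp: eventually_nhds)

lemma field_differentiable_cong_open:
  fixes f g :: "real \<Rightarrow> real"
  assumes "open S" "x \<in> S" "\<And>y. y \<in> S \<Longrightarrow> f y = g y" "f field_differentiable at x"
  shows "g field_differentiable at x"
proof -
  obtain d where "(f has_real_derivative d) (at x)"
    using assms(4) by (auto simp: field_differentiable_def)
  hence "(g has_real_derivative d) (at x)"
    by (rule has_field_derivative_transform_within_open[OF _ assms(1,2,3)])
  thus ?thesis by (auto simp: field_differentiable_def)
qed

lemma diff_times_cong:
  assumes "open S" "\<And>y. y \<in> S \<Longrightarrow> f y = g y" "diff_times k S f"
  shows "diff_times k S g"
  using assms
proof (induction k arbitrary: f g)
  case (Suc k)
  have "\<forall>x\<in>S. g field_differentiable at x"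
    using field_differentiable_cong_open[OF Suc.prems(1) _ Suc.prems(2)] Suc.prems(3) by auto
  moreover have "diff_times k S (deriv g)"
    using Suc.IH[of "deriv f" "deriv g"] Suc.prems deriv_cong_open[OF Suc.prems(1) _ Suc.prems(2)]
    by auto
  ultimately show ?case by simp
qed simp

lemma diff_times_mono: "diff_times (Suc k) S f \<Longrightarrow> diff_times k S f"
  by (induction k arbitrary: f) auto

lemma diff_timesI:
  assumes "open S" "\<And>x. x \<in> S \<Longrightarrow> (f has_real_derivative g x) (at x)" "diff_times k S g"
  shows "diff_times (Suc k) S f"
proof -
  have "\<forall>x\<in>S. f field_differentiable at x"
    using assms(2) by (auto simp: field_differentiable_def)
  moreover have "diff_times k S (deriv f)"
    using diff_times_cong[OF assms(1) _ assms(3), of "deriv f"] DERIV_imp_deriv[OF assms(2)] by auto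
  ultimately show ?thesis by simp
qed

lemma diff_times_deriv:
  assumes "diff_times (Suc k) S f" "x \<in> S"
  shows "(f has_real_derivative deriv f x) (at x)"
  using assms by (auto simp: DERIV_deriv_iff_field_differentiable)

lemma diff_times_const: "open S \<Longrightarrow> diff_times k S (\<lambda>_. c)"
proof (induction k arbitrary: c)
  case (Suc k)
  show ?case by (rule diff_timesI[where g = "\<lambda>_. 0"]) (use Suc in \<open>auto intro!: derivative_eq_intros\<close>)
qed simp

lemma diff_times_id: "open S \<Longrightarrow> diff_times k S (\<lambda>x. x)"
proof (induction k)
  case (Suc k)
  show ?case by (rule diff_timesI[where g = "\<lambda>_. 1"])
    (use Suc diff_times_const in \<open>auto intro!: derivative_eq_intros\<close>)
qed simp

lemma diff_times_add:
  assumes "open S" "diff_times k S f" "diff_times k S g"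
  shows "diff_times k S (\<lambda>x. f x + g x)"
  using assms
proof (induction k arbitrary: f g)
  case (Suc k)
  show ?case
    by (rule diff_timesI[where g = "\<lambda>x. deriv f x + deriv g x"])
       (use Suc diff_times_deriv in \<open>auto intro!: derivative_intros\<close>)
qed simp

lemma diff_times_mult:
  assumes "open S" "diff_times k S f" "diff_times k S g"
  shows "diff_times k S (\<lambda>x. f x * g x)"
  using assms
proof (induction k arbitrary: f g)
  case (Suc k)
  show ?case
  proof (rule diff_timesI[where g = "\<lambda>x. f x * deriv g x + deriv f x * g x"])
    show "diff_times k S (\<lambda>x. f x * deriv g x + deriv f x * g x)"
      using Suc.prems diff_times_mono by (intro diff_times_add Suc.IH) auto
    show "((\<lambda>x. f x * g x) has_real_derivative f x * deriv g x + deriv f x * g x) (at x)" if "x \<in> S" for x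
      using diff_times_deriv[OF Suc.prems(2) that] diff_times_deriv[OF Suc.prems(3) that]
      by (auto intro!: derivative_eq_intros)
  qed (use Suc in auto)
qed simp

lemma diff_times_inverse:
  assumes "open S" "diff_times k S f" "\<And>x. x \<in> S \<Longrightarrow> f x \<noteq> 0"
  shows "diff_times k S (\<lambda>x. inverse (f x))"
  using assms
proof (induction k)
  case (Suc k)
  note IH = Suc.IH[OF Suc.prems(1) diff_times_mono[OF Suc.prems(2)] Suc.prems(3)]
  show ?case
  proof (rule diff_timesI[where g = "\<lambda>x. (- 1) * (deriv f x * (inverse (f x) * inverse (f x)))"])
    show "diff_times k S (\<lambda>x. (- 1) * (deriv f x * (inverse (f x) * inverse (f x))))"
      using Suc.prems IH by (intro diff_times_mult diff_times_const) auto
    show "((\<lambda>x. inverse (f x)) has_real_derivative (- 1) * (deriv f x * (inverse (f x) * inverse (f x)))) (at x)"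
      if "x \<in> S" for x
      using diff_times_deriv[OF Suc.prems(2) that] Suc.prems(3)[OF that]
      by (auto intro!: derivative_eq_intros)
  qed (use Suc in auto)
qed simp

lemma diff_times_poly: "open S \<Longrightarrow> diff_times k S f \<Longrightarrow> diff_times k S (\<lambda>x. poly p (f x))"
  by (induction p) (auto intro!: diff_times_add diff_times_mult diff_times_const)

lemma smooth_iff: "smooth S f \<longleftrightarrow> (\<forall>x\<in>S. f field_differentiable at x) \<and> smooth S (deriv f)"
proof -
  have "smooth S f \<longleftrightarrow> (\<forall>k. diff_times (Suc k) S f)"
    unfolding smooth_def using diff_times_mono by blast
  thus ?thesis by (auto simp: smooth_def)
qed

lemma smooth_deriv [intro]: "smooth S f \<Longrightarrow> smooth S (deriv f)"
  using smooth_iff by blast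

lemma smooth_has_deriv: "smooth S f \<Longrightarrow> x \<in> S \<Longrightarrow> (f has_real_derivative deriv f x) (at x)"
  using smooth_iff[of S f] by (metis DERIV_deriv_iff_field_differentiable)

lemma smooth_isCont: "smooth S f \<Longrightarrow> x \<in> S \<Longrightarrow> isCont f x"
  using smooth_has_deriv DERIV_isCont by blast

lemma smooth_continuous_on: "smooth S f \<Longrightarrow> continuous_on S f"
  using smooth_isCont continuous_at_imp_continuous_on by blast

lemma smooth_subset: "smooth S f \<Longrightarrow> T \<subseteq> S \<Longrightarrow> smooth T f"
proof -
  have "diff_times k S f \<Longrightarrow> T \<subseteq> S \<Longrightarrow> diff_times k T f" for k
    by (induction k arbitrary: f) auto
  thus "smooth S f \<Longrightarrow> T \<subseteq> S \<Longrightarrow> smooth T f" by (auto simp: smooth_def)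
qed

lemma smooth_cong: "open S \<Longrightarrow> (\<And>y. y \<in> S \<Longrightarrow> f y = g y) \<Longrightarrow> smooth S f \<Longrightarrow> smooth S g"
  unfolding smooth_def using diff_times_cong by blast

lemma smooth_const [intro]: "open S \<Longrightarrow> smooth S (\<lambda>_. c)"
  and smooth_id [intro]: "open S \<Longrightarrow> smooth S (\<lambda>x. x)"
  and smooth_add [intro]: "open S \<Longrightarrow> smooth S f \<Longrightarrow> smooth S g \<Longrightarrow> smooth S (\<lambda>x. f x + g x)"
  and smooth_mult [intro]: "open S \<Longrightarrow> smooth S f \<Longrightarrow> smooth S g \<Longrightarrow> smooth S (\<lambda>x. f x * g x)"
  and smooth_inverse:
    "open S \<Longrightarrow> smooth S f \<Longrightarrow> (\<And>x. x \<in> S \<Longrightarrow> f x \<noteq> 0) \<Longrightarrow> smooth S (\<lambda>x. inverse (f x))"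
  by (auto simp: smooth_def diff_times_const diff_times_id diff_times_add diff_times_mult diff_times_inverse)

lemma smooth_divide: "open S \<Longrightarrow> smooth S f \<Longrightarrow> smooth S g \<Longrightarrow> (\<And>x. x \<in> S \<Longrightarrow> g x \<noteq> 0) \<Longrightarrow> smooth S (\<lambda>x. f x / g x)"
  unfolding divide_inverse by (intro smooth_mult smooth_inverse) auto

lemma smooth_diff [intro]:
  assumes "open S" "smooth S f" "smooth S g" shows "smooth S (\<lambda>x. f x - g x)"
proof -
  have "smooth S (\<lambda>x. f x + (- 1) * g x)" by (intro smooth_add smooth_mult smooth_const assms)
  thus ?thesis by simp
qed

lemma smooth_power [intro]:
  assumes "open S" "smooth S f" shows "smooth S (\<lambda>x. f x ^ n)"
  by (induction n) (use assms in auto)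

lemma smooth_poly [intro]:
  assumes "open S" "smooth S f" shows "smooth S (\<lambda>x. poly p (f x))"
  by (induction p) (use assms in auto)

lemma vanish_cong:
  assumes "open S" "x \<in> S" "\<And>y. y \<in> S \<Longrightarrow> f y = g y"
  shows "vanish f k x \<longleftrightarrow> vanish g k x"
  using assms
proof (induction k arbitrary: f g)
  case (Suc k)
  have "vanish (deriv f) k x = vanish (deriv g) k x"
    by (rule Suc.IH) (use Suc.prems deriv_cong_open[OF Suc.prems(1) _ Suc.prems(3)] in auto)
  thus ?case using Suc.prems by simp
qed simp

lemma vanish_iff: "vanish f k x \<longleftrightarrow> (\<forall>i<k. (deriv ^^ i) f x = 0)"
proof (induction k arbitrary: f)
  case (Suc k)
  show ?case
    unfolding vanish.simps Suc.IH
    by (auto simp: less_Suc_eq_0_disj funpow_swap1)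
qed simp

lemma vanish_mono: "vanish f k x \<Longrightarrow> j \<le> k \<Longrightarrow> vanish f j x"
  by (auto simp: vanish_iff)

lemma deriv_add_on:
  assumes "smooth S f" "smooth S g" "x \<in> S"
  shows "deriv (\<lambda>x. f x + g x) x = deriv f x + deriv g x"
  by (intro DERIV_imp_deriv DERIV_add smooth_has_deriv[OF _ assms(3)] assms)

lemma deriv_mult_on:
  assumes "smooth S f" "smooth S g" "x \<in> S"
  shows "deriv (\<lambda>x. f x * g x) x = deriv f x * g x + f x * deriv g x"
proof (rule DERIV_imp_deriv)
  show "((\<lambda>x. f x * g x) has_real_derivative deriv f x * g x + f x * deriv g x) (at x)"
    by (rule derivative_eq_intros smooth_has_deriv[OF _ assms(3)] assms refl)+ simp
qed

lemma vanish_add: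
  assumes "open S" "smooth S f" "smooth S g" "x \<in> S" "vanish f k x" "vanish g k x"
  shows "vanish (\<lambda>x. f x + g x) k x"
  using assms
proof (induction k arbitrary: f g)
  case (Suc k)
  have "vanish (\<lambda>x. deriv f x + deriv g x) k x"
    by (rule Suc.IH) (use Suc.prems smooth_deriv in auto)
  hence "vanish (deriv (\<lambda>x. f x + g x)) k x"
    using vanish_cong[OF Suc.prems(1,4), of "deriv (\<lambda>x. f x + g x)" "\<lambda>x. deriv f x + deriv g x"]
      deriv_add_on[OF Suc.prems(2,3)] by auto
  thus ?case using Suc.prems by simp
qed simp

lemma vanish_deriv_mult:
  assumes "open S" "smooth S f" "smooth S g" "x \<in> S"
    "vanish (\<lambda>x. deriv f x * g x) k x" "vanish (\<lambda>x. f x * deriv g x) k x"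
  shows "vanish (deriv (\<lambda>x. f x * g x)) k x"
proof -
  have "vanish (\<lambda>x. deriv f x * g x + f x * deriv g x) k x"
    by (rule vanish_add[OF assms(1) _ _ assms(4-6)]) (use assms(1-3) smooth_deriv in auto)
  thus ?thesis
    using vanish_cong[OF assms(1,4), of "deriv (\<lambda>x. f x * g x)" "\<lambda>x. deriv f x * g x + f x * deriv g x"]
      deriv_mult_on[OF assms(2,3)] by auto
qed

lemma vanish_mult_right:
  assumes "open S" "smooth S f" "smooth S g" "x \<in> S" "vanish g k x"
  shows "vanish (\<lambda>x. f x * g x) k x"
  using assms
proof (induction k arbitrary: f g)
  case (Suc k)
  have "vanish (deriv (\<lambda>x. f x * g x)) k x"
  proof (rule vanish_deriv_mult[OF Suc.prems(1-4)])
    show "vanish (\<lambda>x. deriv f x * g x) k x"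
      by (rule Suc.IH) (use Suc.prems(1-4) smooth_deriv vanish_mono[OF Suc.prems(5)] in auto)
    show "vanish (\<lambda>x. f x * deriv g x) k x"
      by (rule Suc.IH) (use Suc.prems smooth_deriv in auto)
  qed
  thus ?case using Suc.prems(5) by simp
qed simp

text \<open>A zero of the factor \<open>f\<close> raises the order of vanishing by one. This is why a first order
  operator \<open>F \<mapsto> b F' - c F\<close> does not lower the multiplicity of a zero of \<open>F\<close> at a zero of \<open>b\<close>.\<close>

lemma vanish_mult_Suc:
  assumes "open S" "smooth S f" "smooth S g" "x \<in> S" "f x = 0" "vanish g k x"
  shows "vanish (\<lambda>x. f x * g x) (Suc k) x"
  using assms
proof (induction k arbitrary: f g)
  case (Suc k)
  have "vanish (deriv (\<lambda>x. f x * g x)) (Suc k) x"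
  proof (rule vanish_deriv_mult[OF Suc.prems(1-4)])
    show "vanish (\<lambda>x. deriv f x * g x) (Suc k) x"
      by (rule vanish_mult_right[OF Suc.prems(1) smooth_deriv[OF Suc.prems(2)] Suc.prems(3,4,6)])
    show "vanish (\<lambda>x. f x * deriv g x) (Suc k) x"
      by (rule Suc.IH[OF Suc.prems(1,2) smooth_deriv[OF Suc.prems(3)] Suc.prems(4,5)])
        (use Suc.prems(6) in simp)
  qed
  thus ?case using Suc.prems(5) by simp
qed simp

lemma funpow_deriv_cong:
  fixes f g :: "real \<Rightarrow> real"
  assumes "open S" "x \<in> S" "\<And>y. y \<in> S \<Longrightarrow> f y = g y"
  shows "(deriv ^^ n) f x = (deriv ^^ n) g x"
  using assms
proof (induction n arbitrary: f g)
  case (Suc n)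
  have "(deriv ^^ n) (deriv f) x = (deriv ^^ n) (deriv g) x"
    by (rule Suc.IH[OF Suc.prems(1,2)]) (use deriv_cong_open[OF Suc.prems(1), of _ f g] Suc.prems(3) in blast)
  thus ?case by (simp add: funpow_swap1)
qed auto

lemma funpow_deriv_add:
  assumes "open S" "x \<in> S" "smooth S f" "smooth S g"
  shows "(deriv ^^ n) (\<lambda>x. f x + g x) x = (deriv ^^ n) f x + (deriv ^^ n) g x"
  using assms
proof (induction n arbitrary: f g)
  case (Suc n)
  have "(deriv ^^ n) (deriv (\<lambda>x. f x + g x)) x = (deriv ^^ n) (\<lambda>x. deriv f x + deriv g x) x"
    by (rule funpow_deriv_cong[OF Suc.prems(1,2)]) (rule deriv_add_on[OF Suc.prems(3,4)])
  also have "\<dots> = (deriv ^^ n) (deriv f) x + (deriv ^^ n) (deriv g) x"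
    by (rule Suc.IH) (use Suc.prems(1,2) smooth_deriv[OF Suc.prems(3)] smooth_deriv[OF Suc.prems(4)] in simp_all)
  finally show ?case by (simp add: funpow_swap1)
qed auto

text \<open>If \<open>f\<close> and \<open>g\<close> vanish at \<open>x\<close> to the orders \<open>a\<close> and \<open>b\<close>, all terms but one of the Leibniz
  formula for the derivative of order \<open>a + b\<close> of the product are zero at \<open>x\<close>. The constant is the
  binomial coefficient; only its sign matters.\<close>

lemma leibniz_lowest_order:
  assumes "open S" "x \<in> S" "smooth S f" "smooth S g" "vanish f a x" "vanish g b x"
  shows "\<exists>C>0. (deriv ^^ (a + b)) (\<lambda>x. f x * g x) x = C * ((deriv ^^ a) f x * (deriv ^^ b) g x)"
  using assms
proof (induction "a + b" arbitrary: a b f g)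
  case 0
  thus ?case by (auto intro!: exI[of _ 1])
next
  case (Suc n)
  let ?L = "\<lambda>x. deriv f x * g x" and ?R = "\<lambda>x. f x * deriv g x"
  have sm: "smooth S (deriv f)" "smooth S (deriv g)" "smooth S ?L" "smooth S ?R"
    using Suc.prems(1,3,4) smooth_deriv[OF Suc.prems(3)] smooth_deriv[OF Suc.prems(4)]
    by (auto simp del: funpow.simps)
  have "(deriv ^^ n) (deriv (\<lambda>x. f x * g x)) x = (deriv ^^ n) (\<lambda>x. ?L x + ?R x) x"
    by (rule funpow_deriv_cong[OF Suc.prems(1,2)]) (rule deriv_mult_on[OF Suc.prems(3,4)])
  also have "\<dots> = (deriv ^^ n) ?L x + (deriv ^^ n) ?R x"
    by (rule funpow_deriv_add[OF Suc.prems(1,2) sm(3,4)])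
  finally have *: "(deriv ^^ (a + b)) (\<lambda>x. f x * g x) x = (deriv ^^ n) ?L x + (deriv ^^ n) ?R x"
    by (simp add: funpow_swap1 flip: Suc.hyps(2))
  let ?X = "(deriv ^^ a) f x * (deriv ^^ b) g x"
  have L: "(a = 0 \<and> (deriv ^^ n) ?L x = 0) \<or> (\<exists>C>0. (deriv ^^ n) ?L x = C * ?X)"
  proof (cases a)
    case 0
    have "vanish ?L b x"
      by (rule vanish_mult_right) (use Suc.prems sm in auto)
    thus ?thesis using 0 Suc.hyps(2) by (auto simp: vanish_iff)
  next
    case a': (Suc a')
    have "\<exists>C>0. (deriv ^^ (a' + b)) ?L x = C * ((deriv ^^ a') (deriv f) x * (deriv ^^ b) g x)"
      by (rule Suc.hyps(1)[OF _ Suc.prems(1,2)]) (use Suc.prems(3-6) Suc.hyps(2) a' sm in auto)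
    moreover have "a' + b = n" using Suc.hyps(2) a' by simp
    ultimately show ?thesis using a' by (simp add: funpow_swap1)
  qed
  have R: "(b = 0 \<and> (deriv ^^ n) ?R x = 0) \<or> (\<exists>C>0. (deriv ^^ n) ?R x = C * ?X)"
  proof (cases b)
    case 0
    have "vanish (\<lambda>x. deriv g x * f x) a x"
      by (rule vanish_mult_right) (use Suc.prems sm in auto)
    hence "vanish ?R a x" by (simp add: mult.commute)
    thus ?thesis using 0 Suc.hyps(2) by (auto simp: vanish_iff)
  next
    case b': (Suc b')
    have "\<exists>C>0. (deriv ^^ (a + b')) ?R x = C * ((deriv ^^ a) f x * (deriv ^^ b') (deriv g) x)"
      by (rule Suc.hyps(1)[OF _ Suc.prems(1,2)]) (use Suc.prems(3-6) Suc.hyps(2) b' sm in auto)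
    moreover have "a + b' = n" using Suc.hyps(2) b' by simp
    ultimately show ?thesis using b' by (simp add: funpow_swap1)
  qed
  define X where "X = (deriv ^^ a) f x * (deriv ^^ b) g x"
  define l where "l = (deriv ^^ n) ?L x"
  define r where "r = (deriv ^^ n) ?R x"
  have "\<exists>C>0. l + r = C * X"
  proof -
    have L': "(a = 0 \<and> l = 0) \<or> (\<exists>C>0. l = C * X)" using L unfolding l_def X_def .
    have R': "(b = 0 \<and> r = 0) \<or> (\<exists>C>0. r = C * X)" using R unfolding r_def X_def .
    have "\<not> (a = 0 \<and> b = 0)" using Suc.hyps(2) by auto
    then consider "l = 0" "\<exists>C>0. r = C * X" | "r = 0" "\<exists>C>0. l = C * X"
      | C1 C2 where "C1 > 0" "C2 > 0" "l = C1 * X" "r = C2 * X"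
      using L' R' by blast
    thus ?thesis
    proof cases
      case (3 C1 C2)
      thus ?thesis by (intro exI[of _ "C1 + C2"]) (simp add: distrib_right)
    qed auto
  qed
  thus ?case unfolding * l_def r_def X_def .
qed

text \<open>The order of a product is the sum of the orders of its factors: otherwise the derivative given by
  \<open>leibniz_lowest_order\<close> would be both zero and nonzero.\<close>

lemma vanish_mult_split:
  assumes "open S" "x \<in> S" "smooth S f" "smooth S g" "vanish (\<lambda>x. f x * g x) k x"
  shows "\<exists>a\<le>k. vanish f a x \<and> vanish g (k - a) x"
proof (cases "vanish f k x")
  case False
  define a where "a = (LEAST j. \<not> vanish f j x)"
  have na: "\<not> vanish f a x" unfolding a_def using False by (rule LeastI)
  have "a \<le> k" unfolding a_def by (rule Least_le) (rule False)
  obtain a' where a': "a = Suc a'" using na by (cases a) auto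
  have va: "vanish f a' x" using not_less_Least[of a' "\<lambda>j. \<not> vanish f j x"] a' a_def by auto
  have da: "(deriv ^^ a') f x \<noteq> 0" using na va a' by (auto simp: vanish_iff less_Suc_eq)
  have "vanish g (k - a') x"
  proof (rule ccontr)
    assume H: "\<not> vanish g (k - a') x"
    define b where "b = (LEAST j. \<not> vanish g j x)"
    have nb: "\<not> vanish g b x" unfolding b_def using H by (rule LeastI)
    have "b \<le> k - a'" unfolding b_def by (rule Least_le) (rule H)
    obtain b' where b': "b = Suc b'" using nb by (cases b) auto
    have vb: "vanish g b' x" using not_less_Least[of b' "\<lambda>j. \<not> vanish g j x"] b' b_def by auto
    have db: "(deriv ^^ b') g x \<noteq> 0" using nb vb b' by (auto simp: vanish_iff less_Suc_eq)
    have "(deriv ^^ (a' + b')) (\<lambda>x. f x * g x) x \<noteq> 0"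
      using leibniz_lowest_order[OF assms(1-4) va vb] da db by auto
    moreover have "a' + b' < k" using \<open>b \<le> k - a'\<close> b' \<open>a \<le> k\<close> a' by auto
    ultimately show False using assms(5) by (auto simp: vanish_iff)
  qed
  thus ?thesis using va \<open>a \<le> k\<close> a' by (intro exI[of _ a']) auto
qed (auto intro!: exI[of _ k])

section \<open>Counting zeros with multiplicity\<close>

text \<open>A finite multiset of zeros of \<open>f\<close>, each taken at most with its multiplicity. A bound on the size
  of all these multisets is a bound on the number of zeros with multiplicity, and it includes the
  statement that the zeros are finitely many and of finite order.\<close>

definition zero_multiset :: "(real \<Rightarrow> real) \<Rightarrow> real multiset \<Rightarrow> bool" where
  "zero_multiset f A \<longleftrightarrow> (\<forall>x\<in>#A. vanish f (count A x) x)"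

definition zeros_le :: "real set \<Rightarrow> (real \<Rightarrow> real) \<Rightarrow> nat \<Rightarrow> bool" where
  "zeros_le S f N \<longleftrightarrow> (\<forall>A. set_mset A \<subseteq> S \<longrightarrow> zero_multiset f A \<longrightarrow> size A \<le> N)"

lemma zeros_leD: "zeros_le S f N \<Longrightarrow> set_mset A \<subseteq> S \<Longrightarrow> zero_multiset f A \<Longrightarrow> size A \<le> N"
  by (auto simp: zeros_le_def)

lemma zeros_le_mono: "zeros_le S f N \<Longrightarrow> N \<le> M \<Longrightarrow> zeros_le S f M"
  unfolding zeros_le_def by (meson le_trans)

lemma zeros_le_cong:
  assumes "open S" "\<And>x. x \<in> S \<Longrightarrow> f x = g x" "zeros_le S f N"
  shows "zeros_le S g N"
proof -
  have "zero_multiset f A" if "set_mset A \<subseteq> S" "zero_multiset g A" for A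
    using that vanish_cong[OF assms(1) _ assms(2)] by (auto simp: zero_multiset_def)
  thus ?thesis using assms(3) by (auto simp: zeros_le_def)
qed

lemma zero_multiset_vanish: "zero_multiset f A \<Longrightarrow> vanish f (count A x) x"
  by (cases "x \<in># A") (auto simp: zero_multiset_def not_in_iff)

lemma zeros_le_finite:
  assumes "zeros_le S f N"
  shows "finite {x\<in>S. f x = 0}" "card {x\<in>S. f x = 0} \<le> N"
proof -
  have *: "card X \<le> N" if "finite X" "X \<subseteq> {x\<in>S. f x = 0}" for X
  proof -
    have "zero_multiset f (mset_set X)"
      using that by (auto simp: zero_multiset_def)
    hence "size (mset_set X) \<le> N" using that by (intro zeros_leD[OF assms]) auto
    thus ?thesis by simp
  qed
  show "finite {x\<in>S. f x = 0}"
  proof (rule ccontr)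
    assume "infinite {x\<in>S. f x = 0}"
    then obtain X where "finite X" "card X = Suc N" "X \<subseteq> {x\<in>S. f x = 0}"
      using infinite_arbitrarily_large by blast
    thus False using * by fastforce
  qed
  thus "card {x\<in>S. f x = 0} \<le> N" using * by blast
qed

lemma zeros_le_order:
  assumes "zeros_le S f N" "x \<in> S"
  shows "\<not> vanish f (Suc N) x"
proof
  assume "vanish f (Suc N) x"
  hence "size (replicate_mset (Suc N) x) \<le> N"
    using assms by (intro zeros_leD[OF assms(1)]) (auto simp: zero_multiset_def)
  thus False by simp
qed

lemma zeros_le_nonzero: "(\<And>x. x \<in> S \<Longrightarrow> f x \<noteq> 0) \<Longrightarrow> zeros_le S f 0"
proof -
  assume nz: "\<And>x. x \<in> S \<Longrightarrow> f x \<noteq> 0"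
  have "A = {#}" if "set_mset A \<subseteq> S" "zero_multiset f A" for A
  proof (rule ccontr)
    assume "A \<noteq> {#}"
    then obtain x where x: "x \<in># A" by blast
    then obtain k where "count A x = Suc k" by (metis count_eq_zero_iff not0_implies_Suc)
    hence "f x = 0" using that(2) x by (fastforce simp: zero_multiset_def)
    thus False using that(1) x nz[of x] by blast
  qed
  thus ?thesis by (auto simp: zeros_le_def)
qed

lemma zeros_le_imp_zero_count:
  assumes "zeros_le S f N"
  shows "zero_count f S \<le> enat N"
proof -
  let ?Z = "{x\<in>S. f x = 0}"
  have fin: "finite ?Z" by (rule zeros_le_finite[OF assms])
  have ex: "\<exists>k. (deriv ^^ k) f x \<noteq> 0" if "x \<in> S" for x
    using zeros_le_order[OF assms that] by (auto simp: vanish_iff)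
  define ord where "ord x = (LEAST k. (deriv ^^ k) f x \<noteq> 0)" for x
  define A where "A = (\<Sum>x\<in>?Z. replicate_mset (ord x) x)"
  have cnt: "count A x = (if x \<in> ?Z then ord x else 0)" for x
    using fin by (simp add: A_def count_sum if_distrib cong: if_cong)
  have "zero_multiset f A"
    unfolding zero_multiset_def
  proof
    fix x assume "x \<in># A"
    hence "count A x = ord x" using cnt[of x] by (auto simp: count_eq_zero_iff split: if_splits)
    thus "vanish f (count A x) x"
      unfolding vanish_iff ord_def using not_less_Least by auto
  qed
  moreover have "set_mset A \<subseteq> S"
    using cnt by (auto simp: set_mset_def split: if_splits)
  ultimately have "size A \<le> N" by (rule zeros_leD[OF assms, rotated])
  moreover have "size A = (\<Sum>x\<in>?Z. ord x)"
    using fin by (simp add: A_def size_multiset_sum)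
  moreover have "(\<Sum>x\<in>X. enat (ord x)) = enat (\<Sum>x\<in>X. ord x)" for X
    by (induction X rule: infinite_finite_induct) (auto simp: zero_enat_def)
  ultimately have "(\<Sum>x\<in>?Z. enat (ord x)) \<le> enat N"
    by simp
  moreover have "vanishing_order f x = enat (ord x)" if "x \<in> ?Z" for x
    using ex[of x] that by (simp add: vanishing_order_def ord_def)
  ultimately show ?thesis using fin by (simp add: zero_count_def)
qed

lemma zeros_le_mult:
  assumes "open S" "smooth S f" "smooth S g" "zeros_le S f N" "zeros_le S g M"
  shows "zeros_le S (\<lambda>x. f x * g x) (N + M)"
  unfolding zeros_le_def
proof (intro allI impI)
  fix A assume A: "set_mset A \<subseteq> S" "zero_multiset (\<lambda>x. f x * g x) A"
  have "\<exists>a\<le>count A x. vanish f a x \<and> vanish g (count A x - a) x" if "x \<in># A" for x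
    using vanish_mult_split[OF assms(1) _ assms(2,3)] A that by (auto simp: zero_multiset_def)
  then obtain a where a: "\<And>x. x \<in># A \<Longrightarrow> a x \<le> count A x \<and> vanish f (a x) x \<and> vanish g (count A x - a x) x"
    by metis
  define B where "B = (\<Sum>x\<in>set_mset A. replicate_mset (a x) x)"
  have cB: "count B x = (if x \<in># A then a x else 0)" for x
    by (simp add: B_def count_sum if_distrib cong: if_cong)
  have BA: "B \<subseteq># A" using a cB by (auto simp: subseteq_mset_def)
  have "zero_multiset f B"
    using a cB by (auto simp: zero_multiset_def dest: mset_subset_eqD[OF BA])
  hence "size B \<le> N"
    using A mset_subset_eqD[OF BA] by (intro zeros_leD[OF assms(4)]) auto
  moreover have "zero_multiset g (A - B)"
    using a cB by (auto simp: zero_multiset_def dest: in_diffD)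
  hence "size (A - B) \<le> M"
    using A in_diffD by (intro zeros_leD[OF assms(5)]) fastforce+
  ultimately show "size A \<le> N + M" using size_Diff_submset[OF BA] size_mset_mono[OF BA] by simp
qed

section \<open>Rolle's theorem with multiplicities\<close>

text \<open>The integrating factor \<open>exp (- p)\<close>, where \<open>p\<close> is a primitive of \<open>c / b\<close>, turns \<open>b F' - c F\<close> into a
  multiple of a derivative, to which Rolle's theorem applies.\<close>

lemma first_order_rolle_point:
  fixes F b c :: "real \<Rightarrow> real"
  assumes "x < y" "{x..y} \<subseteq> S" "open S" "smooth S F" "smooth S b" "smooth S c"
    "F x = 0" "F y = 0" "\<And>t. t \<in> {x..y} \<Longrightarrow> b t \<noteq> 0"
  shows "\<exists>t\<in>{x<..<y}. b t * deriv F t - c t * F t = 0"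
proof -
  have cont: "continuous_on {x..y} (\<lambda>t. c t / b t)"
    using assms(2,9) smooth_continuous_on[OF assms(5)] smooth_continuous_on[OF assms(6)]
    by (intro continuous_intros) (auto intro: continuous_on_subset)
  obtain p where p: "\<And>t. t \<in> {x..y} \<Longrightarrow> (p has_vector_derivative (c t / b t)) (at t within {x..y})"
    using antiderivative_continuous[OF cont] by blast
  define G where "G = (\<lambda>t. F t * exp (- p t))"
  have "continuous_on {x..y} p"
    using has_vector_derivative_continuous[OF p] by (auto simp: continuous_on_eq_continuous_within)
  hence contG: "continuous_on {x..y} G"
    unfolding G_def using smooth_continuous_on[OF assms(4)] assms(2)
    by (intro continuous_intros) (auto intro: continuous_on_subset)
  have dG: "(G has_real_derivative (deriv F t * exp (- p t) - F t * exp (- p t) * (c t / b t))) (at t)"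
    if t: "x < t" "t < y" for t
  proof -
    have "(p has_real_derivative (c t / b t)) (at t)"
      using p[of t] t by (auto simp: has_real_derivative_iff_has_vector_derivative at_within_Icc_at)
    moreover have "(F has_real_derivative deriv F t) (at t)"
      by (rule smooth_has_deriv[OF assms(4)]) (rule subsetD[OF assms(2)], use t in simp)
    ultimately show ?thesis unfolding G_def
      by (auto intro!: derivative_eq_intros)
  qed
  define D where "D t = deriv F t * exp (- p t) - F t * exp (- p t) * (c t / b t)" for t
  have "G x = G y" using assms(7,8) by (simp add: G_def)
  from Rolle_deriv[OF assms(1) this contG, of "\<lambda>t v. D t * v"]
  obtain t where t: "x < t" "t < y" "(\<lambda>v. D t * v) = (\<lambda>v. 0)"
    using dG unfolding has_field_derivative_def D_def by blast
  from fun_cong[OF t(3), of 1] have "exp (- p t) * (deriv F t - F t * (c t / b t)) = 0"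
    by (simp add: algebra_simps D_def)
  hence "deriv F t = F t * (c t / b t)" by simp
  thus ?thesis using t assms(9)[of t] by (intro bexI[of _ t]) (auto simp: field_simps)
qed

definition first_order :: "(real \<Rightarrow> real) \<Rightarrow> (real \<Rightarrow> real) \<Rightarrow> (real \<Rightarrow> real) \<Rightarrow> real \<Rightarrow> real" where
  "first_order b c F = (\<lambda>x. b x * deriv F x - c x * F x)"

lemma first_order_vanish:
  assumes "open S" "smooth S F" "smooth S b" "smooth S c" "x \<in> S" "vanish F (Suc k) x"
  shows "vanish (first_order b c F) k x"
    and "b x = 0 \<Longrightarrow> vanish (first_order b c F) (Suc k) x"
proof -
  note sm = smooth_deriv[OF assms(2)]
  have *: "first_order b c F = (\<lambda>x. b x * deriv F x + (\<lambda>x. (-1) * c x) x * F x)"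
    by (simp add: first_order_def)
  have c: "smooth S (\<lambda>x. (-1) * c x)" by (rule smooth_mult[OF assms(1) smooth_const[OF assms(1)] assms(4)])
  have v: "vanish (\<lambda>x. (-1) * c x * F x) (Suc k) x"
    using vanish_mult_right[OF assms(1) c assms(2,5,6)] by simp
  have bF: "smooth S (\<lambda>x. b x * deriv F x)" "smooth S (\<lambda>x. (-1) * c x * F x)"
    by (rule smooth_mult[OF assms(1)], fact+)+
  show "vanish (first_order b c F) k x" unfolding *
    by (rule vanish_add[OF assms(1) bF assms(5) _ vanish_mono[OF v]])
      (use vanish_mult_right[OF assms(1,3) sm assms(5)] assms(6) in auto)
  show "vanish (first_order b c F) (Suc k) x" if "b x = 0" unfolding *
    by (rule vanish_add[OF assms(1) bF assms(5) _ v])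
      (use vanish_mult_Suc[OF assms(1,3) sm assms(5) that, of k] assms(6) in simp)
qed

text \<open>Every point of \<open>X\<close> loses one order, and every gap between two neighbours gives a new zero. All zeros
  of the conclusion are at most \<open>Max X\<close>, so that the induction can add points on the right.\<close>

lemma rolle_no_pole:
  assumes "smooth {l<..<r} F" "smooth {l<..<r} b" "smooth {l<..<r} c"
    "\<And>t. t \<in> {l<..<r} \<Longrightarrow> b t \<noteq> 0"
    "finite X" "X \<noteq> {}" "X \<subseteq> {l<..<r}" "\<And>x. x \<in> X \<Longrightarrow> vanish F (Suc (\<mu> x)) x"
  shows "\<exists>A. set_mset A \<subseteq> {l<..Max X} \<and> zero_multiset (first_order b c F) A \<and>
            sum (\<lambda>x. Suc (\<mu> x)) X \<le> size A + 1"
  using assms(5-8)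
proof (induction X rule: finite_linorder_max_induct)
  case (insert y X)
  let ?G = "first_order b c F"
  have y: "y \<in> {l<..<r}" "vanish F (Suc (\<mu> y)) y" using insert.prems by auto
  have vy: "vanish ?G (\<mu> y) y" using first_order_vanish(1)[OF _ assms(1-3) y] by simp
  show ?case
  proof (cases "X = {}")
    case True
    let ?A = "replicate_mset (\<mu> y) y"
    have "set_mset ?A \<subseteq> {l<..Max (insert y X)}" using y True by (auto split: if_splits)
    moreover have "zero_multiset ?G ?A" using vy by (auto simp: zero_multiset_def)
    ultimately show ?thesis using True by (intro exI[of _ ?A]) auto
  next
    case False
    from insert.IH[OF this] insert.prems obtain A where
      A: "set_mset A \<subseteq> {l<..Max X}" "zero_multiset ?G A" "sum (\<lambda>x. Suc (\<mu> x)) X \<le> size A + 1"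
      by auto
    define x where "x = Max X"
    have x: "x \<in> X" unfolding x_def using False insert.hyps by simp
    hence xy: "x < y" using insert.hyps by auto
    have "F x = 0" "F y = 0" using x insert.prems by force+
    moreover have "{x..y} \<subseteq> {l<..<r}" using x insert.prems by auto
    ultimately obtain t where t: "x < t" "t < y" "?G t = 0"
      using first_order_rolle_point[OF xy _ _ assms(1-3)] assms(4) 
      by (force simp: first_order_def)
    \<comment> \<open>The zero \<open>t\<close> lies between the two largest points.\<close>
    define B where "B = A + {#t#} + replicate_mset (\<mu> y) y"
    have tA: "count A t = 0" "count A y = 0"
      using A(1) t xy by (auto simp: count_eq_zero_iff x_def)
    have cA: "w \<noteq> t" "w \<noteq> y" if "w \<in># A" for w using that A(1) t xy by (auto simp: x_def)
    have "zero_multiset ?G B"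
      unfolding zero_multiset_def
    proof
      fix w assume w: "w \<in># B"
      consider "w = t" | "w = y" | "w \<noteq> t" "w \<noteq> y" "w \<in># A"
        using w by (auto simp: B_def split: if_splits)
      thus "vanish ?G (count B w) w"
      proof cases
        case 1 thus ?thesis using tA t by (simp add: B_def)
      next
        case 2 thus ?thesis using tA t vy by (simp add: B_def)
      next
        case 3 thus ?thesis using A(2) by (simp add: B_def zero_multiset_def)
      qed
    qed
    moreover have Max: "Max (insert y X) = y"
      using insert.hyps by (intro Max_eqI) auto
    moreover have "set_mset B \<subseteq> {l<..y}"
      using A(1) t xy y \<open>{x..y} \<subseteq> {l<..<r}\<close> by (fastforce simp: B_def x_def split: if_splits)
    moreover have "sum (\<lambda>x. Suc (\<mu> x)) (insert y X) \<le> size B + 1"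
      using insert.hyps A(3) by (subst sum.insert) (auto simp: B_def)
    ultimately show ?thesis by auto
  qed
qed simp

text \<open>Statements about the intervals between the points of \<open>B\<close> are extended across these points one at a
  time.\<close>

lemma split_interval_induct:
  fixes B :: "real set"
  assumes "finite B"
    and base: "\<And>l r. B \<inter> {l<..<r} = {} \<Longrightarrow> P l r"
    and step: "\<And>l z r. l < z \<Longrightarrow> z < r \<Longrightarrow> z \<in> B \<Longrightarrow> P l z \<Longrightarrow> P z r \<Longrightarrow> P l r"
  shows "P l r"
proof (induction "card (B \<inter> {l<..<r})" arbitrary: l r rule: less_induct)
  case less
  show ?case
  proof (cases "B \<inter> {l<..<r} = {}")
    case False
    then obtain z where z: "z \<in> B" "l < z" "z < r" by auto
    have "card (B \<inter> {l<..<z}) < card (B \<inter> {l<..<r})" "card (B \<inter> {z<..<r}) < card (B \<inter> {l<..<r})"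
      using z assms(1) by (auto intro!: psubset_card_mono)
    thus ?thesis using less step[OF z(2,3,1)] by blast
  qed (use base in blast)
qed

lemma split_interval: "l < z \<Longrightarrow> z < r \<Longrightarrow> {l<..<r} = insert z ({l<..<z} \<union> {z<..<r :: real})"
  by auto

text \<open>Rolle's theorem for the operator \<open>F \<mapsto> b F' - c F\<close>. Away from the zeros of \<open>b\<close> it is, up to an
  integrating factor, a derivative, and each of the intervals between them loses at most one zero.
  At the zeros of \<open>b\<close> the multiplicity does not drop.\<close>

lemma rolle_first_order_multiset:
  assumes "smooth {l<..<r} F" "smooth {l<..<r} b" "smooth {l<..<r} c" "finite {x\<in>{l<..<r}. b x = 0}"
    "set_mset A \<subseteq> {l<..<r}" "zero_multiset F A"
  shows "\<exists>A'. set_mset A' \<subseteq> {l<..<r} \<and> zero_multiset (first_order b c F) A' \<and>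
           size A \<le> size A' + card {x\<in>{l<..<r}. b x = 0} + 1"
proof -
  define B where "B = {x\<in>{l<..<r}. b x = 0}"
  define Q where "Q l' r' = ({l'<..<r'} \<subseteq> {l<..<r} \<longrightarrow> (\<forall>A. set_mset A \<subseteq> {l'<..<r'} \<longrightarrow> zero_multiset F A \<longrightarrow>
     (\<exists>A'. set_mset A' \<subseteq> {l'<..<r'} \<and> zero_multiset (first_order b c F) A' \<and>
           size A \<le> size A' + card (B \<inter> {l'<..<r'}) + 1)))" for l' r'
  let ?G = "first_order b c F"
  have "Q l r"
  proof (rule split_interval_induct[where B = B and P = Q])
    show "finite B" using assms(4) by (simp add: B_def)
    fix l' r' assume e: "B \<inter> {l'<..<r'} = {}"
    show "Q l' r'"
      unfolding Q_def
    proof (intro impI allI)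
      fix A assume sub: "{l'<..<r'} \<subseteq> {l<..<r}" and A: "set_mset A \<subseteq> {l'<..<r'}" "zero_multiset F A"
      show "\<exists>A'. set_mset A' \<subseteq> {l'<..<r'} \<and> zero_multiset ?G A' \<and> size A \<le> size A' + card (B \<inter> {l'<..<r'}) + 1"
      proof (cases "A = {#}")
        case True
        thus ?thesis by (intro exI[of _ "{#}"]) (auto simp: zero_multiset_def)
      next
        case False
        have c: "Suc (count A x - 1) = count A x" if "x \<in># A" for x using that by simp
        have nz: "b t \<noteq> 0" if "t \<in> {l'<..<r'}" for t
          using e subsetD[OF sub that] that unfolding B_def by blast
        have v: "vanish F (Suc (count A x - 1)) x" if "x \<in> set_mset A" for x
          using A(2) that unfolding c[OF that] zero_multiset_def by blast
        have ne: "set_mset A \<noteq> {}" using False by simp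
        from rolle_no_pole[OF smooth_subset[OF assms(1) sub] smooth_subset[OF assms(2) sub]
            smooth_subset[OF assms(3) sub] nz finite_set_mset ne A(1) v]
        obtain A' where A': "set_mset A' \<subseteq> {l'<..Max (set_mset A)}" "zero_multiset ?G A'"
          "sum (\<lambda>x. Suc (count A x - 1)) (set_mset A) \<le> size A' + 1" by auto
        have "Max (set_mset A) < r'" using A(1) False by auto
        hence "set_mset A' \<subseteq> {l'<..<r'}" using A'(1) by fastforce
        moreover have "size A = sum (\<lambda>x. Suc (count A x - 1)) (set_mset A)"
          unfolding size_multiset_overloaded_eq by (intro sum.cong) auto
        ultimately show ?thesis using A' by (intro exI[of _ A']) auto
      qed
    qed
  next
    fix l' z r' assume z: "l' < z" "z < r'" "z \<in> B" and Q: "Q l' z" "Q z r'"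
    show "Q l' r'"
      unfolding Q_def
    proof (intro impI allI)
      fix A assume sub: "{l'<..<r'} \<subseteq> {l<..<r}" and A: "set_mset A \<subseteq> {l'<..<r'}" "zero_multiset F A"
      define A1 where "A1 = filter_mset (\<lambda>x. x < z) A"
      define A2 where "A2 = filter_mset (\<lambda>x. z < x) A"
      have Aeq: "A = A1 + A2 + replicate_mset (count A z) z"
        by (rule multiset_eqI) (auto simp: A1_def A2_def)
      have sub': "{l'<..<z} \<subseteq> {l<..<r}" "{z<..<r'} \<subseteq> {l<..<r}" using sub z split_interval[OF z(1,2)] by auto
      have "set_mset A1 \<subseteq> {l'<..<z}" "zero_multiset F A1" "set_mset A2 \<subseteq> {z<..<r'}" "zero_multiset F A2"
        using A by (auto simp: A1_def A2_def zero_multiset_def)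
      then obtain A1' A2' where A': "set_mset A1' \<subseteq> {l'<..<z}" "zero_multiset ?G A1'"
         "size A1 \<le> size A1' + card (B \<inter> {l'<..<z}) + 1"
         "set_mset A2' \<subseteq> {z<..<r'}" "zero_multiset ?G A2'"
         "size A2 \<le> size A2' + card (B \<inter> {z<..<r'}) + 1"
        using Q sub' unfolding Q_def by metis
      define A' where "A' = A1' + A2' + replicate_mset (count A z) z"
      have cz: "count A1' z = 0" "count A2' z = 0" using A' by (auto simp: count_eq_zero_iff)
      have c1: "count A2' x = 0" "x \<noteq> z" if "x \<in># A1'" for x using A' that by (force simp: count_eq_zero_iff)+
      have c2: "count A1' x = 0" "x \<noteq> z" if "x \<in># A2'" for x using A' that by (force simp: count_eq_zero_iff)+
      have zin: "z \<in> {l<..<r}" "b z = 0" using z by (auto simp: B_def)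
      have vz: "vanish ?G (count A z) z"
      proof (cases "count A z")
        case (Suc k)
        thus ?thesis using first_order_vanish(2)[OF _ assms(1-3) zin(1) _ zin(2), of k]
            zero_multiset_vanish[OF A(2), of z] by auto
      qed simp
      have "zero_multiset ?G A'"
        unfolding zero_multiset_def
      proof
        fix w assume w: "w \<in># A'"
        consider "w = z" | "w \<in># A1'" | "w \<in># A2'"
          using w by (auto simp: A'_def split: if_splits)
        thus "vanish ?G (count A' w) w"
          by cases (use cz vz c1 c2 A'(2,5) in \<open>auto simp: A'_def zero_multiset_def\<close>)
      qed
      moreover have "set_mset A' \<subseteq> {l'<..<r'}"
        using A'(1,4) z by (force simp: A'_def split: if_splits)
      moreover have "card (B \<inter> {l'<..<r'}) = card (B \<inter> {l'<..<z}) + card (B \<inter> {z<..<r'}) + 1"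
      proof -
        have "finite B" using assms(4) by (simp add: B_def)
        moreover have "B \<inter> {l'<..<r'} = insert z ((B \<inter> {l'<..<z}) \<union> (B \<inter> {z<..<r'}))" using z by auto
        ultimately show ?thesis by (simp add: card_Un_disjoint disjoint_iff)
      qed
      moreover have "size A = size A1 + size A2 + count A z" using arg_cong[OF Aeq, of size] by simp
      moreover have "size A' = size A1' + size A2' + count A z" by (simp add: A'_def)
      ultimately show "\<exists>A'. set_mset A' \<subseteq> {l'<..<r'} \<and> zero_multiset ?G A' \<and> size A \<le> size A' + card (B \<inter> {l'<..<r'}) + 1"
        using A'(3,6) by (intro exI[of _ A']) auto
    qed
  qed
  moreover have "B \<inter> {l<..<r} = {x\<in>{l<..<r}. b x = 0}" by (auto simp: B_def)
  ultimately show ?thesis using assms(5,6) unfolding Q_def by auto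
qed

theorem rolle_first_order:
  assumes "smooth {l<..<r} F" "smooth {l<..<r} b" "smooth {l<..<r} c" "zeros_le {l<..<r} b K"
    "zeros_le {l<..<r} (first_order b c F) N"
  shows "zeros_le {l<..<r} F (N + K + 1)"
  unfolding zeros_le_def
proof (intro allI impI)
  fix A assume "set_mset A \<subseteq> {l<..<r}" "zero_multiset F A"
  then obtain A' where "set_mset A' \<subseteq> {l<..<r}" "zero_multiset (first_order b c F) A'"
     "size A \<le> size A' + card {x\<in>{l<..<r}. b x = 0} + 1"
    using rolle_first_order_multiset[OF assms(1-3) zeros_le_finite(1)[OF assms(4)]] by blast
  moreover from this have "size A' \<le> N" by (intro zeros_leD[OF assms(5)])
  ultimately show "size A \<le> N + K + 1" using zeros_le_finite(2)[OF assms(4)] by linarith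
qed



lemma vanish_at_endpoint:
  fixes f :: "real \<Rightarrow> real"
  assumes "open S" "smooth S f" "z \<in> S" "at z within T \<noteq> bot" "open T" "\<And>x. x \<in> T \<Longrightarrow> f x = 0"
  shows "vanish f k z"
  using assms(2,6)
proof (induction k arbitrary: f)
  case (Suc k)
  have "(f \<longlongrightarrow> f z) (at z within T)"
    using smooth_isCont[OF Suc.prems(1) assms(3)] continuous_at_imp_continuous_at_within
    by (auto simp: continuous_within)
  moreover have "(f \<longlongrightarrow> 0) (at z within T)"
    by (rule tendsto_eventually) (use Suc.prems(2) in \<open>auto simp: eventually_at_filter\<close>)
  ultimately have "f z = 0" using tendsto_unique[OF assms(4)] by blast
  moreover have "deriv f x = 0" if "x \<in> T" for x
    using deriv_cong_open[OF assms(5) that, of f "\<lambda>_. 0"] Suc.prems(2) by simp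
  ultimately show ?case using Suc.IH[OF smooth_deriv[OF Suc.prems(1)]] by simp
qed simp

text \<open>The kernel of the operator \<open>F \<mapsto> b F' - b' F\<close>. Between two zeros of \<open>b\<close> the quotient \<open>F / b\<close>
  is constant; since \<open>b\<close> vanishes to finite order at its zeros, the smoothness of \<open>F\<close> forces the
  constants on both sides of a zero to agree.\<close>

theorem proportional_of_wronskian_zero:
  assumes F: "smooth {l<..<r} F" and b: "smooth {l<..<r} b" and zb: "zeros_le {l<..<r} b K"
    and W: "\<And>x. x \<in> {l<..<r} \<Longrightarrow> b x * deriv F x - deriv b x * F x = 0"
  shows "\<exists>c. \<forall>x\<in>{l<..<r}. F x = c * b x"
proof -
  define B where "B = {x\<in>{l<..<r}. b x = 0}"
  define Q where "Q l' r' = ({l'<..<r'} \<subseteq> {l<..<r} \<longrightarrow> (\<exists>c. \<forall>x\<in>{l'<..<r'}. F x = c * b x))" for l' r'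
  have smd: "smooth {l<..<r} (\<lambda>x. F x - c * b x)" for c
    by (intro smooth_diff smooth_mult smooth_const F b) auto
  have "Q l r"
  proof (rule split_interval_induct[where B = B and P = Q])
    show "finite B" unfolding B_def by (rule zeros_le_finite[OF zb])
    fix l' r' assume e: "B \<inter> {l'<..<r'} = {}"
    show "Q l' r'" unfolding Q_def
    proof (intro impI)
      assume sub: "{l'<..<r'} \<subseteq> {l<..<r}"
      have nz: "b t \<noteq> 0" if "t \<in> {l'<..<r'}" for t
        using e subsetD[OF sub that] that unfolding B_def by blast
      have "((\<lambda>t. F t / b t) has_real_derivative 0) (at t)" if t: "t \<in> {l'<..<r'}" for t
      proof -
        have "t \<in> {l<..<r}" using sub t by blast
        note d = smooth_has_deriv[OF F this] smooth_has_deriv[OF b this] W[OF this]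
        have "((\<lambda>t. F t / b t) has_real_derivative (deriv F t * b t - F t * deriv b t) / (b t * b t)) (at t)"
          by (rule DERIV_divide[OF d(1,2) nz[OF t]])
        moreover have "deriv F t * b t - F t * deriv b t = 0" using d(3) by (simp add: algebra_simps)
        ultimately show ?thesis by simp
      qed
      hence "\<exists>c. \<forall>t\<in>{l'<..<r'}. F t / b t = c"
        by (intro has_field_derivative_zero_constant) (auto intro: has_field_derivative_at_within)
      then obtain c where "\<And>t. t \<in> {l'<..<r'} \<Longrightarrow> F t / b t = c" by auto
      thus "\<exists>c. \<forall>x\<in>{l'<..<r'}. F x = c * b x" using nz by (intro exI[of _ c]) (auto simp: field_simps)
    qed
  next
    fix l' z r' assume z: "l' < z" "z < r'" "z \<in> B" and Q: "Q l' z" "Q z r'"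
    show "Q l' r'" unfolding Q_def
    proof (intro impI)
      assume sub: "{l'<..<r'} \<subseteq> {l<..<r}"
      hence sub': "{l'<..<z} \<subseteq> {l<..<r}" "{z<..<r'} \<subseteq> {l<..<r}" using z split_interval[OF z(1,2)] by auto
      obtain c1 c2 where c: "\<And>x. x \<in> {l'<..<z} \<Longrightarrow> F x = c1 * b x" "\<And>x. x \<in> {z<..<r'} \<Longrightarrow> F x = c2 * b x"
        using Q sub' unfolding Q_def by blast
      have zS: "z \<in> {l<..<r}" using z by (auto simp: B_def)
      have nt: "at z within {l'<..<z} \<noteq> bot" "at z within {z<..<r'} \<noteq> bot"
        using z islimpt_greaterThanLessThan1[of z r'] islimpt_greaterThanLessThan2[of l' z]
        by (auto simp: trivial_limit_within)
      have v1: "vanish (\<lambda>x. F x - c1 * b x) k z" for k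
        by (rule vanish_at_endpoint[OF _ smd zS nt(1)]) (use c in auto)
      have v2: "vanish (\<lambda>x. F x - c2 * b x) k z" for k
        by (rule vanish_at_endpoint[OF _ smd zS nt(2)]) (use c in auto)
      \<comment> \<open>Otherwise \<open>b\<close> would vanish at \<open>z\<close> to infinite order.\<close>
      have "c1 = c2"
      proof (rule ccontr)
        assume ne: "c1 \<noteq> c2"
        have "vanish (\<lambda>x. (- 1) * (F x - c1 * b x)) (Suc K) z"
          by (rule vanish_mult_right[OF _ smooth_const smd zS v1]) auto
        hence "vanish (\<lambda>x. (F x - c2 * b x) + (- 1) * (F x - c1 * b x)) (Suc K) z"
          by (intro vanish_add[OF _ smd _ zS v2] smooth_mult[OF _ smooth_const smd]) auto
        hence "vanish (\<lambda>x. 1 / (c1 - c2) * ((F x - c2 * b x) + (- 1) * (F x - c1 * b x))) (Suc K) z"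
          by (intro vanish_mult_right[OF _ smooth_const _ zS] smooth_add smd smooth_mult[OF _ smooth_const smd]) auto
        moreover have "(\<lambda>x. 1 / (c1 - c2) * ((F x - c2 * b x) + (- 1) * (F x - c1 * b x))) = b"
          using ne by (intro ext) (simp add: field_simps)
        ultimately have "vanish b (Suc K) z" by (simp only:)
        thus False using zeros_le_order[OF zb zS] by blast
      qed
      moreover have "F z = c1 * b z" using v1[of 1] by simp
      ultimately have "F x = c1 * b x" if "x \<in> {l'<..<r'}" for x
        using c that split_interval[OF z(1,2)] by auto
      thus "\<exists>c. \<forall>x\<in>{l'<..<r'}. F x = c * b x" by blast
    qed
  qed
  thus ?thesis by (auto simp: Q_def)
qed

lemma zeros_le_cmult:
  assumes "open S" "smooth S f" "zeros_le S f N" "c \<noteq> 0"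
  shows "zeros_le S (\<lambda>x. c * f x) N"
  using zeros_le_mult[OF assms(1) _ assms(2) _ assms(3), of "\<lambda>_. c" 0] assms(1,4)
  by (auto intro: zeros_le_nonzero)

text \<open>Repeated differentiation of the polynomial: since \<open>z'\<close> has no zeros, each step loses at most one
  zero by Rolle's theorem.\<close>

lemma zeros_le_poly_comp:
  assumes "smooth {l<..<r} z" "\<And>x. x \<in> {l<..<r} \<Longrightarrow> deriv z x \<noteq> 0" "p \<noteq> 0"
  shows "zeros_le {l<..<r} (\<lambda>x. poly p (z x)) (degree p)"
  using assms(3)
proof (induction "degree p" arbitrary: p)
  case 0
  then obtain c where "p = [:c:]" "c \<noteq> 0" by (metis degree_eq_zeroE pCons_0_0)
  thus ?case by (auto intro: zeros_le_nonzero)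
next
  case (Suc n)
  let ?S = "{l<..<r}"
  have deg: "degree (pderiv p) = n" using Suc.hyps(2) by (simp add: degree_pderiv)
  have "pderiv p \<noteq> 0" using Suc.hyps(2) by (simp add: pderiv_eq_0_iff)
  note IH = Suc.hyps(1)[of "pderiv p", unfolded deg, OF refl this]
  have sm: "smooth ?S (\<lambda>x. poly q (z x))" for q using assms(1) by (intro smooth_poly) auto
  have "zeros_le ?S (\<lambda>x. poly (pderiv p) (z x) * deriv z x) (n + 0)"
    by (rule zeros_le_mult) (use sm IH assms(1,2) in \<open>auto intro: zeros_le_nonzero\<close>)
  moreover have "poly (pderiv p) (z x) * deriv z x = first_order (\<lambda>_. 1) (\<lambda>_. 0) (\<lambda>x. poly p (z x)) x"
    if "x \<in> ?S" for x
    using DERIV_imp_deriv[OF DERIV_chain2[OF poly_DERIV smooth_has_deriv[OF assms(1) that]], of p]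
    by (simp add: first_order_def)
  ultimately have "zeros_le ?S (first_order (\<lambda>_. 1) (\<lambda>_. 0) (\<lambda>x. poly p (z x))) n"
    using zeros_le_cong[of ?S "\<lambda>x. poly (pderiv p) (z x) * deriv z x" _ n] by simp
  hence "zeros_le ?S (\<lambda>x. poly p (z x)) (n + 0 + 1)"
    by (intro rolle_first_order[where b = "\<lambda>_. 1" and c = "\<lambda>_. 0"]) (use sm in \<open>auto intro: zeros_le_nonzero\<close>)
  thus ?case using Suc.hyps(2) by simp
qed

lemma zeros_le_poly:
  assumes "p \<noteq> 0"
  shows "zeros_le {l<..<r} (poly p) (degree p)"
proof -
  have "deriv (\<lambda>x::real. x) y \<noteq> 0" for y by (simp add: DERIV_imp_deriv)
  from zeros_le_poly_comp[of l r "\<lambda>x. x" p, OF _ this assms] smooth_id show ?thesis by simp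
qed

section \<open>The Picard-Fuchs connection\<close>

text \<open>The Picard-Fuchs equations of the family of ovals are singular at \<open>h = 0\<close> (the center) and at
  \<open>h = 1/6\<close> (the saddle). The derivation \<open>Delta * d/dh\<close> keeps their coefficients polynomial.\<close>

definition Delta :: "real poly" where "Delta = [:0, -1, 6:]"

type_synonym covector = "real poly \<times> real poly"

text \<open>A pair \<open>(a, b)\<close> stands for the function \<open>a I\<^sub>0 + b I\<^sub>1\<close>, where \<open>I\<^sub>0\<close>, \<open>I\<^sub>1\<close> solve the
  Picard-Fuchs system of the locale \<open>picard_fuchs\<close> below. Its image under \<open>Delta * d/dh\<close> is a function
  of the same kind, with the coefficients \<open>nabla (a, b)\<close>.\<close>

definition nabla :: "covector \<Rightarrow> covector" where
  "nabla r = (Delta * pderiv (fst r) + [:-1, 5:] * fst r - [:0, 1:] * snd r,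
              Delta * pderiv (snd r) + [:7/6:] * fst r + [:0, 7:] * snd r)"

definition wedge :: "covector \<Rightarrow> covector \<Rightarrow> real poly" where
  "wedge r s = fst r * snd s - snd r * fst s"

lemma poly_Delta: "poly Delta h = h * (6 * h - 1)"
  by (simp add: Delta_def algebra_simps)

lemma Delta_nonzero: "h \<in> {0<..<1/6} \<Longrightarrow> poly Delta h \<noteq> 0"
  by (auto simp: poly_Delta)

lemma degree_Delta: "degree Delta = 2" by (simp add: Delta_def)

lemma pderiv_Delta: "pderiv Delta = [:-1, 12:]"
  by (simp add: Delta_def pderiv_pCons)

definition deg_le :: "nat \<Rightarrow> covector \<Rightarrow> bool" where
  "deg_le d r \<longleftrightarrow> degree (fst r) \<le> d \<and> degree (snd r) \<le> d"

lemma degree_mult_le_add: "degree p \<le> a \<Longrightarrow> degree q \<le> b \<Longrightarrow> degree (p * q) \<le> a + b"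
  for p q :: "real poly"
  using degree_mult_le[of p q] by linarith

lemma degree_Delta_pderiv:
  assumes "degree p \<le> d" shows "degree (Delta * pderiv p) \<le> Suc d"
proof (cases "degree p")
  case 0
  hence "pderiv p = 0" by (simp add: pderiv_eq_0_iff)
  thus ?thesis by simp
next
  case (Suc k)
  have "degree (pderiv p) \<le> k" using Suc by (simp add: degree_pderiv)
  thus ?thesis using degree_mult_le_add[of Delta 2 "pderiv p" k] Suc assms by (simp add: degree_Delta)
qed

lemma deg_le_nabla: "deg_le d r \<Longrightarrow> deg_le (Suc d) (nabla r)"
  unfolding deg_le_def nabla_def fst_conv snd_conv
proof (intro conjI degree_add_le degree_diff_le)
  assume "degree (fst r) \<le> d \<and> degree (snd r) \<le> d"
  hence d: "degree (fst r) \<le> d" "degree (snd r) \<le> d" by auto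
  show "degree (Delta * pderiv (fst r)) \<le> Suc d" "degree (Delta * pderiv (snd r)) \<le> Suc d"
    using d degree_Delta_pderiv by auto
  show "degree ([:-1, 5:] * fst r) \<le> Suc d" "degree ([:0, 1:] * snd r) \<le> Suc d"
     "degree ([:7/6:] * fst r) \<le> Suc d" "degree ([:0, 7:] * snd r) \<le> Suc d"
    using d by (auto simp del: mult_pCons_left intro!: order_trans[OF degree_mult_le_add[of _ 1, OF _ order_refl]])
qed

lemma degree_wedge:
  assumes "deg_le a r" "deg_le b s" shows "degree (wedge r s) \<le> a + b"
  using assms unfolding wedge_def deg_le_def
  by (intro degree_diff_le degree_mult_le_add) auto

lemma nabla_smult:
  "nabla (g * a, g * b) =
     (g * fst (nabla (a, b)) + Delta * pderiv g * a, g * snd (nabla (a, b)) + Delta * pderiv g * b)"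
  by (simp add: nabla_def pderiv_mult algebra_simps)

text \<open>If \<open>nabla (a, b)\<close> were a multiple \<open>l (a, b)\<close>, then \<open>l\<close> would have degree one, and its values at the
  singular points would be eigenvalues of the matrix of \<open>nabla\<close> there: \<open>0\<close> or \<open>-1\<close> at \<open>h = 0\<close>, \<open>0\<close> or \<open>1\<close> at
  \<open>h = 1/6\<close>. Hence the leading coefficient of \<open>l\<close> would be \<open>0\<close>, \<open>6\<close> or \<open>12\<close>. But it is determined at
  infinity as \<open>6 deg a + 5\<close> or \<open>6 deg b + 7\<close>, because the elliptic integrals grow
  there like \<open>h\<close> to the powers \<open>5/6\<close> and \<open>7/6\<close>, which are not integers.\<close>

lemma no_rational_eigenline:
  fixes a b l :: "real poly"
  assumes cop: "coprime a b" and nz: "a \<noteq> 0" "b \<noteq> 0"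
    and e1: "fst (nabla (a, b)) = l * a" and e2: "snd (nabla (a, b)) = l * b"
  shows False
proof -
  define p where "p = degree a"
  define q where "q = degree b"
  have nc: "\<not> (poly a t = 0 \<and> poly b t = 0)" for t
    using cop coprime_poly_0[of a b t] by auto
  have E1: "poly (Delta * pderiv a) t + (5 * t - 1) * poly a t - t * poly b t = poly l t * poly a t" for t
    using arg_cong[OF e1, of "\<lambda>p. poly p t"] by (simp add: nabla_def algebra_simps)
  have E2: "poly (Delta * pderiv b) t + 7/6 * poly a t + 7 * t * poly b t = poly l t * poly b t" for t
    using arg_cong[OF e2, of "\<lambda>p. poly p t"] by (simp add: nabla_def algebra_simps)
  \<comment> \<open>The value at the center is an eigenvalue of the matrix of nabla there.\<close>
  have l0: "poly l 0 = 0 \<or> poly l 0 = -1"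
  proof -
    have 1: "- poly a 0 = poly l 0 * poly a 0" and 2: "7/6 * poly a 0 = poly l 0 * poly b 0"
      using E1[of 0] E2[of 0] by (auto simp: poly_Delta)
    have "(poly l 0 + 1) * poly a 0 = 0" using 1 by (simp add: algebra_simps)
    thus ?thesis using 2 nc[of 0] by auto
  qed
  \<comment> \<open>The value at the saddle is an eigenvalue of the matrix of nabla there.\<close>
  have l1: "poly l (1/6) = 0 \<or> poly l (1/6) = 1"
  proof -
    define A B L where "A = poly a (1/6)" and "B = poly b (1/6)" and "L = poly l (1/6)"
    have 1: "- A / 6 - B / 6 = L * A" and 2: "7/6 * A + 7/6 * B = L * B"
      using E1[of "1/6"] E2[of "1/6"] by (auto simp: poly_Delta A_def B_def L_def)
    have "L * (7 * A + B) = 0" using 1 2 by (simp add: algebra_simps)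
    moreover have "L = 1" if "7 * A + B = 0"
    proof -
      have B: "B = -7 * A" using that by simp
      hence "A \<noteq> 0" using nc[of "1/6"] by (auto simp: A_def B_def)
      thus ?thesis using 1 B by simp
    qed
    ultimately show ?thesis by (auto simp: L_def)
  qed
  have dl: "degree l \<le> 1"
  proof (cases "q \<le> p")
    case True
    have "degree (fst (nabla (a, b))) \<le> Suc p"
      using deg_le_nabla[of p "(a, b)"] True by (auto simp: deg_le_def p_def q_def)
    moreover have "l = 0 \<or> degree (l * a) = degree l + p" using nz degree_mult_eq[of l a] by (auto simp: p_def)
    ultimately show ?thesis using e1 by auto
  next
    case False
    have "degree (snd (nabla (a, b))) \<le> Suc q"
      using deg_le_nabla[of q "(a, b)"] False by (auto simp: deg_le_def p_def q_def)
    moreover have "l = 0 \<or> degree (l * b) = degree l + q" using nz degree_mult_eq[of l b] by (auto simp: q_def)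
    ultimately show ?thesis using e2 by auto
  qed
  obtain c0 c1 where l: "l = [:c0, c1:]"
  proof
    show "l = [:coeff l 0, coeff l 1:]"
      using dl by (intro poly_eqI) (auto simp: coeff_pCons coeff_eq_0 split: nat.split)
  qed
  have lead: "coeff (Delta * pderiv u) (Suc (degree u)) = 6 * real (degree u) * lead_coeff u" for u
  proof (cases "degree u")
    case 0
    hence "pderiv u = 0" by (simp add: pderiv_eq_0_iff)
    thus ?thesis using 0 by simp
  next
    case (Suc k)
    have "degree (pderiv u) = k" using Suc by (simp add: degree_pderiv)
    hence "coeff (Delta * pderiv u) (2 + k) = coeff Delta 2 * coeff (pderiv u) k"
      using coeff_mult_degree_sum[of Delta "pderiv u"] by (simp add: degree_Delta)
    thus ?thesis using Suc by (simp add: Delta_def coeff_pderiv numeral_2_eq_2)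
  qed
  have lead1: "coeff ([:k0, k1:] * w) (Suc (degree w)) = k1 * lead_coeff w" for k0 k1 and w :: "real poly"
    by (simp add: coeff_pCons coeff_eq_0)
  have high: "coeff ([:k0, k1:] * w) n = 0" if "Suc (degree w) < n" for k0 k1 n and w :: "real poly"
    using that by (cases n) (auto simp: coeff_pCons coeff_eq_0)
  \<comment> \<open>Comparison of leading terms, in the first component if \<open>deg a > deg b\<close> and otherwise in the second,
    where the other entry is of lower order.\<close>
  have C1: "c1 = 6 * real p + 5 \<or> c1 = 6 * real q + 7"
  proof (cases "q < p")
    case True
    have "coeff (fst (nabla (a, b))) (Suc p) = c1 * lead_coeff a"
      unfolding e1 l by (simp only: p_def lead1)
    hence "(6 * real p + 5) * lead_coeff a = c1 * lead_coeff a"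
      using lead[of a] lead1[of "-1" 5 a] high[of b "Suc p" 0 1] True
      unfolding nabla_def fst_conv snd_conv coeff_add coeff_diff
      by (simp add: p_def q_def algebra_simps)
    thus ?thesis using nz by simp
  next
    case False
    have "coeff (snd (nabla (a, b))) (Suc q) = c1 * lead_coeff b"
      unfolding e2 l by (simp only: q_def lead1)
    moreover have "coeff ([:7/6:] * a) (Suc q) = 0" using False by (simp add: p_def q_def coeff_eq_0)
    ultimately have "(6 * real q + 7) * lead_coeff b = c1 * lead_coeff b"
      using lead[of b] lead1[of 0 7 b]
      unfolding nabla_def fst_conv snd_conv coeff_add coeff_diff
      by (simp add: q_def algebra_simps)
    thus ?thesis using nz by simp
  qed
  have "c0 + c1 / 6 = 0 \<or> c0 + c1 / 6 = 1" "c0 = 0 \<or> c0 = -1"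
    using l0 l1 by (auto simp: l)
  hence "c1 = real 0 \<or> c1 = real 6 \<or> c1 = real 12" by auto
  moreover have "c1 = real (6 * p + 5) \<or> c1 = real (6 * q + 7)" using C1 by auto
  ultimately have "6 * p + 5 \<in> {0, 6, 12} \<or> 6 * q + 7 \<in> {0, 6, 12}"
    by (auto simp only: of_nat_eq_iff insert_iff empty_iff)
  thus False unfolding insert_iff empty_iff by presburger
qed

text \<open>The second order operator that annihilates \<open>a I\<^sub>0 + b I\<^sub>1\<close> has this wedge as its leading
  coefficient, so it is really of second order. After division by a common factor of \<open>a\<close> and \<open>b\<close>, a
  vanishing wedge would make \<open>(a, b)\<close> an eigenline of \<open>nabla\<close>.\<close>

theorem wedge_nabla_nonzero:
  assumes "r \<noteq> (0, 0)"
  shows "wedge r (nabla r) \<noteq> 0"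
proof
  assume W: "wedge r (nabla r) = 0"
  obtain a b where r: "r = (a, b)" by (cases r)
  have a: "a \<noteq> 0"
  proof
    assume "a = 0"
    hence "wedge r (nabla r) = b * [:0, 1:] * b" by (simp add: r wedge_def nabla_def)
    thus False using W assms r \<open>a = 0\<close> by simp
  qed
  have b: "b \<noteq> 0"
  proof
    assume "b = 0"
    hence "wedge r (nabla r) = a * [:7/6:] * a" by (simp add: r wedge_def nabla_def)
    thus False using W a by simp
  qed
  obtain g a' b' where g: "a = g * a'" "b = g * b'" "coprime a' b'"
    using gcd_coprime_exists[of a b] a by (metis gcd_eq_0_iff mult.commute)
  have nz: "g \<noteq> 0" "a' \<noteq> 0" "b' \<noteq> 0" using a b g by auto
  have "wedge r (nabla r) = g * g * (a' * snd (nabla (a', b')) - b' * fst (nabla (a', b')))"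
    unfolding r g wedge_def nabla_smult by (simp add: algebra_simps)
  hence *: "a' * snd (nabla (a', b')) = b' * fst (nabla (a', b'))" using W nz by simp
  hence "a' dvd fst (nabla (a', b'))"
    using g(3) by (metis coprime_dvd_mult_right_iff dvd_triv_left)
  then obtain l where l: "fst (nabla (a', b')) = l * a'" by (metis dvd_def mult.commute)
  hence "snd (nabla (a', b')) = l * b'" using * nz by (simp add: mult_ac)
  thus False using no_rational_eigenline[OF g(3) nz(2,3) l] by blast
qed

lemma poly_nabla:
  "poly (fst (nabla r)) h = poly Delta h * poly (pderiv (fst r)) h + (5 * h - 1) * poly (fst r) h - h * poly (snd r) h"
  "poly (snd (nabla r)) h = poly Delta h * poly (pderiv (snd r)) h + 7/6 * poly (fst r) h + 7 * h * poly (snd r) h"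
  by (simp_all add: nabla_def algebra_simps)

lemma poly_wedge: "poly (wedge r s) h = poly (fst r) h * poly (snd s) h - poly (snd r) h * poly (fst s) h"
  by (simp add: wedge_def)

text \<open>The trace of the connection is \<open>12 h - 1\<close>, the derivative of \<open>Delta\<close>. For this reason
  the product of \<open>Delta\<close> and the wedge has the derivative \<open>wedge r (nabla (nabla r))\<close>, which is, up to the
  sign, the coefficient of order one of the operator \<open>annihilator r\<close> below.\<close>

lemma wedge_derivative:
  "poly Delta h * poly (pderiv (wedge r (nabla r))) h =
     poly (wedge r (nabla (nabla r))) h - (12 * h - 1) * poly (wedge r (nabla r)) h"
proof -
  define N where "N = nabla r"
  define D where "D = poly Delta h"
  define a b a1 b1 n0 n1 m0 m1 where "a = poly (fst r) h" and "b = poly (snd r) h"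
    and "a1 = poly (pderiv (fst r)) h" and "b1 = poly (pderiv (snd r)) h"
    and "n0 = poly (fst N) h" and "n1 = poly (snd N) h"
    and "m0 = poly (pderiv (fst N)) h" and "m1 = poly (pderiv (snd N)) h"
  note defs = this
  have "D * a1 = n0 - (5 * h - 1) * a + h * b" "D * b1 = n1 - 7/6 * a - 7 * h * b"
    unfolding defs D_def N_def poly_nabla by auto
  hence 1: "D * a1 * n1 - D * b1 * n0 =
      (n0 - (5 * h - 1) * a + h * b) * n1 - (n1 - 7/6 * a - 7 * h * b) * n0" by simp
  have 2: "poly (pderiv (wedge r N)) h = a1 * n1 + a * m1 - b1 * n0 - b * m0"
    by (simp add: wedge_def pderiv_diff pderiv_mult defs algebra_simps)
  have 3: "poly (wedge r (nabla N)) h = a * (D * m1 + 7/6 * n0 + 7 * h * n1) - b * (D * m0 + (5 * h - 1) * n0 - h * n1)"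
    unfolding poly_wedge poly_nabla defs D_def by simp
  have 4: "poly (wedge r N) h = a * n1 - b * n0" unfolding poly_wedge defs ..
  show ?thesis
    unfolding N_def[symmetric] D_def[symmetric] 2 3 4 using 1 by (simp add: algebra_simps)
qed

section \<open>Zeros of combinations of complete integrals\<close>

abbreviation energies :: "real set" where "energies \<equiv> {0<..<1/6}"

definition combine :: "covector \<Rightarrow> (real \<Rightarrow> real) \<Rightarrow> (real \<Rightarrow> real) \<Rightarrow> real \<Rightarrow> real" where
  "combine r X Y h = poly (fst r) h * X h + poly (snd r) h * Y h"

definition scaled_deriv :: "(real \<Rightarrow> real) \<Rightarrow> real \<Rightarrow> real" where
  "scaled_deriv F h = poly Delta h * deriv F h"

text \<open>Cramer's rule for the three pairs \<open>r\<close>, \<open>nabla r\<close>, \<open>nabla (nabla r)\<close> in a space of rank two gives the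
  coefficients of an operator that annihilates \<open>combine r I\<^sub>0 I\<^sub>1\<close> for every solution of the
  Picard-Fuchs system.\<close>

definition annihilator :: "covector \<Rightarrow> (real \<Rightarrow> real) \<Rightarrow> real \<Rightarrow> real" where
  "annihilator r F h = poly (wedge r (nabla r)) h * scaled_deriv (scaled_deriv F) h - poly (wedge r (nabla (nabla r))) h * scaled_deriv F h
     + poly (wedge (nabla r) (nabla (nabla r))) h * F h"

lemma smooth_poly_id [intro]: "open S \<Longrightarrow> smooth S (poly p)"
  using smooth_poly[OF _ smooth_id, of S p] by simp

lemma smooth_scaled_deriv [intro]: "open S \<Longrightarrow> smooth S F \<Longrightarrow> smooth S (scaled_deriv F)"
  unfolding scaled_deriv_def[abs_def] by (intro smooth_mult) auto

lemma scaled_deriv_cong: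
  assumes "open S" "x \<in> S" "\<And>y. y \<in> S \<Longrightarrow> f y = g y" shows "scaled_deriv f x = scaled_deriv g x"
  unfolding scaled_deriv_def using deriv_cong_open[OF assms] by simp

lemma annihilator_cong:
  assumes "open S" "x \<in> S" "\<And>y. y \<in> S \<Longrightarrow> f y = g y" shows "annihilator r f x = annihilator r g x"
  unfolding annihilator_def using scaled_deriv_cong[OF assms] assms(3)[OF assms(2)]
    scaled_deriv_cong[OF assms(1,2), of "scaled_deriv f" "scaled_deriv g"] scaled_deriv_cong[OF assms(1) _ assms(3)] by simp

lemma scaled_deriv_add:
  assumes "smooth S f" "smooth S g" "x \<in> S" shows "scaled_deriv (\<lambda>x. f x + g x) x = scaled_deriv f x + scaled_deriv g x"
  unfolding scaled_deriv_def by (simp add: deriv_add_on[OF assms] algebra_simps)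

lemma scaled_deriv_mult:
  assumes "smooth S f" "smooth S g" "x \<in> S" shows "scaled_deriv (\<lambda>x. f x * g x) x = scaled_deriv f x * g x + f x * scaled_deriv g x"
  unfolding scaled_deriv_def by (simp add: deriv_mult_on[OF assms] algebra_simps)

lemma scaled_deriv_poly: "scaled_deriv (poly p) x = poly (Delta * pderiv p) x"
  unfolding scaled_deriv_def by (simp add: DERIV_imp_deriv)

lemma plucker:
  "poly (wedge r s) h * combine t X Y h - poly (wedge r t) h * combine s X Y h + poly (wedge s t) h * combine r X Y h = 0"
  by (simp add: poly_wedge combine_def algebra_simps)

locale picard_fuchs =
  fixes I0 I1 :: "real \<Rightarrow> real"
  assumes smooth_I: "smooth energies I0" "smooth energies I1"
    and scaled_deriv_I: "\<And>h. h \<in> energies \<Longrightarrow> scaled_deriv I0 h = (5 * h - 1) * I0 h + 7/6 * I1 h"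
      "\<And>h. h \<in> energies \<Longrightarrow> scaled_deriv I1 h = - h * I0 h + 7 * h * I1 h"
    and I0_pos: "\<And>h. h \<in> energies \<Longrightarrow> I0 h > 0"
begin

lemma smooth_combine: "smooth energies (combine r I0 I1)"
  unfolding combine_def[abs_def] using smooth_I by (intro smooth_add smooth_mult) auto

lemma scaled_deriv_combine:
  assumes "h \<in> energies" shows "scaled_deriv (combine r I0 I1) h = combine (nabla r) I0 I1 h"
proof -
  have sm: "smooth energies (poly p)" for p by auto
  have "scaled_deriv (combine r I0 I1) h = scaled_deriv (\<lambda>h. poly (fst r) h * I0 h) h + scaled_deriv (\<lambda>h. poly (snd r) h * I1 h) h"
    unfolding combine_def[abs_def] using smooth_I by (intro scaled_deriv_add[OF _ _ assms] smooth_mult) auto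
  also have "\<dots> = combine (nabla r) I0 I1 h"
    unfolding scaled_deriv_mult[OF sm smooth_I(1) assms] scaled_deriv_mult[OF sm smooth_I(2) assms] scaled_deriv_poly scaled_deriv_I[OF assms]
      combine_def poly_nabla poly_mult
    by (simp add: algebra_simps)
  finally show ?thesis .
qed

lemma scaled_deriv2_combine:
  assumes "h \<in> energies" shows "scaled_deriv (scaled_deriv (combine r I0 I1)) h = combine (nabla (nabla r)) I0 I1 h"
  using scaled_deriv_cong[OF _ assms, of "scaled_deriv (combine r I0 I1)" "combine (nabla r) I0 I1"] scaled_deriv_combine assms by auto

lemma annihilator_combine:
  assumes "h \<in> energies" shows "annihilator r (combine r I0 I1) h = 0"
  unfolding annihilator_def scaled_deriv_combine[OF assms] scaled_deriv2_combine[OF assms] using plucker by blast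

text \<open>With \<open>f = a I\<^sub>0 + b I\<^sub>1\<close> and \<open>P = wedge r (nabla r)\<close>, elimination of \<open>I\<^sub>1\<close> gives
  \<open>b Delta f' - c f = - P I\<^sub>0\<close>, and \<open>I\<^sub>0\<close> is positive. The right hand side has at most \<open>2 d + 1\<close>
  zeros and \<open>b\<close> at most \<open>d\<close>, and Rolle's theorem adds one.\<close>

lemma zeros_le_combine:
  assumes "r \<noteq> (0, 0)" "deg_le d r"
  shows "zeros_le energies (combine r I0 I1) (3 * d + 2)"
proof (cases "snd r = 0")
  case True
  hence "fst r \<noteq> 0" using assms(1) by (cases r) auto
  hence "zeros_le energies (\<lambda>h. poly (fst r) h * I0 h) (degree (fst r) + 0)"
    using I0_pos smooth_I by (intro zeros_le_mult zeros_le_poly zeros_le_nonzero) (auto simp: less_le)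
  moreover have "combine r I0 I1 = (\<lambda>h. poly (fst r) h * I0 h)" using True by (simp add: combine_def fun_eq_iff)
  ultimately show ?thesis using assms(2) by (auto simp: deg_le_def intro: zeros_le_mono)
next
  case False
  let ?f = "combine r I0 I1" and ?P = "wedge r (nabla r)"
  let ?b = "\<lambda>h. poly Delta h * poly (snd r) h" and ?c = "poly (snd (nabla r))"
  have "zeros_le energies ?b (0 + degree (snd r))"
    using False by (intro zeros_le_mult zeros_le_poly zeros_le_nonzero Delta_nonzero) auto
  hence zb: "zeros_le energies ?b d" using assms(2) by (auto simp: deg_le_def intro: zeros_le_mono)
  have fo: "poly (- ?P) h * I0 h = first_order ?b ?c ?f h" if "h \<in> energies" for h
  proof -
    have "first_order ?b ?c ?f h = poly (snd r) h * scaled_deriv ?f h - ?c h * ?f h"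
      by (simp add: first_order_def scaled_deriv_def)
    also have "\<dots> = poly (- ?P) h * I0 h"
      unfolding scaled_deriv_combine[OF that] by (simp add: combine_def poly_wedge algebra_simps)
    finally show ?thesis ..
  qed
  have "zeros_le energies (\<lambda>h. poly (- ?P) h * I0 h) (degree (- ?P) + 0)"
    using I0_pos smooth_I wedge_nabla_nonzero[OF assms(1)]
    by (intro zeros_le_mult zeros_le_poly zeros_le_nonzero smooth_poly_id) (auto simp: less_le)
  moreover have "degree ?P \<le> d + Suc d" by (rule degree_wedge[OF assms(2) deg_le_nabla[OF assms(2)]])
  ultimately have "zeros_le energies (\<lambda>h. poly (- ?P) h * I0 h) (2 * d + 1)" by (auto intro: zeros_le_mono)
  from zeros_le_cong[OF _ fo this] have "zeros_le energies (first_order ?b ?c ?f) (2 * d + 1)" by auto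
  hence "zeros_le energies ?f (2 * d + 1 + d + 1)"
    by (rule rolle_first_order[OF smooth_combine _ _ zb, rotated 2]) (auto intro!: smooth_mult smooth_poly_id)
  thus ?thesis by (rule zeros_le_mono) simp
qed

text \<open>The second order operator factors into two of first order. Let \<open>f = combine r I\<^sub>0 I\<^sub>1\<close> be the
  function that it annihilates and \<open>W = Delta (f F' - f' F)\<close>. Then \<open>W\<close> and \<open>Q = Delta P\<close>, where \<open>P\<close> is
  the leading coefficient, satisfy \<open>Q W' - Q' W = f * annihilator r F\<close>. Rolle's theorem leads from \<open>F\<close> to \<open>W\<close>
  at the cost of one zero more than \<open>f\<close> has, and from \<open>W\<close> to \<open>f * annihilator r F\<close> at the cost of one
  zero more than \<open>P\<close> has; the zeros of the factor \<open>f\<close> have to be subtracted. The sum is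
  \<open>(3 d + 3) + (2 d + 2) + (3 d + 2) = 8 d + 7\<close>.

  If the operator annihilates \<open>F\<close>, then \<open>W\<close> is a multiple of \<open>Q\<close>, and if moreover \<open>W = 0\<close>, then \<open>F\<close> is a
  multiple of \<open>f\<close>.\<close>

theorem zeros_le_annihilator:
  assumes r: "r \<noteq> (0, 0)" "deg_le d r" and F: "smooth energies F"
  shows "zeros_le energies (annihilator r F) N \<Longrightarrow> zeros_le energies F (N + 8 * d + 7)" (is "?A \<Longrightarrow> ?B")
    and "\<lbrakk>\<And>h. h \<in> energies \<Longrightarrow> annihilator r F h = 0; \<exists>h\<in>energies. F h \<noteq> 0\<rbrakk> \<Longrightarrow> zeros_le energies F (8 * d + 7)"
proof -
  define f where "f = combine r I0 I1"
  define P where "P = wedge r (nabla r)"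
  have Pnz: "P \<noteq> 0" unfolding P_def by (rule wedge_nabla_nonzero[OF r(1)])
  have degP: "degree P \<le> 2 * d + 1" unfolding P_def using degree_wedge[OF r(2) deg_le_nabla[OF r(2)]] by simp
  have smf: "smooth energies f" unfolding f_def by (rule smooth_combine)
  have zf: "zeros_le energies f (3 * d + 2)" unfolding f_def by (rule zeros_le_combine[OF r])
  let ?b = "\<lambda>h. poly Delta h * f h"
  define W where "W = first_order ?b (scaled_deriv f) F"
  have smb: "smooth energies ?b" using smf by (intro smooth_mult) auto
  have smW: "smooth energies W" unfolding W_def first_order_def[abs_def]
    by (intro smooth_diff smooth_mult) (use smb smf F in auto)
  have "zeros_le energies ?b (0 + (3 * d + 2))"
    using smf zf by (intro zeros_le_mult zeros_le_nonzero Delta_nonzero) auto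
  hence zb: "zeros_le energies ?b (3 * d + 2)" by simp
  have F_of_W: "zeros_le energies F (M + (3 * d + 2) + 1)" if "zeros_le energies W M" for M
    by (rule rolle_first_order[OF F smb _ zb that[unfolded W_def]]) (use smf in auto)
  define Q where "Q = Delta * P"
  have sQ: "smooth energies (poly Q)" by auto
  note Q = sQ smooth_deriv[OF sQ]
  have "zeros_le energies (\<lambda>h. poly Delta h * poly P h) (0 + degree P)"
    using Pnz by (intro zeros_le_mult zeros_le_poly zeros_le_nonzero Delta_nonzero) auto
  moreover have "(\<lambda>h. poly Delta h * poly P h) = poly Q" by (simp add: Q_def fun_eq_iff)
  ultimately have zQ: "zeros_le energies (poly Q) (2 * d + 1)" using degP by (auto intro: zeros_le_mono)
  have key: "f h * annihilator r F h = first_order (poly Q) (deriv (poly Q)) W h" if h: "h \<in> energies" for h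
  proof -
    have W: "W = (\<lambda>h. f h * scaled_deriv F h + (-1) * (F h * scaled_deriv f h))"
      by (simp add: W_def first_order_def scaled_deriv_def fun_eq_iff algebra_simps)
    have s: "smooth energies (scaled_deriv F)" "smooth energies (scaled_deriv f)" "smooth energies (\<lambda>_. -1)" using F smf by auto
    have s2: "smooth energies (\<lambda>h. F h * scaled_deriv f h)" "smooth energies (\<lambda>h. f h * scaled_deriv F h)" using F smf s by (auto intro!: smooth_mult)
    have s3: "smooth energies (\<lambda>h. (-1) * (F h * scaled_deriv f h))" by (rule smooth_mult[OF _ s(3) s2(1)]) simp
    have "scaled_deriv (\<lambda>_. -1) h = 0" by (simp add: scaled_deriv_def)
    hence dW: "scaled_deriv W h = f h * scaled_deriv (scaled_deriv F) h - F h * scaled_deriv (scaled_deriv f) h"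
      unfolding W scaled_deriv_add[OF s2(2) s3 h] scaled_deriv_mult[OF s(3) s2(1) h] scaled_deriv_mult[OF smf s(1) h] scaled_deriv_mult[OF F s(2) h]
      by (simp add: algebra_simps)
    have Wh: "W h = f h * scaled_deriv F h - F h * scaled_deriv f h" by (simp add: W)
    define u v where "u = poly (wedge r (nabla (nabla r))) h" and "v = poly (wedge (nabla r) (nabla (nabla r))) h"
    have pl: "poly P h * scaled_deriv (scaled_deriv f) h - u * scaled_deriv f h + v * f h = 0"
      unfolding P_def u_def v_def f_def scaled_deriv_combine[OF h] scaled_deriv2_combine[OF h] by (rule plucker)
    have dQ: "deriv (poly Q) h = u"
    proof -
      have "deriv (poly Q) h = poly (pderiv Q) h" by (rule DERIV_imp_deriv) simp
      also have "\<dots> = poly Delta h * poly (pderiv P) h + poly (pderiv Delta) h * poly P h"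
        by (simp add: Q_def pderiv_mult)
      also have "\<dots> = u" unfolding P_def wedge_derivative u_def by (simp add: pderiv_Delta algebra_simps)
      finally show ?thesis .
    qed
    have "first_order (poly Q) (deriv (poly Q)) W h = poly P h * scaled_deriv W h - u * W h"
      by (simp add: first_order_def scaled_deriv_def Q_def dQ[unfolded Q_def])
    also have "\<dots> = f h * (poly P h * scaled_deriv (scaled_deriv F) h - u * scaled_deriv F h + v * F h)
        - F h * (poly P h * scaled_deriv (scaled_deriv f) h - u * scaled_deriv f h + v * f h)"
      unfolding dW Wh by (simp add: algebra_simps)
    also have "\<dots> = f h * annihilator r F h"
      unfolding pl by (simp add: annihilator_def P_def u_def v_def)
    finally show ?thesis ..
  qed
  have sma: "smooth energies (annihilator r F)" unfolding annihilator_def[abs_def]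
    by (intro smooth_add smooth_diff smooth_mult smooth_poly_id smooth_scaled_deriv F) auto
  show ?B if A: ?A
  proof -
    have "zeros_le energies (\<lambda>h. f h * annihilator r F h) ((3 * d + 2) + N)"
      by (rule zeros_le_mult[OF _ smf sma zf A]) simp
    from zeros_le_cong[OF _ key this]
    have "zeros_le energies (first_order (poly Q) (deriv (poly Q)) W) ((3 * d + 2) + N)" by auto
    from F_of_W[OF rolle_first_order[OF smW Q zQ this]] show ?B by (rule zeros_le_mono) simp
  qed
  show "zeros_le energies F (8 * d + 7)" if A: "\<And>h. h \<in> energies \<Longrightarrow> annihilator r F h = 0" "\<exists>h\<in>energies. F h \<noteq> 0"
  proof -
    have "first_order (poly Q) (deriv (poly Q)) W h = 0" if "h \<in> energies" for h using key[OF that] A(1)[OF that] by simp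
    then obtain c where c: "\<And>h. h \<in> energies \<Longrightarrow> W h = c * poly Q h"
      using proportional_of_wronskian_zero[OF smW Q(1) zQ] unfolding first_order_def by blast
    show ?thesis
    proof (cases "c = 0")
      case False
      have "zeros_le energies (\<lambda>h. c * poly Q h) (2 * d + 1)" by (rule zeros_le_cmult[OF _ Q(1) zQ False]) simp
      hence "zeros_le energies W (2 * d + 1)" using zeros_le_cong[of energies "\<lambda>h. c * poly Q h" W] c by simp
      from F_of_W[OF this] show ?thesis by (rule zeros_le_mono) simp
    next
      case True
      have "f h * deriv F h - deriv f h * F h = 0" if "h \<in> energies" for h
      proof -
        have "poly Delta h * (f h * deriv F h - deriv f h * F h) = W h"
          by (simp add: W_def first_order_def scaled_deriv_def algebra_simps)
        thus ?thesis using c[OF that] True Delta_nonzero[OF that] by simp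
      qed
      then obtain c' where c': "\<And>h. h \<in> energies \<Longrightarrow> F h = c' * f h"
        using proportional_of_wronskian_zero[OF F smf zf] by blast
      have "c' \<noteq> 0" using A(2) c' by auto
      have "zeros_le energies (\<lambda>h. c' * f h) (3 * d + 2)" by (rule zeros_le_cmult[OF _ smf zf \<open>c' \<noteq> 0\<close>]) simp
      hence "zeros_le energies F (3 * d + 2)" using zeros_le_cong[of energies "\<lambda>h. c' * f h" F] c' by simp
      thus ?thesis by (rule zeros_le_mono) simp
    qed
  qed
qed

end

section \<open>Algebraic functions on the switching curve\<close>

text \<open>The energy of the point \<open>(z ^ m, sqrt z)\<close> of the switching curve.\<close>

definition switch_energy :: "nat \<Rightarrow> real poly" where
  "switch_energy m = monom (1/2) 1 + monom (1/2) (2 * m) - monom (1/3) (3 * m)"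

text \<open>The polynomial \<open>z \<eta>'(z)\<close>, where \<open>\<eta>\<close> is the energy polynomial above. By the inverse function theorem
  it is the denominator of \<open>z' / z\<close> when \<open>z\<close> is considered as a function of the energy.\<close>

definition energy_euler :: "nat \<Rightarrow> real poly" where
  "energy_euler m = [:0, 1:] * pderiv (switch_energy m)"

lemma degree_switch_energy: "m \<ge> 1 \<Longrightarrow> degree (switch_energy m) \<le> 3 * m"
  unfolding switch_energy_def
  by (intro degree_diff_le degree_add_le order_trans[OF degree_monom_le]) auto

lemma degree_energy_euler: "m \<ge> 1 \<Longrightarrow> degree (energy_euler m) \<le> 3 * m"
  unfolding energy_euler_def
  using degree_mult_le[of "[:0, 1:]" "pderiv (switch_energy m)"] degree_switch_energy[of m]
  by (simp add: degree_pderiv)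

text \<open>The oval of energy \<open>h\<close> meets the switching curve \<open>x = y\<^sup>2\<^sup>m\<close> in the points \<open>(z ^ m, \<plusminus> v)\<close> with
  \<open>z = v\<^sup>2\<close>.\<close>

locale switching_curve =
  fixes m :: nat and z v :: "real \<Rightarrow> real"
  assumes m: "m \<ge> 1"
    and smooth_z: "smooth energies z" and smooth_v: "smooth energies v"
    and z_pos: "\<And>h. h \<in> energies \<Longrightarrow> z h > 0" and v_pos: "\<And>h. h \<in> energies \<Longrightarrow> v h > 0"
    and energy_euler_pos: "\<And>h. h \<in> energies \<Longrightarrow> poly (energy_euler m) (z h) > 0"
    and deriv_z: "\<And>h. h \<in> energies \<Longrightarrow> deriv z h = z h / poly (energy_euler m) (z h)"
    and deriv_v: "\<And>h. h \<in> energies \<Longrightarrow> deriv v h = v h / (2 * poly (energy_euler m) (z h))"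
    and switch_energy_z: "\<And>h. h \<in> energies \<Longrightarrow> poly (switch_energy m) (z h) = h"
begin

lemma energy_euler_nonzero: "h \<in> energies \<Longrightarrow> poly (energy_euler m) (z h) \<noteq> 0"
  using energy_euler_pos[of h] by simp

lemma smooth_poly_z: "smooth energies (\<lambda>h. poly p (z h))"
  by (rule smooth_poly[OF _ smooth_z]) simp

lemma smooth_energy_euler_power: "smooth energies (\<lambda>h. poly (energy_euler m) (z h) ^ k)"
  by (rule smooth_power[OF _ smooth_poly_z]) simp

text \<open>Functions \<open>v N(z) / (z \<eta>'(z)) ^ k\<close>. The number \<open>\<rho>\<close> bounds the degree of the numerator diminished by
  the degree \<open>3 m k\<close> of the denominator, and is not changed when the fraction is expanded
  (\<open>alg_Suc\<close>).\<close>

definition alg :: "nat \<Rightarrow> nat \<Rightarrow> (real \<Rightarrow> real) \<Rightarrow> bool" where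
  "alg k \<rho> F \<longleftrightarrow> (\<exists>N. degree N \<le> \<rho> + 3 * m * k \<and>
      (\<forall>h\<in>energies. F h = v h * poly N (z h) / poly (energy_euler m) (z h) ^ k))"

lemma alg_mono: "alg k \<rho> F \<Longrightarrow> \<rho> \<le> \<rho>' \<Longrightarrow> alg k \<rho>' F"
  unfolding alg_def by (meson add_le_mono1 order_trans)

lemma alg_cong: "(\<And>h. h \<in> energies \<Longrightarrow> F h = G h) \<Longrightarrow> alg k \<rho> F \<Longrightarrow> alg k \<rho> G"
  unfolding alg_def by auto

lemma alg_Suc: assumes "alg k \<rho> F" shows "alg (Suc k) \<rho> F"
proof -
  obtain N where N: "degree N \<le> \<rho> + 3 * m * k" "\<And>h. h \<in> energies \<Longrightarrow> F h = v h * poly N (z h) / poly (energy_euler m) (z h) ^ k"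
    using assms unfolding alg_def by blast
  have "degree (N * energy_euler m) \<le> \<rho> + 3 * m * Suc k"
    using degree_mult_le_add[OF N(1) degree_energy_euler[OF m]] by simp
  moreover have "F h = v h * poly (N * energy_euler m) (z h) / poly (energy_euler m) (z h) ^ Suc k" if "h \<in> energies" for h
    using N(2)[OF that] energy_euler_pos[OF that] by simp
  ultimately show ?thesis unfolding alg_def by blast
qed

lemma alg_pad:
  assumes "alg k \<rho> F" "k \<le> k'" shows "alg k' \<rho> F"
  using assms(2,1) by (induction rule: dec_induct) (auto intro: alg_Suc)

lemma alg_add: assumes "alg k \<rho> F" "alg k \<rho> G" shows "alg k \<rho> (\<lambda>h. F h + G h)"
proof -
  obtain N M where "degree N \<le> \<rho> + 3 * m * k" "\<And>h. h \<in> energies \<Longrightarrow> F h = v h * poly N (z h) / poly (energy_euler m) (z h) ^ k"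
     "degree M \<le> \<rho> + 3 * m * k" "\<And>h. h \<in> energies \<Longrightarrow> G h = v h * poly M (z h) / poly (energy_euler m) (z h) ^ k"
    using assms unfolding alg_def by blast
  thus ?thesis unfolding alg_def
    by (intro exI[of _ "N + M"] conjI degree_add_le) (auto simp: algebra_simps add_divide_distrib)
qed

lemma alg_poly_mult:
  assumes "alg k \<rho> F" "degree p \<le> c" shows "alg k (\<rho> + 3 * m * c) (\<lambda>h. poly p h * F h)"
proof -
  obtain N where N: "degree N \<le> \<rho> + 3 * m * k" "\<And>h. h \<in> energies \<Longrightarrow> F h = v h * poly N (z h) / poly (energy_euler m) (z h) ^ k"
    using assms unfolding alg_def by blast
  have "degree (p \<circ>\<^sub>p switch_energy m) \<le> 3 * m * c"
    using degree_pcompose_le[of p "switch_energy m"] mult_mono[OF assms(2) degree_switch_energy[OF m]] by (simp add: mult.commute)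
  from degree_mult_le_add[OF this N(1)] have "degree ((p \<circ>\<^sub>p switch_energy m) * N) \<le> \<rho> + 3 * m * c + 3 * m * k" by simp
  moreover have "poly p h * F h = v h * poly ((p \<circ>\<^sub>p switch_energy m) * N) (z h) / poly (energy_euler m) (z h) ^ k" if "h \<in> energies" for h
    using N(2)[OF that] switch_energy_z[OF that] by (simp add: poly_pcompose)
  ultimately show ?thesis unfolding alg_def by blast
qed

lemma alg_cmult: "alg k \<rho> F \<Longrightarrow> alg k \<rho> (\<lambda>h. c * F h)"
  using alg_poly_mult[of k \<rho> F "[:c:]" 0] by simp

lemma alg_diff: assumes "alg k \<rho> F" "alg k \<rho> G" shows "alg k \<rho> (\<lambda>h. F h - G h)"
  using alg_add[OF assms(1) alg_cmult[OF assms(2), of "-1"]] by simp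

lemma alg_smooth: assumes "alg k \<rho> F" shows "smooth energies F"
proof -
  obtain N where N: "\<And>h. h \<in> energies \<Longrightarrow> F h = v h * poly N (z h) / poly (energy_euler m) (z h) ^ k"
    using assms unfolding alg_def by blast
  have "smooth energies (\<lambda>h. v h * poly N (z h) / poly (energy_euler m) (z h) ^ k)"
    by (rule smooth_divide[OF _ smooth_mult[OF _ smooth_v smooth_poly_z] smooth_energy_euler_power])
       (simp_all add: energy_euler_nonzero del: greaterThanLessThan_iff)
  from smooth_cong[OF _ N[symmetric] this] show ?thesis by auto
qed

text \<open>The quotient rule raises the exponent of the denominator by two, that is its degree by \<open>6 m\<close>; the
  degree of the numerator grows by \<open>3 m\<close>, and by another \<open>6 m\<close> from the factor \<open>Delta\<close>, which is
  quadratic in the energy. In total \<open>\<rho>\<close> grows by \<open>3 m\<close>.\<close>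

lemma alg_scaled_deriv: assumes "alg k \<rho> F" shows "alg (k + 2) (\<rho> + 3 * m) (scaled_deriv F)"
proof -
  obtain N where N: "degree N \<le> \<rho> + 3 * m * k" "\<And>h. h \<in> energies \<Longrightarrow> F h = v h * poly N (z h) / poly (energy_euler m) (z h) ^ k"
    using assms unfolding alg_def by blast
  define X where "X = [:0, 1 :: real:]"
  define M where "M = (Delta \<circ>\<^sub>p switch_energy m) * (smult (1/2) (energy_euler m * N) + X * pderiv N * energy_euler m - smult (of_nat k) (X * pderiv (energy_euler m) * N))"
  have dX: "degree (X * pderiv p) \<le> degree p" for p
    using degree_mult_le[of X "pderiv p"] by (cases "degree p = 0") (auto simp: X_def degree_pderiv pderiv_eq_0_iff)
  have "degree (smult (1/2) (energy_euler m * N) + X * pderiv N * energy_euler m - smult (of_nat k) (X * pderiv (energy_euler m) * N)) \<le> 3 * m + (\<rho> + 3 * m * k)"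
    using degree_mult_le_add[OF degree_energy_euler[OF m] N(1)]
      degree_mult_le_add[OF order_trans[OF dX N(1)] degree_energy_euler[OF m]]
      degree_mult_le_add[OF order_trans[OF dX degree_energy_euler[OF m]] N(1)]
    by (intro degree_diff_le degree_add_le order_trans[OF degree_smult_le]) (simp_all add: add_ac)
  moreover have "degree (Delta \<circ>\<^sub>p switch_energy m) \<le> 6 * m"
    using degree_pcompose_le[of Delta "switch_energy m"] mult_left_mono[OF degree_switch_energy[OF m], of 2] by (simp add: degree_Delta)
  ultimately have "degree M \<le> 6 * m + (3 * m + (\<rho> + 3 * m * k))"
    unfolding M_def by (intro degree_mult_le_add)
  hence deg: "degree M \<le> (\<rho> + 3 * m) + 3 * m * (k + 2)" by (simp add: algebra_simps)
  have "scaled_deriv F h = v h * poly M (z h) / poly (energy_euler m) (z h) ^ (k + 2)" if h: "h \<in> energies" for h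
  proof -
    define w where "w = poly (energy_euler m) (z h)"
    have w: "w > 0" using energy_euler_pos[OF h] by (simp add: w_def)
    have dz: "(z has_real_derivative z h / w) (at h)"
      using smooth_has_deriv[OF smooth_z h] deriv_z[OF h] by (simp add: w_def)
    have dv: "(v has_real_derivative v h / (2 * w)) (at h)"
      using smooth_has_deriv[OF smooth_v h] deriv_v[OF h] by (simp add: w_def)
    have dp: "((\<lambda>h. poly p (z h)) has_real_derivative poly (pderiv p) (z h) * (z h / w)) (at h)" for p
      by (rule DERIV_chain2[OF poly_DERIV dz])
    have "((\<lambda>h. poly (energy_euler m) (z h) ^ k) has_real_derivative
        of_nat k * (poly (pderiv (energy_euler m)) (z h) * (z h / w) * w ^ (k - Suc 0))) (at h)"
      unfolding w_def by (rule DERIV_power[OF dp[unfolded w_def]])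
    moreover have "of_nat k * (poly (pderiv (energy_euler m)) (z h) * (z h / w) * w ^ (k - Suc 0))
        = of_nat k * poly (pderiv (energy_euler m)) (z h) * z h * w ^ k / w ^ 2"
      using w by (cases k) (simp_all add: power2_eq_square)
    ultimately have dw: "((\<lambda>h. poly (energy_euler m) (z h) ^ k) has_real_derivative
        of_nat k * poly (pderiv (energy_euler m)) (z h) * z h * w ^ k / w ^ 2) (at h)"
      by simp
    define n0 n1 o1 where "n0 = poly N (z h)" and "n1 = poly (pderiv N) (z h)" and "o1 = poly (pderiv (energy_euler m)) (z h)"
    have dq: "((\<lambda>h. v h * poly N (z h) / poly (energy_euler m) (z h) ^ k) has_real_derivative
       ((v h / (2 * w) * n0 + n1 * (z h / w) * v h) * w ^ k
         - v h * n0 * (of_nat k * o1 * z h * w ^ k / w ^ 2)) / (w ^ k * w ^ k)) (at h)"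
      using DERIV_divide[OF DERIV_mult[OF dv dp[of N]] dw] w by (simp add: w_def n0_def n1_def o1_def)
    have "((v h / (2 * w) * n0 + n1 * (z h / w) * v h) * w ^ k - v h * n0 * (of_nat k * o1 * z h * w ^ k / w ^ 2)) / (w ^ k * w ^ k)
       = v h * (w * n0 / 2 + z h * n1 * w - of_nat k * (z h * o1 * n0)) / w ^ (k + 2)"
      using w by (simp add: field_simps power2_eq_square)
    from DERIV_imp_deriv[OF dq[unfolded this]]
    have "deriv (\<lambda>h. v h * poly N (z h) / poly (energy_euler m) (z h) ^ k) h =
       v h * (w * n0 / 2 + z h * n1 * w - of_nat k * (z h * o1 * n0)) / w ^ (k + 2)" .
    moreover have "deriv F h = deriv (\<lambda>h. v h * poly N (z h) / poly (energy_euler m) (z h) ^ k) h"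
      by (rule deriv_cong_open[of energies]) (use h N(2) in auto)
    ultimately show ?thesis unfolding scaled_deriv_def M_def
      by (simp add: poly_pcompose switch_energy_z[OF h] X_def w_def n0_def n1_def o1_def algebra_simps)
  qed
  thus ?thesis using deg unfolding alg_def by blast
qed

text \<open>The zeros are those of the numerator, as \<open>v\<close> and the denominator are positive and \<open>z' \<noteq> 0\<close>.\<close>

lemma zeros_le_alg:
  assumes "alg k \<rho> F" "\<exists>h\<in>energies. F h \<noteq> 0"
  shows "zeros_le energies F (\<rho> + 3 * m * k)"
proof -
  obtain N where N: "degree N \<le> \<rho> + 3 * m * k" "\<And>h. h \<in> energies \<Longrightarrow> F h = v h * poly N (z h) / poly (energy_euler m) (z h) ^ k"
    using assms(1) unfolding alg_def by blast
  have "N \<noteq> 0" using assms(2) N(2) by auto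
  have "deriv z h \<noteq> 0" if "h \<in> energies" for h using deriv_z[OF that] z_pos[OF that] energy_euler_pos[OF that] by simp
  hence zN: "zeros_le energies (\<lambda>h. poly N (z h)) (degree N)"
    by (intro zeros_le_poly_comp smooth_z \<open>N \<noteq> 0\<close>)
  have "zeros_le energies (\<lambda>h. (v h / poly (energy_euler m) (z h) ^ k) * poly N (z h)) (0 + degree N)"
  proof (rule zeros_le_mult[OF _ _ _ _ zN])
    show "smooth energies (\<lambda>h. v h / poly (energy_euler m) (z h) ^ k)"
      by (rule smooth_divide[OF _ smooth_v smooth_energy_euler_power])
         (simp_all add: energy_euler_nonzero del: greaterThanLessThan_iff)
    show "smooth energies (\<lambda>h. poly N (z h))" by (rule smooth_poly_z)
    show "zeros_le energies (\<lambda>h. v h / poly (energy_euler m) (z h) ^ k) 0"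
      by (rule zeros_le_nonzero) (use v_pos energy_euler_nonzero in force)
  qed auto
  hence "zeros_le energies F (0 + degree N)"
    by (rule zeros_le_cong[rotated 2]) (use N(2) in auto)
  thus ?thesis using N(1) by (auto intro: zeros_le_mono)
qed

end

section \<open>Zeros of combinations of complete and incomplete integrals\<close>

text \<open>The incomplete integrals satisfy the same equations as the complete ones, up to the algebraic
  functions \<open>e0\<close>, \<open>e1\<close> that come from the end points of the arc.\<close>

locale incomplete_picard_fuchs = picard_fuchs I0 I1 + switching_curve m z v
  for I0 I1 :: "real \<Rightarrow> real" and m z v +
  fixes J0 J1 e0 e1 :: "real \<Rightarrow> real"
  assumes smooth_J: "smooth energies J0" "smooth energies J1"
    and scaled_deriv_J: "\<And>h. h \<in> energies \<Longrightarrow> scaled_deriv J0 h = (5 * h - 1) * J0 h + 7/6 * J1 h + e0 h"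
      "\<And>h. h \<in> energies \<Longrightarrow> scaled_deriv J1 h = - h * J0 h + 7 * h * J1 h + e1 h"
    and alg_e: "alg 0 (5 * m) e0" "alg 0 (5 * m) e1"
begin

lemma smooth_combine_J: "smooth energies (combine s J0 J1)"
  unfolding combine_def[abs_def] using smooth_J by (intro smooth_add smooth_mult) auto

lemma scaled_deriv_combine_J:
  assumes "h \<in> energies" shows "scaled_deriv (combine s J0 J1) h = combine (nabla s) J0 J1 h + combine s e0 e1 h"
proof -
  have sm: "smooth energies (poly p)" for p by auto
  have "scaled_deriv (combine s J0 J1) h = scaled_deriv (\<lambda>h. poly (fst s) h * J0 h) h + scaled_deriv (\<lambda>h. poly (snd s) h * J1 h) h"
    unfolding combine_def[abs_def] using smooth_J by (intro scaled_deriv_add[OF _ _ assms] smooth_mult) auto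
  also have "\<dots> = combine (nabla s) J0 J1 h + combine s e0 e1 h"
    unfolding scaled_deriv_mult[OF sm smooth_J(1) assms] scaled_deriv_mult[OF sm smooth_J(2) assms] scaled_deriv_poly scaled_deriv_J[OF assms]
      combine_def poly_nabla poly_mult
    by (simp add: algebra_simps)
  finally show ?thesis .
qed

text \<open>The condition on \<open>\<rho>\<close> says that the algebraic part is at least as large as what the inhomogeneous
  terms \<open>e0\<close>, \<open>e1\<close> contribute. It is stable under differentiation, which raises \<open>e\<close> by one and \<open>\<rho>\<close> by
  \<open>3 m\<close>.\<close>

lemma scaled_deriv_combine_J_alg:
  assumes "deg_le e s" "alg k \<rho> A" "(3 * e + 2) * m \<le> \<rho>"
  obtains A' where "alg (k + 2) (\<rho> + 3 * m) A'"
    "\<And>h. h \<in> energies \<Longrightarrow> scaled_deriv (\<lambda>h. combine s J0 J1 h + A h) h = combine (nabla s) J0 J1 h + A' h"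
proof
  have le: "5 * m + 3 * m * e \<le> \<rho> + 3 * m" using assms(3) by (simp add: algebra_simps)
  have "alg (k + 2) (\<rho> + 3 * m) (\<lambda>h. poly (fst s) h * e0 h + poly (snd s) h * e1 h)"
    by (intro alg_add alg_pad[OF alg_mono[OF alg_poly_mult[OF alg_e(1)] le]]
         alg_pad[OF alg_mono[OF alg_poly_mult[OF alg_e(2)] le]]) (use assms(1) in \<open>auto simp: deg_le_def\<close>)
  thus "alg (k + 2) (\<rho> + 3 * m) (\<lambda>h. combine s e0 e1 h + scaled_deriv A h)"
    unfolding combine_def by (rule alg_add[OF _ alg_scaled_deriv[OF assms(2)]])
  show "scaled_deriv (\<lambda>h. combine s J0 J1 h + A h) h = combine (nabla s) J0 J1 h + (combine s e0 e1 h + scaled_deriv A h)" if "h \<in> energies" for h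
    unfolding scaled_deriv_add[OF smooth_combine_J alg_smooth[OF assms(2)] that] scaled_deriv_combine_J[OF that] by simp
qed

definition annihilator_covector :: "covector \<Rightarrow> covector \<Rightarrow> covector" where
  "annihilator_covector r s = (let P = wedge r (nabla r); Q = wedge r (nabla (nabla r)); R = wedge (nabla r) (nabla (nabla r))
     in (P * fst (nabla (nabla s)) - Q * fst (nabla s) + R * fst s,
         P * snd (nabla (nabla s)) - Q * snd (nabla s) + R * snd s))"

lemma deg_le_annihilator_covector:
  assumes "deg_le d r" "deg_le e s" shows "deg_le (2 * d + 3 + e) (annihilator_covector r s)"
proof -
  note n = deg_le_nabla[OF assms(1)] deg_le_nabla[OF assms(2)]
  note nn = deg_le_nabla[OF n(1)] deg_le_nabla[OF n(2)]
  have W: "degree (wedge r (nabla r)) \<le> 2 * d + 1" "degree (wedge r (nabla (nabla r))) \<le> 2 * d + 2"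
     "degree (wedge (nabla r) (nabla (nabla r))) \<le> 2 * d + 3"
    using degree_wedge[OF assms(1) n(1)] degree_wedge[OF assms(1) nn(1)] degree_wedge[OF n(1) nn(1)] by auto
  have S: "degree (fst s) \<le> e" "degree (snd s) \<le> e" "degree (fst (nabla s)) \<le> e + 1" "degree (snd (nabla s)) \<le> e + 1"
     "degree (fst (nabla (nabla s))) \<le> e + 2" "degree (snd (nabla (nabla s))) \<le> e + 2"
    using assms(2) n(2) nn(2) by (auto simp: deg_le_def)
  show ?thesis
    unfolding deg_le_def annihilator_covector_def Let_def fst_conv snd_conv
    by (intro conjI degree_add_le degree_diff_le;
        rule order_trans[OF degree_mult_le_add[OF W(1) S(5)]] order_trans[OF degree_mult_le_add[OF W(1) S(6)]]
             order_trans[OF degree_mult_le_add[OF W(2) S(3)]] order_trans[OF degree_mult_le_add[OF W(2) S(4)]]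
             order_trans[OF degree_mult_le_add[OF W(3) S(1)]] order_trans[OF degree_mult_le_add[OF W(3) S(2)]]; simp)
qed

lemma annihilator_combine_J:
  assumes r: "deg_le d r" and s: "deg_le e s" and A: "alg k \<rho> A" and rho: "(3 * e + 2) * m \<le> \<rho>"
  obtains A' where "alg (k + 4) (\<rho> + 3 * m * (2 * d + 3)) A'"
    "\<And>h. h \<in> energies \<Longrightarrow> annihilator r (\<lambda>h. combine s J0 J1 h + A h) h = combine (annihilator_covector r s) J0 J1 h + A' h"
proof -
  let ?F = "\<lambda>h. combine s J0 J1 h + A h"
  note n = deg_le_nabla[OF r] and nn = deg_le_nabla[OF deg_le_nabla[OF r]]
  obtain A1 where A1: "alg (k + 2) (\<rho> + 3 * m) A1" "\<And>h. h \<in> energies \<Longrightarrow> scaled_deriv ?F h = combine (nabla s) J0 J1 h + A1 h"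
    using scaled_deriv_combine_J_alg[OF s A rho] by blast
  obtain A2 where A2: "alg (k + 4) (\<rho> + 6 * m) A2"
    "\<And>h. h \<in> energies \<Longrightarrow> scaled_deriv (\<lambda>h. combine (nabla s) J0 J1 h + A1 h) h = combine (nabla (nabla s)) J0 J1 h + A2 h"
  proof (rule scaled_deriv_combine_J_alg[OF deg_le_nabla[OF s] A1(1)])
    show "(3 * Suc e + 2) * m \<le> \<rho> + 3 * m" using rho by (simp add: algebra_simps)
    fix A' assume *: "alg (k + 2 + 2) (\<rho> + 3 * m + 3 * m) A'"
       "\<And>h. h \<in> energies \<Longrightarrow> scaled_deriv (\<lambda>h. combine (nabla s) J0 J1 h + A1 h) h = combine (nabla (nabla s)) J0 J1 h + A' h"
    have "k + 2 + 2 = k + 4" "\<rho> + 3 * m + 3 * m = \<rho> + 6 * m" by auto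
    thus thesis using that * by metis
  qed
  have dd2: "scaled_deriv (scaled_deriv ?F) h = combine (nabla (nabla s)) J0 J1 h + A2 h" if "h \<in> energies" for h
    using scaled_deriv_cong[OF _ that A1(2)] A2(2)[OF that] by simp
  define A' where "A' h = poly (wedge r (nabla r)) h * A2 h - poly (wedge r (nabla (nabla r))) h * A1 h
     + poly (wedge (nabla r) (nabla (nabla r))) h * A h" for h
  show thesis
  proof
    have W: "degree (wedge r (nabla r)) \<le> 2 * d + 1" "degree (wedge r (nabla (nabla r))) \<le> 2 * d + 2"
       "degree (wedge (nabla r) (nabla (nabla r))) \<le> 2 * d + 3"
      using degree_wedge[OF r n] degree_wedge[OF r nn] degree_wedge[OF n nn] by auto
    let ?r = "\<rho> + 3 * m * (2 * d + 3)"
    have "alg (k + 4) ?r (\<lambda>h. poly (wedge r (nabla r)) h * A2 h)"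
      by (rule alg_mono[OF alg_poly_mult[OF A2(1) W(1)]]) (simp add: algebra_simps)
    moreover have "alg (k + 4) ?r (\<lambda>h. poly (wedge r (nabla (nabla r))) h * A1 h)"
      by (rule alg_pad[OF alg_mono[OF alg_poly_mult[OF A1(1) W(2)]]]) (simp_all add: algebra_simps)
    moreover have "alg (k + 4) ?r (\<lambda>h. poly (wedge (nabla r) (nabla (nabla r))) h * A h)"
      by (rule alg_pad[OF alg_poly_mult[OF A W(3)]]) simp
    ultimately show "alg (k + 4) ?r A'" unfolding A'_def by (intro alg_add alg_diff)
    show "annihilator r ?F h = combine (annihilator_covector r s) J0 J1 h + A' h" if "h \<in> energies" for h
      unfolding annihilator_def A1(2)[OF that] dd2[OF that] A'_def
      by (simp add: combine_def annihilator_covector_def Let_def algebra_simps)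
  qed
qed

lemma combine_annihilator_self: "combine (annihilator_covector r r) X Y h = 0"
  using plucker[of r "nabla r" h "nabla (nabla r)" X Y]
  by (simp add: combine_def annihilator_covector_def Let_def algebra_simps)

text \<open>The operator that belongs to the coefficients \<open>s\<close> leaves an algebraic function.\<close>

lemma zeros_le_incomplete:
  assumes s: "deg_le e s" and A: "alg k \<rho> A" and rho: "(3 * e + 2) * m \<le> \<rho>"
    and F: "\<And>h. h \<in> energies \<Longrightarrow> F h = combine s J0 J1 h + A h" and nz: "\<exists>h\<in>energies. F h \<noteq> 0"
  shows "zeros_le energies F (\<rho> + 3 * m * (2 * e + 3) + 3 * m * (k + 4) + 8 * e + 7)"
proof (cases "s = (0, 0)")
  case True
  hence "\<And>h. h \<in> energies \<Longrightarrow> F h = A h" using F by (simp add: combine_def)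
  hence "alg k \<rho> F" using A alg_cong[of A F] by simp
  from zeros_le_alg[OF this nz] show ?thesis by (rule zeros_le_mono) (simp add: algebra_simps)
next
  case False
  have smF: "smooth energies F"
    by (rule smooth_cong[OF _ F[symmetric]]) (auto intro!: smooth_add smooth_combine_J alg_smooth[OF A])
  obtain A' where A': "alg (k + 4) (\<rho> + 3 * m * (2 * e + 3)) A'"
    "\<And>h. h \<in> energies \<Longrightarrow> annihilator s (\<lambda>h. combine s J0 J1 h + A h) h = combine (annihilator_covector s s) J0 J1 h + A' h"
    using annihilator_combine_J[OF s s A rho] by blast
  have a: "annihilator s F h = A' h" if "h \<in> energies" for h
    using annihilator_cong[OF _ that F] A'(2)[OF that] by (simp add: combine_annihilator_self)
  hence alg: "alg (k + 4) (\<rho> + 3 * m * (2 * e + 3)) (annihilator s F)" using alg_cong[OF _ A'(1)] by simp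
  show ?thesis
  proof (cases "\<exists>h\<in>energies. annihilator s F h \<noteq> 0")
    case True
    from zeros_le_annihilator(1)[OF False s smF zeros_le_alg[OF alg True]]
    show ?thesis by (rule zeros_le_mono) simp
  next
    case ne: False
    have "zeros_le energies F (8 * e + 7)"
      by (rule zeros_le_annihilator(2)[OF False s smF _ nz]) (use ne in blast)
    thus ?thesis by (rule zeros_le_mono) simp
  qed
qed

text \<open>A first operator removes the complete integrals at the cost of \<open>8 d + 7\<close> zeros. The coefficients of
  the incomplete integrals then have degree \<open>3 d + 3\<close>, and the algebraic part has
  \<open>\<rho> = (9 d + 11) m\<close>. A second operator removes the incomplete integrals at the cost of
  \<open>8 (3 d + 3) + 7\<close> zeros and leaves an algebraic function with at most
  \<open>(9 d + 11) m + 3 m (6 d + 9) + 24 m\<close> zeros.\<close>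

theorem zeros_le_melnikov_form:
  assumes r: "deg_le d r" and s: "deg_le d s" and A: "alg 0 ((3 * d + 2) * m) A"
    and F: "\<And>h. h \<in> energies \<Longrightarrow> F h = combine r I0 I1 h + (combine s J0 J1 h + A h)" and nz: "\<exists>h\<in>energies. F h \<noteq> 0"
  shows "zeros_le energies F (27 * m * d + 62 * m + 32 * d + 38)"
proof (cases "r = (0, 0)")
  case True
  hence "\<And>h. h \<in> energies \<Longrightarrow> F h = combine s J0 J1 h + A h" using F by (simp add: combine_def)
  from zeros_le_incomplete[OF s A order_refl this nz]
  show ?thesis by (rule zeros_le_mono) (simp_all add: algebra_simps)
next
  case False
  let ?G = "\<lambda>h. combine s J0 J1 h + A h"
  have smG: "smooth energies ?G" by (auto intro!: smooth_add smooth_combine_J alg_smooth[OF A])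
  have smF: "smooth energies F"
    by (rule smooth_cong[OF _ F[symmetric] smooth_add[OF _ smooth_combine smG]]) auto
  let ?rho = "(9 * d + 11) * m"
  obtain A' where A': "alg 4 ?rho A'"
    "\<And>h. h \<in> energies \<Longrightarrow> annihilator r ?G h = combine (annihilator_covector r s) J0 J1 h + A' h"
  proof (rule annihilator_combine_J[OF r s A order_refl])
    fix A' assume *: "alg (0 + 4) ((3 * d + 2) * m + 3 * m * (2 * d + 3)) A'"
      "\<And>h. h \<in> energies \<Longrightarrow> annihilator r ?G h = combine (annihilator_covector r s) J0 J1 h + A' h"
    have "(3 * d + 2) * m + 3 * m * (2 * d + 3) = ?rho" "0 + 4 = (4::nat)" by (auto simp: algebra_simps)
    thus thesis using that * by metis
  qed
  have "annihilator r F h = annihilator r ?G h" if h: "h \<in> energies" for h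
  proof -
    let ?C = "combine r I0 I1"
    have sm: "smooth energies ?C" "smooth energies (scaled_deriv ?C)" "smooth energies (scaled_deriv ?G)"
      by (rule smooth_combine) (rule smooth_scaled_deriv[OF _ smooth_combine] smooth_scaled_deriv[OF _ smG], simp)+
    have d1: "scaled_deriv F x = scaled_deriv ?C x + scaled_deriv ?G x" if "x \<in> energies" for x
      using scaled_deriv_cong[OF _ that F] scaled_deriv_add[OF sm(1) smG that] by simp
    have d2: "scaled_deriv (scaled_deriv F) h = scaled_deriv (scaled_deriv ?C) h + scaled_deriv (scaled_deriv ?G) h"
      using scaled_deriv_cong[OF _ h d1] scaled_deriv_add[OF sm(2,3) h] by simp
    have "annihilator r F h = annihilator r ?C h + annihilator r ?G h"
      unfolding annihilator_def d2 d1[OF h] F[OF h] by (simp add: algebra_simps)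
    thus ?thesis using annihilator_combine[OF h] by simp
  qed
  hence a: "annihilator r F h = combine (annihilator_covector r s) J0 J1 h + A' h" if "h \<in> energies" for h
    using A'(2) that by simp
  show ?thesis
  proof (cases "\<exists>h\<in>energies. annihilator r F h \<noteq> 0")
    case True
    have e: "deg_le (3 * d + 3) (annihilator_covector r s)"
      using deg_le_annihilator_covector[OF r s] by (simp add: algebra_simps)
    have "(3 * (3 * d + 3) + 2) * m \<le> ?rho" by simp
    from zeros_le_annihilator(1)[OF False r smF zeros_le_incomplete[OF e A'(1) this a True]]
    show ?thesis by (rule zeros_le_mono) (simp_all add: algebra_simps)
  next
    case ne: False
    have "zeros_le energies F (8 * d + 7)"
      by (rule zeros_le_annihilator(2)[OF False r smF _ nz]) (use ne in blast)
    thus ?thesis by (rule zeros_le_mono) simp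
  qed
qed

end

section \<open>Tools from calculus\<close>

text \<open>A differentiable solution gains one derivative from each use of the equations.\<close>

lemma smooth_linear_system:
  assumes S: "open S" and c: "smooth S a" "smooth S b" "smooth S c" "smooth S d" "smooth S e" "smooth S f"
    and X: "\<And>x. x \<in> S \<Longrightarrow> (X has_real_derivative a x * X x + b x * Y x + e x) (at x)"
    and Y: "\<And>x. x \<in> S \<Longrightarrow> (Y has_real_derivative c x * X x + d x * Y x + f x) (at x)"
  shows "smooth S X" "smooth S Y"
proof -
  have "diff_times k S X \<and> diff_times k S Y" for k
  proof (induction k)
    case (Suc k)
    have c': "diff_times k S a" "diff_times k S b" "diff_times k S c" "diff_times k S d" "diff_times k S e" "diff_times k S f"
      using c by (auto simp: smooth_def)
    show ?case
      by (intro conjI; rule diff_timesI[OF S X] diff_timesI[OF S Y])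
         (use Suc c' S in \<open>auto intro!: diff_times_add diff_times_mult\<close>)
  qed simp
  thus "smooth S X" "smooth S Y" by (auto simp: smooth_def)
qed

lemma deriv_of_inverse:
  fixes f g D :: "real \<Rightarrow> real"
  assumes x: "a < x" "x < b" and gf: "\<And>t. a < t \<Longrightarrow> t < b \<Longrightarrow> g (f t) = t"
    and D: "\<And>t. a < t \<Longrightarrow> t < b \<Longrightarrow> (f has_real_derivative D t) (at t)" and nz: "D x \<noteq> 0"
    and T: "open T" "f x \<in> T" and fg: "\<And>y. y \<in> T \<Longrightarrow> f (g y) = y"
  shows "(g has_real_derivative inverse (D x)) (at (f x))"
proof -
  obtain a' b' where ab: "a < a'" "a' < x" "x < b'" "b' < b" using x dense by metis
  have cont: "isCont g (f x)"
  proof (rule isCont_inverse_function2[of a' x b'])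
    show "isCont f t" if "a' \<le> t" "t \<le> b'" for t by (rule DERIV_isCont[OF D]) (use ab that in auto)
  qed (use ab gf in auto)
  obtain e where e: "e > 0" "\<And>y. \<bar>y - f x\<bar> < e \<Longrightarrow> y \<in> T"
    using T by (auto simp: open_real)
  have "(f has_real_derivative D x) (at (g (f x)))" using gf[OF x] D[OF x] by simp
  thus ?thesis
    by (rule DERIV_inverse_function[where a = "f x - e" and b = "f x + e"]) (use e fg cont nz in auto)
qed

text \<open>As a function of the parameter and of the upper limit, the integral has the partial derivatives
  \<open>integral {0..y} (fx x)\<close> and \<open>f x y\<close>; the latter is continuous, so the chain rule applies.\<close>

lemma leibniz_moving:
  fixes f fx :: "real \<Rightarrow> real \<Rightarrow> real"
  assumes U: "open U" "convex U" "x0 \<in> U"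
    and fx: "\<And>x t. x \<in> U \<Longrightarrow> t \<in> {0..C} \<Longrightarrow> ((\<lambda>x. f x t) has_real_derivative fx x t) (at x)"
    and cf: "continuous_on (U \<times> {0..C}) (\<lambda>(x, t). f x t)"
    and cfx: "continuous_on (U \<times> {0..C}) (\<lambda>(x, t). fx x t)"
    and c: "(c has_real_derivative c') (at x0)" "0 < c x0" "c x0 < C"
  shows "((\<lambda>x. integral {0..c x} (f x)) has_real_derivative (integral {0..c x0} (fx x0) + f x0 (c x0) * c')) (at x0)"
proof -
  define Y where "Y = {0<..<C}"
  have cfx1: "continuous_on {0..C} (f x)" if "x \<in> U" for x
  proof -
    have "continuous_on {0..C} (Pair x)" by (intro continuous_intros)
    from continuous_on_compose2[OF cf this] that show ?thesis by auto
  qed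
  let ?F = "\<lambda>x y. integral {0..y} (f x)"
  have 1: "((\<lambda>x. ?F x (c x0)) has_derivative (*) (integral {0..c x0} (fx x0))) (at x0 within U)"
  proof -
    have "((\<lambda>x. integral (cbox 0 (c x0)) (f x)) has_field_derivative integral (cbox 0 (c x0)) (fx x0)) (at x0 within U)"
    proof (rule leibniz_rule_field_derivative)
      show "((\<lambda>x. f x t) has_field_derivative fx x t) (at x within U)" if "x \<in> U" "t \<in> cbox 0 (c x0)" for x t
        using fx[of x t] that c by (auto intro: has_field_derivative_at_within)
      show "f x integrable_on cbox 0 (c x0)" if "x \<in> U" for x
        by (rule integrable_continuous) (use cfx1[OF that] c in \<open>auto intro: continuous_on_subset\<close>)
      show "continuous_on (U \<times> cbox 0 (c x0)) (\<lambda>(x, t). fx x t)"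
        by (rule continuous_on_subset[OF cfx]) (use c in auto)
    qed (use U in auto)
    thus ?thesis by (simp add: has_field_derivative_def)
  qed
  have 2: "((\<lambda>y. ?F x y) has_derivative blinfun_apply (blinfun_mult_right (f x y))) (at y within Y)"
    if "x \<in> U" "y \<in> Y" for x y
  proof -
    have "((\<lambda>y. ?F x y) has_real_derivative f x y) (at y within {0..C})"
      using integral_has_real_derivative[OF cfx1[OF that(1)], of y] that by (auto simp: Y_def)
    hence "((\<lambda>y. ?F x y) has_real_derivative f x y) (at y within Y)"
      by (rule DERIV_subset) (auto simp: Y_def)
    thus ?thesis by (simp add: has_field_derivative_def blinfun_mult_right.rep_eq)
  qed
  have xY: "c x0 \<in> Y" using c by (simp add: Y_def)
  have 3: "continuous (at (x0, c x0) within U \<times> Y) (\<lambda>(x, y). blinfun_mult_right (f x y))"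
  proof -
    have "continuous_on (U \<times> Y) (\<lambda>p. f (fst p) (snd p))"
      by (rule continuous_on_subset[OF cf[unfolded split_beta]]) (auto simp: Y_def)
    hence "continuous_on (U \<times> Y) (\<lambda>p. blinfun_mult_right (f (fst p) (snd p)))"
      by (intro bounded_linear.continuous_on[OF bounded_linear_blinfun_mult_right])
    thus ?thesis using xY U by (simp add: continuous_on_eq_continuous_within case_prod_unfold)
  qed
  have "((\<lambda>(x, y). ?F x y) has_derivative
      (\<lambda>(tx, ty). integral {0..c x0} (fx x0) * tx + blinfun_mult_right (f x0 (c x0)) ty)) (at (x0, c x0) within U \<times> Y)"
    by (rule has_derivative_partialsI[OF 1 2 3 xY]) (auto simp: Y_def)
  hence F: "((\<lambda>(x, y). ?F x y) has_derivative
      (\<lambda>(tx, ty). integral {0..c x0} (fx x0) * tx + f x0 (c x0) * ty)) (at (x0, c x0))"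
    using xY U by (subst (asm) at_within_open) (auto simp: Y_def blinfun_mult_right.rep_eq intro: open_Times)
  have g: "((\<lambda>x. (x, c x)) has_derivative (\<lambda>t. (t, c' * t))) (at x0)"
    using c(1) by (auto intro!: derivative_eq_intros simp: has_field_derivative_def)
  have "((\<lambda>x. ?F x (c x)) has_derivative (\<lambda>t. integral {0..c x0} (fx x0) * t + f x0 (c x0) * (c' * t))) (at x0)"
    using has_derivative_compose[OF g F] by (simp add: case_prod_beta)
  thus ?thesis
    by (rule has_derivative_imp_has_field_derivative) (simp add: algebra_simps)
qed

section \<open>A coordinate in which the Hamiltonian is quadratic\<close>

text \<open>In the coordinate \<open>u = x sqrt (1 - 2 x / 3)\<close> the Hamiltonian is \<open>(u\<^sup>2 + y\<^sup>2) / 2\<close>, and the ovals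
  become circles. The map is increasing on the interval \<open>(-1/2, 1)\<close>, which contains the projections of
  all ovals, and maps it onto the interval \<open>u\<^sup>2 < 1/3\<close>. The inverse is \<open>xi\<close>, with derivative \<open>xi'\<close>.\<close>

definition quad_coord :: "real \<Rightarrow> real" where "quad_coord x = x * sqrt (1 - 2 * x / 3)"

definition xi :: "real \<Rightarrow> real" where "xi u = (THE x. - 1/2 < x \<and> x < 1 \<and> quad_coord x = u)"

definition xi' :: "real \<Rightarrow> real" where "xi' u = sqrt (1 - 2 * xi u / 3) / (1 - xi u)"

lemma quad_coord_deriv:
  assumes "x < 3/2" shows "(quad_coord has_real_derivative (1 - x) / sqrt (1 - 2 * x / 3)) (at x)"
proof -
  have p: "1 - 2 * x / 3 > 0" using assms by simp
  have "(quad_coord has_real_derivative sqrt (1 - 2 * x / 3) + x * (- (2/3) * (inverse (sqrt (1 - 2 * x / 3)) / 2))) (at x)"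
    unfolding quad_coord_def using p by (auto intro!: derivative_eq_intros)
  moreover have "sqrt (1 - 2 * x / 3) + x * (- (2/3) * (inverse (sqrt (1 - 2 * x / 3)) / 2)) = (1 - x) / sqrt (1 - 2 * x / 3)"
    using p by (simp add: field_simps)
  ultimately show ?thesis by simp
qed

lemma isCont_quad_coord: "x < 3/2 \<Longrightarrow> isCont quad_coord x"
  using quad_coord_deriv DERIV_isCont by blast

lemma quad_coord_strict_mono:
  assumes "x < y" "y \<le> 1" shows "quad_coord x < quad_coord y"
proof (rule DERIV_pos_imp_increasing_open[OF assms(1)])
  show "\<exists>D. (quad_coord has_real_derivative D) (at t) \<and> 0 < D" if "x < t" "t < y" for t
    using quad_coord_deriv[of t] that assms by (intro exI[of _ "(1 - t) / sqrt (1 - 2 * t / 3)"]) auto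
  show "continuous_on {x..y} quad_coord"
    by (intro continuous_at_imp_continuous_on ballI isCont_quad_coord) (use assms in auto)
qed

lemma quad_coord_square: "x \<le> 3/2 \<Longrightarrow> (quad_coord x)\<^sup>2 = x\<^sup>2 - 2/3 * x ^ 3"
  by (simp add: quad_coord_def power_mult_distrib power2_eq_square power3_eq_cube algebra_simps)

lemma quad_coord_square_less: "- 1/2 < x \<Longrightarrow> x < 1 \<Longrightarrow> (quad_coord x)\<^sup>2 < 1/3"
proof -
  assume x: "- 1/2 < x" "x < 1"
  have "0 < (x - 1)\<^sup>2 * (2 * x + 1)" using x by (intro mult_pos_pos) auto
  hence "x\<^sup>2 - 2/3 * x ^ 3 < 1/3" by (simp add: power2_eq_square power3_eq_cube algebra_simps)
  thus ?thesis using x quad_coord_square[of x] by simp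
qed

lemma xi_ex1:
  assumes "u\<^sup>2 < 1/3" shows "\<exists>!x. - 1/2 < x \<and> x < 1 \<and> quad_coord x = u"
proof -
  have 1: "u < sqrt (1/3)" "- u < sqrt (1/3)" using assms by (auto intro!: real_less_rsqrt)
  have 2: "quad_coord 1 = sqrt (1/3)" by (simp add: quad_coord_def)
  have "sqrt (4/3) = 2 * sqrt (1/3 :: real)" by (simp add: real_sqrt_divide)
  hence 3: "quad_coord (-1/2) = - sqrt (1/3)" by (simp add: quad_coord_def)
  have "continuous_on {-1/2..1} quad_coord"
    by (intro continuous_at_imp_continuous_on ballI isCont_quad_coord) auto
  then obtain x where x: "-1/2 \<le> x" "x \<le> 1" "quad_coord x = u"
    using IVT'[of quad_coord "-1/2" u 1] 1 2 3 by auto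
  have "x \<noteq> 1" "x \<noteq> -1/2" using x 1 2 3 by auto
  show ?thesis
  proof (rule ex1I[of _ x])
    show "-1/2 < x \<and> x < 1 \<and> quad_coord x = u" using x \<open>x \<noteq> 1\<close> \<open>x \<noteq> -1/2\<close> by auto
    fix y assume y: "-1/2 < y \<and> y < 1 \<and> quad_coord y = u"
    show "y = x" using quad_coord_strict_mono[of x y] quad_coord_strict_mono[of y x] x y by (cases x y rule: linorder_cases) auto
  qed
qed

lemma xi:
  assumes "u\<^sup>2 < 1/3" shows "- 1/2 < xi u" "xi u < 1" "quad_coord (xi u) = u"
  using theI'[OF xi_ex1[OF assms]] by (auto simp: xi_def)

lemma xi_quad_coord: "- 1/2 < x \<Longrightarrow> x < 1 \<Longrightarrow> xi (quad_coord x) = x"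
  unfolding xi_def by (rule the1_equality[OF xi_ex1[OF quad_coord_square_less]]) auto

lemma xi_square: "u\<^sup>2 < 1/3 \<Longrightarrow> (xi u)\<^sup>2 - 2/3 * xi u ^ 3 = u\<^sup>2"
  using xi[of u] quad_coord_square[of "xi u"] by auto

lemma xi'_pos: "u\<^sup>2 < 1/3 \<Longrightarrow> xi' u > 0"
  using xi[of u] by (auto simp: xi'_def)

lemma xi_xi': assumes "u\<^sup>2 < 1/3" shows "(xi u - (xi u)\<^sup>2) * xi' u = u"
proof -
  have "xi u - (xi u)\<^sup>2 = xi u * (1 - xi u)" by (simp add: power2_eq_square algebra_simps)
  thus ?thesis using xi[OF assms] by (simp add: xi'_def quad_coord_def)
qed

lemma open_disc: "open {u::real. u\<^sup>2 < 1/3}"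
  by (intro open_Collect_less continuous_intros)

lemma xi_deriv:
  assumes "u\<^sup>2 < 1/3" shows "(xi has_real_derivative xi' u) (at u)"
proof -
  note x = xi[OF assms]
  have "(xi has_real_derivative inverse ((1 - xi u) / sqrt (1 - 2 * xi u / 3))) (at (quad_coord (xi u)))"
    by (rule deriv_of_inverse[where D = "\<lambda>x. (1 - x) / sqrt (1 - 2 * x / 3)", OF x(1,2) xi_quad_coord quad_coord_deriv _ open_disc])
       (use x assms xi(3) in simp_all)
  thus ?thesis using x by (simp add: xi'_def)
qed

lemma continuous_on_xi: "continuous_on {u. u\<^sup>2 < 1/3} xi"
  by (intro continuous_at_imp_continuous_on ballI) (use xi_deriv DERIV_isCont in blast)

lemma continuous_on_xi': "continuous_on {u. u\<^sup>2 < 1/3} xi'"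
  unfolding xi'_def[abs_def]
proof (intro continuous_intros continuous_on_xi ballI)
  show "1 - xi u \<noteq> 0" if "u \<in> {u. u\<^sup>2 < 1/3}" for u using xi(2)[of u] that by simp
qed simp

lemma xi_0: "xi 0 = 0"
  using xi_quad_coord[of 0] by (simp add: quad_coord_def)

lemma xi_strict_mono:
  assumes "u\<^sup>2 < 1/3" "w\<^sup>2 < 1/3" "u < w" shows "xi u < xi w"
proof (rule ccontr)
  assume "\<not> xi u < xi w"
  hence "quad_coord (xi w) \<le> quad_coord (xi u)"
    using quad_coord_strict_mono[of "xi w" "xi u"] xi[OF assms(1)] by (cases "xi w = xi u") auto
  thus False using xi[OF assms(1)] xi[OF assms(2)] assms by simp
qed

section \<open>Integrals along an arc of the orbit\<close>

definition rho :: "real \<Rightarrow> real" where "rho h = sqrt (2 * h)"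

text \<open>The oval of energy \<open>h\<close>, parametrized by an angle \<open>p\<close> that increases in the direction of the flow;
  \<open>orbit_w h p\<close> is the derivative of the time with respect to the angle.\<close>

definition orbit_x :: "real \<Rightarrow> real \<Rightarrow> real" where "orbit_x h p = xi (rho h * cos p)"
definition orbit_y :: "real \<Rightarrow> real \<Rightarrow> real" where "orbit_y h p = - (rho h * sin p)"
definition orbit_w :: "real \<Rightarrow> real \<Rightarrow> real" where "orbit_w h p = xi' (rho h * cos p)"

lemma rho_pos: "h \<in> energies \<Longrightarrow> rho h > 0"
  and rho_square: "h \<in> energies \<Longrightarrow> (rho h)\<^sup>2 = 2 * h"
  by (auto simp: rho_def)

lemma rho_cos_disc: "h \<in> energies \<Longrightarrow> (rho h * cos p)\<^sup>2 < 1/3"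
proof -
  assume h: "h \<in> energies"
  have "(cos p)\<^sup>2 \<le> 1" by (simp add: abs_square_le_1)
  hence "2 * h * (cos p)\<^sup>2 \<le> 2 * h * 1" using h by (intro mult_left_mono) auto
  also have "\<dots> < 1/3" using h by simp
  finally show ?thesis by (simp only: power_mult_distrib rho_square[OF h])
qed

lemma orbit_w_pos: "h \<in> energies \<Longrightarrow> orbit_w h p > 0"
  unfolding orbit_w_def by (rule xi'_pos[OF rho_cos_disc])

lemma orbit_x_deriv:
  assumes "h \<in> energies" shows "(orbit_x h has_real_derivative orbit_y h p * orbit_w h p) (at p)"
proof -
  have "((\<lambda>p. rho h * cos p) has_real_derivative - (rho h * sin p)) (at p)"
    by (auto intro!: derivative_eq_intros)
  from DERIV_chain2[OF xi_deriv[OF rho_cos_disc[OF assms]] this] show ?thesis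
    by (simp add: orbit_x_def[abs_def] orbit_y_def orbit_w_def mult.commute)
qed

lemma orbit_x_w: "h \<in> energies \<Longrightarrow> (orbit_x h p - (orbit_x h p)\<^sup>2) * orbit_w h p = rho h * cos p"
  unfolding orbit_x_def orbit_w_def by (rule xi_xi'[OF rho_cos_disc])

lemma orbit_y_deriv:
  assumes "h \<in> energies"
  shows "(orbit_y h has_real_derivative - (orbit_x h p - (orbit_x h p)\<^sup>2) * orbit_w h p) (at p)"
proof -
  have "(orbit_y h has_real_derivative - (rho h * cos p)) (at p)"
    unfolding orbit_y_def[abs_def] by (auto intro!: derivative_eq_intros)
  thus ?thesis by (simp only: mult_minus_left orbit_x_w[OF assms])
qed

lemma orbit_energy:
  assumes "h \<in> energies" shows "(orbit_y h p)\<^sup>2 = 2 * h - (orbit_x h p)\<^sup>2 + 2/3 * orbit_x h p ^ 3"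
proof -
  have "(rho h * sin p)\<^sup>2 = (rho h)\<^sup>2 - (rho h * cos p)\<^sup>2"
    by (simp add: power_mult_distrib sin_squared_eq algebra_simps)
  also have "\<dots> = 2 * h - ((orbit_x h p)\<^sup>2 - 2/3 * orbit_x h p ^ 3)"
    unfolding orbit_x_def xi_square[OF rho_cos_disc[OF assms]] by (simp only: rho_square[OF assms])
  finally show ?thesis by (simp add: orbit_y_def)
qed

lemma orbit_minus: "orbit_x h (- p) = orbit_x h p" "orbit_y h (- p) = - orbit_y h p" "orbit_w h (- p) = orbit_w h p"
  by (simp_all add: orbit_x_def orbit_y_def orbit_w_def)

lemma continuous_orbit:
  assumes "h \<in> energies"
  shows "continuous_on A (orbit_x h)" "continuous_on A (orbit_y h)" "continuous_on A (orbit_w h)"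
proof -
  have c: "continuous_on A (\<lambda>p. rho h * cos p)" by (intro continuous_intros)
  show "continuous_on A (orbit_x h)" unfolding orbit_x_def[abs_def]
    by (rule continuous_on_compose2[OF continuous_on_xi c]) (use rho_cos_disc[OF assms] in auto)
  show "continuous_on A (orbit_w h)" unfolding orbit_w_def[abs_def]
    by (rule continuous_on_compose2[OF continuous_on_xi' c]) (use rho_cos_disc[OF assms] in auto)
  show "continuous_on A (orbit_y h)" unfolding orbit_y_def[abs_def] by (intro continuous_intros)
qed

definition monom_fun :: "nat \<Rightarrow> nat \<Rightarrow> real \<Rightarrow> real \<Rightarrow> real" where
  "monom_fun i j h p = orbit_x h p ^ i * orbit_y h p ^ j * orbit_w h p"

text \<open>The integral of \<open>x ^ i y ^ j dt\<close> over the symmetric arc of all points with angle between \<open>-c\<close> and \<open>c\<close>.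
  The whole oval has \<open>c = pi\<close>, the part to the right of the switching curve has the angle of a
  switching point as \<open>c\<close>.\<close>

definition arc :: "nat \<Rightarrow> nat \<Rightarrow> real \<Rightarrow> real \<Rightarrow> real" where
  "arc i j h c = integral {-c..c} (monom_fun i j h)"

lemma continuous_monom_fun: "h \<in> energies \<Longrightarrow> continuous_on A (monom_fun i j h)"
  unfolding monom_fun_def[abs_def] by (intro continuous_intros continuous_orbit)

lemma integrable_monom_fun: "h \<in> energies \<Longrightarrow> monom_fun i j h integrable_on {a..b}"
  by (intro integrable_continuous_interval continuous_monom_fun)

lemma arc_energy:
  assumes "h \<in> energies"
  shows "arc i (j + 2) h c = 2 * h * arc i j h c - arc (i + 2) j h c + 2/3 * arc (i + 3) j h c"
proof -
  have "monom_fun i (j + 2) h = (\<lambda>p. 2 * h * monom_fun i j h p - monom_fun (i + 2) j h p + 2/3 * monom_fun (i + 3) j h p)"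
  proof
    fix p
    have "monom_fun i (j + 2) h p = orbit_x h p ^ i * orbit_y h p ^ j * orbit_w h p * (orbit_y h p)\<^sup>2"
      by (simp add: monom_fun_def power_add power2_eq_square)
    thus "monom_fun i (j + 2) h p = 2 * h * monom_fun i j h p - monom_fun (i + 2) j h p + 2/3 * monom_fun (i + 3) j h p"
      unfolding orbit_energy[OF assms] by (simp add: monom_fun_def power_add power2_eq_square algebra_simps)
  qed
  hence "arc i (j + 2) h c = integral {-c..c} (\<lambda>p. 2 * h * monom_fun i j h p - monom_fun (i + 2) j h p + 2/3 * monom_fun (i + 3) j h p)"
    by (simp add: arc_def)
  also have "\<dots> = 2 * h * arc i j h c - arc (i + 2) j h c + 2/3 * arc (i + 3) j h c"
    unfolding arc_def
    by (intro integral_unique has_integral_diff has_integral_add has_integral_mult_right integrable_integral integrable_monom_fun assms)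
  finally show ?thesis .
qed

text \<open>The integral of \<open>d (x ^ i y ^ j)\<close> for odd \<open>j = 2 l + 1\<close>.\<close>

lemma arc_exact:
  assumes "h \<in> energies" "c \<ge> 0"
  shows "real i * arc (i - 1) (2 * l + 2) h c
     - real (2 * l + 1) * (arc (i + 1) (2 * l) h c - arc (i + 2) (2 * l) h c)
     = 2 * orbit_x h c ^ i * orbit_y h c ^ (2 * l + 1)"
proof -
  let ?f = "\<lambda>p. real i * monom_fun (i - 1) (2 * l + 2) h p
     - real (2 * l + 1) * (monom_fun (i + 1) (2 * l) h p - monom_fun (i + 2) (2 * l) h p)"
  let ?g = "\<lambda>p. orbit_x h p ^ i * orbit_y h p ^ (2 * l + 1)"
  have "(?g has_real_derivative ?f p) (at p)" for p
  proof -
    have D: "(?g has_real_derivative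
       (real i * (orbit_y h p * orbit_w h p * orbit_x h p ^ (i - Suc 0))) * orbit_y h p ^ (2 * l + 1)
       + (real (2 * l + 1) * (- (orbit_x h p - (orbit_x h p)\<^sup>2) * orbit_w h p * orbit_y h p ^ (2 * l + 1 - Suc 0))) * orbit_x h p ^ i) (at p)"
      by (rule DERIV_mult[OF DERIV_power[OF orbit_x_deriv[OF assms(1)]] DERIV_power[OF orbit_y_deriv[OF assms(1)]]])
    have eq: "(real i * (orbit_y h p * orbit_w h p * orbit_x h p ^ (i - Suc 0))) * orbit_y h p ^ (2 * l + 1)
       + (real (2 * l + 1) * (- (orbit_x h p - (orbit_x h p)\<^sup>2) * orbit_w h p * orbit_y h p ^ (2 * l + 1 - Suc 0))) * orbit_x h p ^ i
       = ?f p"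
      by (simp add: monom_fun_def power_add power2_eq_square algebra_simps)
    show ?thesis using D unfolding eq .
  qed
  hence "(?f has_integral (?g c - ?g (- c))) {-c..c}"
    using assms(2)
    by (intro fundamental_theorem_of_calculus)
       (auto simp: has_real_derivative_iff_has_vector_derivative[symmetric] intro: has_field_derivative_at_within)
  hence "integral {-c..c} ?f = ?g c - ?g (- c)" by (rule integral_unique)
  moreover have "integral {-c..c} ?f = real i * arc (i - 1) (2 * l + 2) h c
     - real (2 * l + 1) * (arc (i + 1) (2 * l) h c - arc (i + 2) (2 * l) h c)"
    unfolding arc_def
    by (intro integral_unique has_integral_diff has_integral_mult_right integrable_integral integrable_monom_fun assms)
  moreover have "?g c - ?g (- c) = 2 * orbit_x h c ^ i * orbit_y h c ^ (2 * l + 1)"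
    by (simp add: orbit_minus)
  ultimately show ?thesis by simp
qed

lemma arc_odd: "arc i (2 * l + 1) h c = 0"
proof -
  have "arc i (2 * l + 1) h c = integral {-c..c} (\<lambda>p. monom_fun i (2 * l + 1) h (- p))"
    unfolding arc_def using Henstock_Kurzweil_Integration.integral_reflect_real[of c "-c" "monom_fun i (2 * l + 1) h"] by simp
  also have "(\<lambda>p. monom_fun i (2 * l + 1) h (- p)) = (\<lambda>p. - monom_fun i (2 * l + 1) h p)"
    by (auto simp: monom_fun_def orbit_minus)
  finally show ?thesis by (simp add: arc_def)
qed

lemma arc_even:
  assumes "h \<in> energies" "c \<ge> 0" shows "arc i (2 * l) h c = 2 * integral {0..c} (monom_fun i (2 * l) h)"
proof -
  let ?f = "monom_fun i (2 * l) h"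
  have "?f = (\<lambda>p. ?f (- p))" by (auto simp: monom_fun_def orbit_minus)
  hence "integral {-c..0} ?f = integral {0..c} ?f"
    using Henstock_Kurzweil_Integration.integral_reflect_real[of c 0 ?f] by simp
  thus ?thesis
    using Henstock_Kurzweil_Integration.integral_combine[of "-c" 0 c ?f] integrable_monom_fun[OF assms(1)] assms(2)
    by (simp add: arc_def)
qed

text \<open>Integration by parts replaces the integrals of \<open>x\<^sup>k y dx\<close> by integrals which do not contain the
  derivative of the coordinate change, so that they can be differentiated with respect to \<open>h\<close>.\<close>

definition xi_pow :: "nat \<Rightarrow> real \<Rightarrow> real" where "xi_pow k u = xi u ^ (k + 1) / real (k + 1)"

text \<open>Up to a boundary term, the integral of \<open>x\<^sup>k y dx\<close> over the arc from \<open>-c\<close> to \<open>c\<close> is the integral of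
  this function from \<open>0\<close> to \<open>c\<close> (\<open>arc_by_parts\<close>).\<close>

definition angle_density :: "nat \<Rightarrow> real \<Rightarrow> real \<Rightarrow> real" where
  "angle_density k h p = 2 * xi_pow k (rho h * cos p) * (rho h * cos p)"

text \<open>The derivative of \<open>angle_density\<close> with respect to the energy.\<close>

definition angle_density' :: "nat \<Rightarrow> real \<Rightarrow> real \<Rightarrow> real" where
  "angle_density' k h p = 2 * (orbit_x h p ^ k * orbit_w h p * (rho h * cos p) + xi_pow k (rho h * cos p)) * cos p / rho h"

lemma xi_pow_deriv: "u\<^sup>2 < 1/3 \<Longrightarrow> (xi_pow k has_real_derivative xi u ^ k * xi' u) (at u)"
  unfolding xi_pow_def[abs_def]
  using DERIV_cdivide[OF DERIV_power[OF xi_deriv[of u], of "k + 1"], of "real (k + 1)"] by (simp add: mult.commute)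

lemma xi_pow_orbit_deriv:
  assumes "h \<in> energies"
  shows "((\<lambda>p. xi_pow k (rho h * cos p)) has_real_derivative orbit_x h p ^ k * orbit_w h p * orbit_y h p) (at p)"
proof -
  have "((\<lambda>p. rho h * cos p) has_real_derivative orbit_y h p) (at p)"
    unfolding orbit_y_def by (auto intro!: derivative_eq_intros)
  from DERIV_chain2[OF xi_pow_deriv[OF rho_cos_disc[OF assms]] this] show ?thesis
    by (simp add: orbit_x_def orbit_w_def)
qed

lemma rho_deriv: assumes "h \<in> energies" shows "(rho has_real_derivative 1 / rho h) (at h)"
proof -
  have "(rho has_real_derivative 2 * (inverse (sqrt (2 * h)) / 2)) (at h)"
    unfolding rho_def[abs_def] using assms by (auto intro!: derivative_eq_intros)
  thus ?thesis by (simp add: rho_def field_simps)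
qed

lemma angle_density_deriv:
  assumes "h \<in> energies" shows "((\<lambda>h. angle_density k h p) has_real_derivative angle_density' k h p) (at h)"
proof -
  have r: "((\<lambda>h. rho h * cos p) has_real_derivative cos p / rho h) (at h)"
    using DERIV_cmult_right[OF rho_deriv[OF assms], of "cos p"] by simp
  have x: "((\<lambda>h. xi_pow k (rho h * cos p)) has_real_derivative orbit_x h p ^ k * orbit_w h p * (cos p / rho h)) (at h)"
    using DERIV_chain2[OF xi_pow_deriv[OF rho_cos_disc[OF assms]] r] by (simp add: orbit_x_def orbit_w_def)
  have "((\<lambda>h. 2 * (xi_pow k (rho h * cos p) * (rho h * cos p))) has_real_derivative
      2 * (orbit_x h p ^ k * orbit_w h p * (cos p / rho h) * (rho h * cos p) + cos p / rho h * xi_pow k (rho h * cos p))) (at h)"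
    by (rule DERIV_cmult[OF DERIV_mult[OF x r]])
  moreover have "2 * (orbit_x h p ^ k * orbit_w h p * (cos p / rho h) * (rho h * cos p) + cos p / rho h * xi_pow k (rho h * cos p)) = angle_density' k h p"
  proof -
    have "2 * (A * (c / r) * (r * c) + c / r * Q) = 2 * (A * (r * c) + Q) * c / r" for A Q c r :: real
      by (simp add: algebra_simps add_divide_distrib)
    thus ?thesis unfolding angle_density'_def by blast
  qed
  ultimately show ?thesis by (simp add: angle_density_def mult.assoc)
qed

lemma arc_by_parts:
  assumes "h \<in> energies" "c \<ge> 0"
  shows "arc k 2 h c = integral {0..c} (angle_density k h) + 2 * xi_pow k (rho h * cos c) * orbit_y h c"
proof -
  let ?g = "\<lambda>p. 2 * (xi_pow k (rho h * cos p) * orbit_y h p)"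
  let ?f = "\<lambda>p. 2 * monom_fun k 2 h p - angle_density k h p"
  have "(?g has_real_derivative ?f p) (at p)" for p
  proof -
    have y: "(orbit_y h has_real_derivative - (rho h * cos p)) (at p)"
      unfolding orbit_y_def[abs_def] by (auto intro!: derivative_eq_intros)
    have "(?g has_real_derivative 2 * (orbit_x h p ^ k * orbit_w h p * orbit_y h p * orbit_y h p
       + (- (rho h * cos p)) * xi_pow k (rho h * cos p))) (at p)"
      by (rule DERIV_cmult[OF DERIV_mult[OF xi_pow_orbit_deriv[OF assms(1)] y]])
    thus ?thesis by (simp add: angle_density_def monom_fun_def power2_eq_square algebra_simps)
  qed
  hence "(?f has_integral (?g c - ?g 0)) {0..c}"
    using assms(2)
    by (intro fundamental_theorem_of_calculus)
       (auto simp: has_real_derivative_iff_has_vector_derivative[symmetric] intro: has_field_derivative_at_within)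
  moreover have "((\<lambda>p. 2 * monom_fun k 2 h p) has_integral 2 * integral {0..c} (monom_fun k 2 h)) {0..c}"
    by (intro has_integral_mult_right integrable_integral integrable_monom_fun assms)
  ultimately have "((\<lambda>p. 2 * monom_fun k 2 h p - ?f p) has_integral 2 * integral {0..c} (monom_fun k 2 h) - (?g c - ?g 0)) {0..c}"
    by (rule has_integral_diff[rotated])
  hence "integral {0..c} (angle_density k h) = 2 * integral {0..c} (monom_fun k 2 h) - (?g c - ?g 0)"
    by (simp add: integral_unique)
  thus ?thesis using arc_even[OF assms, of k 1] by (simp add: orbit_y_def numeral_2_eq_2)
qed

text \<open>Integration by parts in the reverse direction: up to a boundary term, the derivative of the
  integral of \<open>x\<^sup>k y dx\<close> with respect to the energy is the integral of \<open>x\<^sup>k dt\<close>.\<close>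

lemma integral_angle_density':
  assumes "h \<in> energies" "c \<ge> 0"
  shows "integral {0..c} (angle_density' k h) = arc k 0 h c + 2 * xi_pow k (rho h * cos c) * sin c / rho h"
proof -
  let ?g = "\<lambda>p. 2 / rho h * (xi_pow k (rho h * cos p) * sin p)"
  let ?f = "\<lambda>p. angle_density' k h p - 2 * monom_fun k 0 h p"
  have "(?g has_real_derivative ?f p) (at p)" for p
  proof -
    have "(?g has_real_derivative 2 / rho h * (orbit_x h p ^ k * orbit_w h p * orbit_y h p * sin p
       + cos p * xi_pow k (rho h * cos p))) (at p)"
      by (rule DERIV_cmult[OF DERIV_mult[OF xi_pow_orbit_deriv[OF assms(1)] DERIV_sin]])
    moreover have "2 / rho h * (orbit_x h p ^ k * orbit_w h p * orbit_y h p * sin p + cos p * xi_pow k (rho h * cos p)) = ?f p"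
    proof -
      have aux: "2 / r * (A * - (r * s) * s + c * Q) = 2 * (A * (r * c) + Q) * c / r - 2 * A"
        if "r > 0" "s\<^sup>2 + c\<^sup>2 = 1" for r s c A Q :: real
      proof -
        have s: "s * s = 1 - c * c" using that(2) by (simp add: power2_eq_square)
        have "2 / r * (A * - (r * s) * s + c * Q) = - (2 * A * (s * s)) + 2 * Q * c / r"
          using that(1) by (simp add: field_simps)
        also have "\<dots> = 2 * (A * (r * c) + Q) * c / r - 2 * A"
          unfolding s using that(1) by (simp add: field_simps)
        finally show ?thesis .
      qed
      show ?thesis
        using aux[OF rho_pos[OF assms(1)] sin_cos_squared_add, of "orbit_x h p ^ k * orbit_w h p"]
        by (simp add: angle_density'_def monom_fun_def orbit_y_def)
    qed
    ultimately show ?thesis by simp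
  qed
  hence "(?f has_integral (?g c - ?g 0)) {0..c}"
    using assms(2)
    by (intro fundamental_theorem_of_calculus)
       (auto simp: has_real_derivative_iff_has_vector_derivative[symmetric] intro: has_field_derivative_at_within)
  moreover have "((\<lambda>p. 2 * monom_fun k 0 h p) has_integral 2 * integral {0..c} (monom_fun k 0 h)) {0..c}"
    by (intro has_integral_mult_right integrable_integral integrable_monom_fun assms)
  ultimately have "((\<lambda>p. ?f p + 2 * monom_fun k 0 h p) has_integral (?g c - ?g 0) + 2 * integral {0..c} (monom_fun k 0 h)) {0..c}"
    by (rule has_integral_add)
  hence "integral {0..c} (angle_density' k h) = (?g c - ?g 0) + 2 * integral {0..c} (monom_fun k 0 h)"
    by (simp add: integral_unique)
  thus ?thesis using arc_even[OF assms, of k 0] by simp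
qed

lemma angle_density_integral_deriv:
  assumes h: "h0 \<in> energies" and c: "(c has_real_derivative c') (at h0)" "0 < c h0"
  shows "((\<lambda>h. integral {0..c h} (angle_density k h)) has_real_derivative
     (arc k 0 h0 (c h0) + 2 * xi_pow k (rho h0 * cos (c h0)) * sin (c h0) / rho h0 + angle_density k h0 (c h0) * c')) (at h0)"
proof -
  let ?C = "c h0 + 1"
  have rc: "continuous_on (energies \<times> {0..?C}) (\<lambda>q. rho (fst q) * cos (snd q))"
    unfolding rho_def by (intro continuous_intros)
  have comp: "continuous_on (energies \<times> {0..?C}) (\<lambda>q. f (rho (fst q) * cos (snd q)))" if "continuous_on {u. u\<^sup>2 < 1/3} f" for f :: "real \<Rightarrow> real"
    by (rule continuous_on_compose2[OF that rc]) (use rho_cos_disc in auto)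
  have xp: "continuous_on {u. u\<^sup>2 < 1/3} (xi_pow k)"
    unfolding xi_pow_def[abs_def] by (intro continuous_intros continuous_on_xi) auto
  have "((\<lambda>h. integral {0..c h} (angle_density k h)) has_real_derivative
      (integral {0..c h0} (angle_density' k h0) + angle_density k h0 (c h0) * c')) (at h0)"
  proof (rule leibniz_moving[where U = energies and C = ?C])
    show "continuous_on (energies \<times> {0..?C}) (\<lambda>(x, t). angle_density k x t)"
      unfolding angle_density_def case_prod_unfold by (intro continuous_intros rc comp xp)
    have "rho (fst q) \<noteq> 0" if "q \<in> energies \<times> {0..?C}" for q using that rho_pos[of "fst q"] by (auto simp: mem_Times_iff)
    thus "continuous_on (energies \<times> {0..?C}) (\<lambda>(x, t). angle_density' k x t)"
      unfolding angle_density'_def case_prod_unfold orbit_x_def orbit_w_def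
      by (intro continuous_intros rc comp xp continuous_on_xi continuous_on_xi' ballI) (auto simp: rho_def intro!: continuous_intros)
    show "((\<lambda>x. angle_density k x t) has_real_derivative angle_density' k x t) (at x)" if "x \<in> energies" for x t
      by (rule angle_density_deriv[OF that])
  qed (use h c in auto)
  thus ?thesis using integral_angle_density'[OF h, of "c h0" k] c by simp
qed

section \<open>The complete integrals\<close>

definition full :: "nat \<Rightarrow> nat \<Rightarrow> real \<Rightarrow> real" where "full i j h = arc i j h pi"

lemma full_energy: "h \<in> energies \<Longrightarrow> full i (j + 2) h = 2 * h * full i j h - full (i + 2) j h + 2/3 * full (i + 3) j h"
  unfolding full_def by (rule arc_energy)

lemma full_exact:
  "h \<in> energies \<Longrightarrow> real i * full (i - 1) (2 * l + 2) h - real (2 * l + 1) * (full (i + 1) (2 * l) h - full (i + 2) (2 * l) h) = 0"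
  unfolding full_def using arc_exact[of h pi i l] by (simp add: orbit_y_def)

lemma full_deriv: assumes "h \<in> energies" shows "(full k 2 has_real_derivative full k 0 h) (at h)"
proof -
  have "((\<lambda>h. integral {0..pi} (angle_density k h)) has_real_derivative full k 0 h) (at h)"
    using angle_density_integral_deriv[OF assms DERIV_const, of pi k] by (simp add: full_def)
  thus ?thesis
    by (rule has_field_derivative_transform_within_open[of _ _ _ energies])
       (use assms arc_by_parts[of _ pi k] in \<open>auto simp: full_def orbit_y_def\<close>)
qed

lemma full_0_2_pos: assumes "h \<in> energies" shows "full 0 2 h > 0"
proof -
  have nn: "monom_fun 0 2 h p \<ge> 0" for p using orbit_w_pos[OF assms, of p] by (simp add: monom_fun_def)
  have "monom_fun 0 2 h (pi/2) > 0"
    using orbit_w_pos[OF assms, of "pi/2"] rho_pos[OF assms] by (simp add: monom_fun_def orbit_y_def)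
  moreover have "pi / 2 \<in> {-pi..pi}" by auto
  ultimately have "full 0 2 h \<noteq> 0" unfolding full_def arc_def
    using integral_eq_0_iff[of "-pi" pi "monom_fun 0 2 h"] continuous_monom_fun[OF assms] nn by force
  moreover have "full 0 2 h \<ge> 0" unfolding full_def arc_def by (intro integral_nonneg integrable_monom_fun assms nn)
  ultimately show ?thesis by simp
qed

text \<open>The energy relation and the exact forms express the integrals of \<open>x\<^sup>k y dx\<close> by those of \<open>x\<^sup>k dt\<close>,
  \<open>k = 0, 1\<close>. The equations result when these relations are solved for the latter, which are the
  derivatives of the former.\<close>

lemma picard_fuchs_full:
  assumes "h \<in> energies"
  shows "poly Delta h * full 0 0 h = (5 * h - 1) * full 0 2 h + 7/6 * full 1 2 h"
    and "poly Delta h * full 1 0 h = - h * full 0 2 h + 7 * h * full 1 2 h"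
proof -
  have 1: "full 2 0 h = full 1 0 h" using full_exact[OF assms, of 0 0] by (simp add: numeral_eq_Suc)
  have 2: "full 0 2 h = full 2 0 h - full 3 0 h" using full_exact[OF assms, of 1 0] by (simp add: numeral_eq_Suc)
  have 3: "2 * full 1 2 h = full 3 0 h - full 4 0 h" using full_exact[OF assms, of 2 0] by (simp add: numeral_eq_Suc)
  have 4: "full 0 2 h = 2 * h * full 0 0 h - full 2 0 h + 2/3 * full 3 0 h"
    using full_energy[OF assms, of 0 0] by (simp add: numeral_eq_Suc)
  have 5: "full 1 2 h = 2 * h * full 1 0 h - full 3 0 h + 2/3 * full 4 0 h"
    using full_energy[OF assms, of 1 0] by (simp add: numeral_eq_Suc)
  have 6: "(6 * h - 1) * full 1 0 h = 7 * full 1 2 h - full 0 2 h"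
    using 1 2 3 5 by (simp add: algebra_simps)
  have 7: "6 * h * full 0 0 h = 5 * full 0 2 h + full 1 0 h"
    using 1 2 4 by (simp add: algebra_simps)
  show "poly Delta h * full 1 0 h = - h * full 0 2 h + 7 * h * full 1 2 h"
    using arg_cong[OF 6, of "\<lambda>x. h * x"] by (simp add: poly_Delta algebra_simps)
  have "6 * (poly Delta h * full 0 0 h) = (6 * h - 1) * (6 * h * full 0 0 h)"
    by (simp add: poly_Delta algebra_simps)
  also have "\<dots> = (6 * h - 1) * 5 * full 0 2 h + (6 * h - 1) * full 1 0 h"
    unfolding 7 by (simp add: algebra_simps)
  also have "\<dots> = 6 * ((5 * h - 1) * full 0 2 h + 7/6 * full 1 2 h)"
    unfolding 6 by (simp add: algebra_simps)
  finally show "poly Delta h * full 0 0 h = (5 * h - 1) * full 0 2 h + 7/6 * full 1 2 h" by simp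
qed

text \<open>The number \<open>Delta\<close> has no zeros between the singular energies, so the equations can be solved for
  the derivatives and determine smooth functions.\<close>

lemma smooth_picard_fuchs:
  assumes "smooth energies e0" "smooth energies e1"
    and "\<And>h. h \<in> energies \<Longrightarrow> (X has_real_derivative X' h) (at h)" "\<And>h. h \<in> energies \<Longrightarrow> (Y has_real_derivative Y' h) (at h)"
    and "\<And>h. h \<in> energies \<Longrightarrow> poly Delta h * X' h = (5 * h - 1) * X h + 7/6 * Y h + e0 h"
    and "\<And>h. h \<in> energies \<Longrightarrow> poly Delta h * Y' h = - h * X h + 7 * h * Y h + e1 h"
  shows "smooth energies X" "smooth energies Y"
proof -
  have D: "smooth energies (\<lambda>h. inverse (poly Delta h))" by (intro smooth_inverse smooth_poly_id Delta_nonzero) auto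
  have lin: "smooth energies (\<lambda>h. inverse (poly Delta h) * f h)" if "smooth energies f" for f by (rule smooth_mult[OF _ D that]) simp
  have p: "smooth energies (\<lambda>h. 5 * h - 1)" "smooth energies (\<lambda>h. 7 / 6)" "smooth energies (\<lambda>h. - 1 * h)" "smooth energies (\<lambda>h. 7 * h)"
    by (intro smooth_diff smooth_mult smooth_const smooth_id; simp)+
  have X: "(X has_real_derivative (inverse (poly Delta h) * (5 * h - 1)) * X h + (inverse (poly Delta h) * (7/6)) * Y h
      + inverse (poly Delta h) * e0 h) (at h)" if "h \<in> energies" for h
  proof -
    have "X' h = inverse (poly Delta h) * ((5 * h - 1) * X h + 7/6 * Y h + e0 h)"
      using assms(5)[OF that, symmetric] Delta_nonzero[OF that] by simp
    also have "\<dots> = (inverse (poly Delta h) * (5 * h - 1)) * X h + (inverse (poly Delta h) * (7/6)) * Y h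
      + inverse (poly Delta h) * e0 h" by (simp only: distrib_left mult.assoc)
    finally show ?thesis using assms(3)[OF that] by (simp only:)
  qed
  have Y: "(Y has_real_derivative (inverse (poly Delta h) * (- 1 * h)) * X h + (inverse (poly Delta h) * (7 * h)) * Y h
      + inverse (poly Delta h) * e1 h) (at h)" if "h \<in> energies" for h
  proof -
    have "Y' h = inverse (poly Delta h) * (- h * X h + 7 * h * Y h + e1 h)"
      using assms(6)[OF that, symmetric] Delta_nonzero[OF that] by simp
    also have "\<dots> = (inverse (poly Delta h) * (- 1 * h)) * X h + (inverse (poly Delta h) * (7 * h)) * Y h
      + inverse (poly Delta h) * e1 h" by (simp add: algebra_simps)
    finally show ?thesis using assms(4)[OF that] by (simp only:)
  qed
  show "smooth energies X" "smooth energies Y"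
    by (rule smooth_linear_system[OF _ lin[OF p(1)] lin[OF p(2)] lin[OF p(3)] lin[OF p(4)] lin[OF assms(1)] lin[OF assms(2)] X Y]; simp)+
qed

interpretation picard_fuchs "full 0 2" "full 1 2"
proof
  have pf: "poly Delta h * full 0 0 h = (5 * h - 1) * full 0 2 h + 7/6 * full 1 2 h + 0"
    "poly Delta h * full 1 0 h = - h * full 0 2 h + 7 * h * full 1 2 h + 0" if "h \<in> energies" for h
    by (simp_all only: picard_fuchs_full[OF that] add.right_neutral)
  show "smooth energies (full 0 2)" "smooth energies (full 1 2)"
    by (rule smooth_picard_fuchs[OF smooth_const[of energies 0] smooth_const[of energies 0] full_deriv full_deriv pf]; simp)+
  show "scaled_deriv (full 0 2) h = (5 * h - 1) * full 0 2 h + 7/6 * full 1 2 h"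
    "scaled_deriv (full 1 2) h = - h * full 0 2 h + 7 * h * full 1 2 h" if "h \<in> energies" for h
    using DERIV_imp_deriv[OF full_deriv[OF that]] picard_fuchs_full[OF that] by (simp_all add: scaled_deriv_def)
qed (rule full_0_2_pos)

section \<open>The switching points\<close>

lemma poly_switch_energy: "poly (switch_energy m) z = z / 2 + z ^ (2 * m) / 2 - z ^ (3 * m) / 3"
  by (simp add: switch_energy_def poly_monom)

lemma poly_pderiv_switch_energy:
  "m \<ge> 1 \<Longrightarrow> poly (pderiv (switch_energy m)) z = 1/2 + real m * z ^ (2 * m - 1) - real m * z ^ (3 * m - 1)"
  by (simp add: switch_energy_def pderiv_add pderiv_diff pderiv_monom poly_monom)

lemma pderiv_switch_energy_pos:
  assumes "m \<ge> 1" "0 \<le> z" "z \<le> 1" shows "poly (pderiv (switch_energy m)) z > 0"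
proof -
  have "z ^ (3 * m - 1) \<le> z ^ (2 * m - 1)" using assms by (intro power_decreasing) auto
  hence "real m * z ^ (3 * m - 1) \<le> real m * z ^ (2 * m - 1)" by (intro mult_left_mono) auto
  thus ?thesis unfolding poly_pderiv_switch_energy[OF assms(1)] by linarith
qed

locale exponent =
  fixes m :: nat
  assumes m: "m \<ge> 1"
begin

definition switch_z :: "real \<Rightarrow> real" where "switch_z h = (THE z. 0 < z \<and> z < 1 \<and> poly (switch_energy m) z = h)"
definition switch_y :: "real \<Rightarrow> real" where "switch_y h = sqrt (switch_z h)"
text \<open>The point of switching in the coordinates \<open>(u, y)\<close>, where the oval is a circle.\<close>

definition switch_u :: "real \<Rightarrow> real" where "switch_u h = sqrt (2 * h - switch_z h)"
definition switch_angle :: "real \<Rightarrow> real" where "switch_angle h = arctan (switch_y h / switch_u h)"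

lemma switch_energy_strict_mono:
  assumes "0 \<le> x" "x < y" "y \<le> 1" shows "poly (switch_energy m) x < poly (switch_energy m) y"
proof (rule DERIV_pos_imp_increasing[OF assms(2)])
  show "\<exists>D. (poly (switch_energy m) has_real_derivative D) (at t) \<and> 0 < D" if "x \<le> t" "t \<le> y" for t
    using pderiv_switch_energy_pos[OF m, of t] that assms poly_DERIV by (intro exI conjI) auto
qed

lemma switch_z_ex1:
  assumes "0 < h" "h < 2/3" shows "\<exists>!z. 0 < z \<and> z < 1 \<and> poly (switch_energy m) z = h"
proof -
  have 0: "poly (switch_energy m) 0 = 0" "poly (switch_energy m) 1 = 2/3" using m by (simp_all add: poly_switch_energy power_0_left)
  obtain z where z: "0 \<le> z" "z \<le> 1" "poly (switch_energy m) z = h"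
    using IVT'[of "poly (switch_energy m)" 0 h 1] 0 assms continuous_on_poly[OF continuous_on_id, of "{0..1}" "switch_energy m"] by auto
  hence "z \<noteq> 0" "z \<noteq> 1" using 0 assms by auto
  show ?thesis
  proof (rule ex1I[of _ z])
    show "0 < z \<and> z < 1 \<and> poly (switch_energy m) z = h" using z \<open>z \<noteq> 0\<close> \<open>z \<noteq> 1\<close> by auto
    fix y assume "0 < y \<and> y < 1 \<and> poly (switch_energy m) y = h"
    thus "y = z" using switch_energy_strict_mono[of y z] switch_energy_strict_mono[of z y] z by (cases y z rule: linorder_cases) auto
  qed
qed

lemma switch_z: assumes "0 < h" "h < 2/3" shows "0 < switch_z h" "switch_z h < 1" "poly (switch_energy m) (switch_z h) = h"
  using theI'[OF switch_z_ex1[OF assms]] by (auto simp: switch_z_def)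

lemma switch_z_energies: "h \<in> energies \<Longrightarrow> 0 < switch_z h" "h \<in> energies \<Longrightarrow> switch_z h < 1" "h \<in> energies \<Longrightarrow> poly (switch_energy m) (switch_z h) = h"
  using switch_z[of h] by auto

lemma switch_z_switch_energy: "0 < z \<Longrightarrow> z < 1 \<Longrightarrow> switch_z (poly (switch_energy m) z) = z"
proof -
  assume z: "0 < z" "z < 1"
  have "0 < poly (switch_energy m) z" "poly (switch_energy m) z < 2/3"
    using switch_energy_strict_mono[of 0 z] switch_energy_strict_mono[of z 1] z m by (auto simp: poly_switch_energy power_0_left)
  thus ?thesis unfolding switch_z_def using z by (intro the1_equality[OF switch_z_ex1]) auto
qed

lemma switch_z_deriv:
  assumes "h \<in> energies" shows "(switch_z has_real_derivative inverse (poly (pderiv (switch_energy m)) (switch_z h))) (at h)"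
proof -
  note z = switch_z_energies[OF assms]
  have "(switch_z has_real_derivative inverse (poly (pderiv (switch_energy m)) (switch_z h))) (at (poly (switch_energy m) (switch_z h)))"
  proof (rule deriv_of_inverse[where D = "poly (pderiv (switch_energy m))" and T = "{0<..<2/3}", OF z(1,2) switch_z_switch_energy poly_DERIV])
    show "poly (pderiv (switch_energy m)) (switch_z h) \<noteq> 0" using pderiv_switch_energy_pos[OF m, of "switch_z h"] z by simp
  qed (use z assms switch_z(3) in auto)
  thus ?thesis using z by simp
qed

lemma smooth_switch_z: "smooth energies switch_z"
proof -
  have "diff_times k energies switch_z" for k
  proof (induction k)
    case (Suc k)
    have "diff_times k energies (\<lambda>h. inverse (poly (pderiv (switch_energy m)) (switch_z h)))"
    proof (intro diff_times_inverse diff_times_poly Suc)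
      show "poly (pderiv (switch_energy m)) (switch_z h) \<noteq> 0" if "h \<in> energies" for h
        using pderiv_switch_energy_pos[OF m, of "switch_z h"] switch_z_energies[OF that] by simp
    qed auto
    thus ?case by (rule diff_timesI[OF _ switch_z_deriv, rotated 2]) auto
  qed simp
  thus ?thesis by (simp add: smooth_def)
qed

lemma switch_y_pos: "h \<in> energies \<Longrightarrow> switch_y h > 0" and switch_y_square: "h \<in> energies \<Longrightarrow> (switch_y h)\<^sup>2 = switch_z h"
  using switch_z_energies(1)[of h] by (auto simp: switch_y_def)

lemma switch_y_deriv:
  assumes "h \<in> energies" shows "(switch_y has_real_derivative deriv switch_z h / (2 * switch_y h)) (at h)"
proof -
  have "(switch_y has_real_derivative inverse (sqrt (switch_z h)) / 2 * deriv switch_z h) (at h)"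
    unfolding switch_y_def[abs_def]
    by (rule DERIV_chain2[OF DERIV_real_sqrt[OF switch_z_energies(1)[OF assms]] smooth_has_deriv[OF smooth_switch_z assms]])
  thus ?thesis by (simp add: switch_y_def field_simps)
qed

lemma smooth_switch_y: "smooth energies switch_y"
proof -
  have "diff_times k energies switch_y" for k
  proof (induction k)
    case (Suc k)
    have "diff_times k energies (\<lambda>h. deriv switch_z h * inverse (2 * switch_y h))"
    proof (intro diff_times_mult diff_times_inverse diff_times_const Suc)
      show "diff_times k energies (deriv switch_z)" using smooth_deriv[OF smooth_switch_z] by (simp add: smooth_def)
      show "2 * switch_y h \<noteq> 0" if "h \<in> energies" for h using switch_y_pos[OF that] by simp
    qed auto
    thus ?case by (rule diff_timesI[OF _ switch_y_deriv[unfolded divide_inverse], rotated 2]) auto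
  qed simp
  thus ?thesis by (simp add: smooth_def)
qed

lemma poly_energy_euler_pos: "h \<in> energies \<Longrightarrow> poly (energy_euler m) (switch_z h) > 0"
  using switch_z_energies[of h] pderiv_switch_energy_pos[OF m, of "switch_z h"] by (simp add: energy_euler_def)

sublocale switching_curve m switch_z switch_y
proof
  fix h assume h: "h \<in> energies"
  have z: "deriv switch_z h = inverse (poly (pderiv (switch_energy m)) (switch_z h))" by (rule DERIV_imp_deriv[OF switch_z_deriv[OF h]])
  show dz: "deriv switch_z h = switch_z h / poly (energy_euler m) (switch_z h)"
    unfolding z using switch_z_energies[OF h] by (simp add: energy_euler_def field_simps)
  have "deriv switch_y h = deriv switch_z h / (2 * switch_y h)" by (rule DERIV_imp_deriv[OF switch_y_deriv[OF h]])
  also have "\<dots> = switch_y h / (2 * poly (energy_euler m) (switch_z h))"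
    unfolding dz switch_y_square[OF h, symmetric] using switch_y_pos[OF h] by (simp add: power2_eq_square)
  finally show "deriv switch_y h = switch_y h / (2 * poly (energy_euler m) (switch_z h))" .
qed (use m smooth_switch_z smooth_switch_y switch_z_energies switch_y_pos poly_energy_euler_pos in auto)

lemma switch_z_power: assumes "h \<in> energies" shows "0 < switch_z h ^ m" "switch_z h ^ m < 1"
  using switch_z_energies[OF assms] m by (auto simp: power_less_one_iff)

lemma quad_coord_switch_z: assumes "h \<in> energies" shows "2 * h - switch_z h = (quad_coord (switch_z h ^ m))\<^sup>2"
proof -
  have "(quad_coord (switch_z h ^ m))\<^sup>2 = switch_z h ^ (2 * m) - 2/3 * switch_z h ^ (3 * m)"
    using quad_coord_square[of "switch_z h ^ m"] switch_z_power[OF assms] by (simp add: power_mult[symmetric] mult.commute)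
  moreover have "h = switch_z h / 2 + switch_z h ^ (2 * m) / 2 - switch_z h ^ (3 * m) / 3"
    using switch_z_energies(3)[OF assms] by (simp add: poly_switch_energy)
  ultimately show ?thesis by linarith
qed

lemma switch_u_eq: assumes "h \<in> energies" shows "switch_u h = quad_coord (switch_z h ^ m)" "switch_u h > 0"
proof -
  have "quad_coord (switch_z h ^ m) > 0" using switch_z_power[OF assms] by (auto simp: quad_coord_def)
  thus "switch_u h = quad_coord (switch_z h ^ m)" "switch_u h > 0" unfolding switch_u_def quad_coord_switch_z[OF assms] by auto
qed

lemma switch_u_square: "h \<in> energies \<Longrightarrow> (switch_u h)\<^sup>2 + (switch_y h)\<^sup>2 = 2 * h"
  using quad_coord_switch_z[of h] switch_u_eq[of h] switch_y_square[of h] by simp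

lemma xi_switch_u: "h \<in> energies \<Longrightarrow> xi (switch_u h) = switch_z h ^ m"
  using switch_u_eq[of h] xi_quad_coord[of "switch_z h ^ m"] switch_z_power[of h] by simp

lemma switch_u_deriv:
  assumes "h \<in> energies" shows "(switch_u has_real_derivative (1 - switch_y h * deriv switch_y h) / switch_u h) (at h)"
proof -
  have "2 * h - switch_z h > 0" using switch_u_eq(2)[OF assms] by (simp add: switch_u_def)
  moreover have "((\<lambda>h. 2 * h - switch_z h) has_real_derivative (2 - deriv switch_z h)) (at h)"
    using smooth_has_deriv[OF smooth_switch_z assms] by (auto intro!: derivative_eq_intros)
  ultimately have "(switch_u has_real_derivative inverse (sqrt (2 * h - switch_z h)) / 2 * (2 - deriv switch_z h)) (at h)"
    unfolding switch_u_def[abs_def] by (intro DERIV_chain2[OF DERIV_real_sqrt])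
  moreover have "inverse (sqrt (2 * h - switch_z h)) / 2 * (2 - deriv switch_z h) = (1 - switch_y h * deriv switch_y h) / switch_u h"
  proof -
    have d: "switch_y h * deriv switch_y h = deriv switch_z h / 2"
      using DERIV_imp_deriv[OF switch_y_deriv[OF assms]] switch_y_pos[OF assms] by simp
    have "inverse s / 2 * (2 - t) = (1 - t / 2) / s" for s t :: real
      by (cases "s = 0") (simp_all add: field_simps)
    thus ?thesis unfolding d switch_u_def .
  qed
  ultimately show ?thesis by (rule back_subst)
qed

lemma switch_angle_bounds: assumes "h \<in> energies" shows "0 < switch_angle h" "switch_angle h < pi / 2"
  using switch_y_pos[OF assms] switch_u_eq(2)[OF assms] arctan_ubound by (auto simp: switch_angle_def)

lemma switch_angle_cos_sin:
  assumes "h \<in> energies" shows "rho h * cos (switch_angle h) = switch_u h" "rho h * sin (switch_angle h) = switch_y h"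
proof -
  note p = switch_u_eq(2)[OF assms] rho_pos[OF assms] switch_y_pos[OF assms]
  have "1 + (switch_y h / switch_u h)\<^sup>2 = (rho h / switch_u h)\<^sup>2"
    using p switch_u_square[OF assms] rho_square[OF assms] by (simp add: field_simps)
  hence "sqrt (1 + (switch_y h / switch_u h)\<^sup>2) = rho h / switch_u h" using p by simp
  thus "rho h * cos (switch_angle h) = switch_u h" "rho h * sin (switch_angle h) = switch_y h"
    using p by (simp_all add: switch_angle_def cos_arctan sin_arctan)
qed

lemma switching_point:
  assumes "h \<in> energies" shows "orbit_x h (switch_angle h) = switch_z h ^ m" "orbit_y h (switch_angle h) = - switch_y h"
  using switch_angle_cos_sin[OF assms] xi_switch_u[OF assms] by (simp_all add: orbit_x_def orbit_y_def)

text \<open>The combination of derivatives which appears when the integral with the moving end point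
  \<open>switch_angle\<close> is differentiated. It follows from \<open>u\<^sup>2 + y\<^sup>2 = 2 h\<close> at the switching point.\<close>

lemma switch_angle_deriv:
  assumes "h \<in> energies"
  obtains d where "(switch_angle has_real_derivative d) (at h)" "sin (switch_angle h) / rho h + switch_u h * d = deriv switch_y h"
proof
  note p = switch_u_eq(2)[OF assms] rho_pos[OF assms] switch_y_pos[OF assms]
  define a b b' r where "a = switch_u h" and "b = switch_y h" and "b' = deriv switch_y h" and "r = rho h"
  define a' where "a' = (1 - b * b') / a"
  have a: "a > 0" "r > 0" using p by (simp_all add: a_def r_def)
  have r2: "a\<^sup>2 + b\<^sup>2 = r\<^sup>2" using switch_u_square[OF assms] rho_square[OF assms] by (simp add: a_def b_def r_def)
  let ?d = "(b' * a - b * a') / r\<^sup>2"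
  have "((\<lambda>h. switch_y h / switch_u h) has_real_derivative (b' * a - b * a') / (a * a)) (at h)"
    using DERIV_divide[OF smooth_has_deriv[OF smooth_switch_y assms] switch_u_deriv[OF assms]] p
    by (simp add: a_def b_def b'_def a'_def)
  hence "(switch_angle has_real_derivative inverse (1 + (switch_y h / switch_u h)\<^sup>2) * ((b' * a - b * a') / (a * a))) (at h)"
    unfolding switch_angle_def[abs_def] by (rule DERIV_chain2[OF DERIV_arctan])
  moreover have "1 + (switch_y h / switch_u h)\<^sup>2 = r\<^sup>2 / (a * a)"
    using a r2 by (simp add: a_def b_def field_simps power2_eq_square)
  ultimately show "(switch_angle has_real_derivative ?d) (at h)" using a by simp
  have "sin (switch_angle h) = b / r" using switch_angle_cos_sin(2)[OF assms] a by (simp add: b_def r_def field_simps)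
  hence "sin (switch_angle h) / rho h + switch_u h * ?d = (b + a * (b' * a - b * a')) / r\<^sup>2"
    by (simp add: r_def a_def power2_eq_square add_divide_distrib)
  also have "b + a * (b' * a - b * a') = b + b' * a\<^sup>2 - b * (a * a')" by (simp add: power2_eq_square algebra_simps)
  also have "a * a' = 1 - b * b'" using a by (simp add: a'_def)
  also have "b + b' * a\<^sup>2 - b * (1 - b * b') = b' * (a\<^sup>2 + b\<^sup>2)" by (simp add: power2_eq_square algebra_simps)
  finally show "sin (switch_angle h) / rho h + switch_u h * ?d = deriv switch_y h" using a r2 by (simp add: b'_def)
qed

section \<open>The incomplete integrals\<close>

definition part :: "nat \<Rightarrow> nat \<Rightarrow> real \<Rightarrow> real" where "part i j h = arc i j h (switch_angle h)"

text \<open>The integral of \<open>x\<^sup>k y dx\<close> over the arc, closed up along the switching curve, which is the integral of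
  \<open>x\<^sup>k\<close> over the region between the arc and the switching curve. In its derivative the contributions of
  the moving end points cancel (\<open>incomplete_deriv\<close>).\<close>

definition incomplete :: "nat \<Rightarrow> real \<Rightarrow> real" where
  "incomplete k h = integral {0..switch_angle h} (angle_density k h)
      - 2 / (real (k + 1) * real (2 * (m * (k + 1)) + 1)) * (switch_y h * switch_z h ^ (m * (k + 1)))"

lemma part_energy: "h \<in> energies \<Longrightarrow> part i (j + 2) h = 2 * h * part i j h - part (i + 2) j h + 2/3 * part (i + 3) j h"
  unfolding part_def by (rule arc_energy)

lemma part_exact:
  assumes "h \<in> energies"
  shows "real i * part (i - 1) (2 * l + 2) h - real (2 * l + 1) * (part (i + 1) (2 * l) h - part (i + 2) (2 * l) h)
    = - 2 * (switch_y h * switch_z h ^ (m * i + l))"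
proof -
  have 1: "switch_y h ^ (2 * l + 1) = switch_y h * switch_z h ^ l" unfolding switch_y_square[OF assms, symmetric] by (simp add: power_mult)
  have 2: "(switch_z h ^ m) ^ i * switch_z h ^ l = switch_z h ^ (m * i + l)" by (simp add: power_mult power_add)
  have 3: "(- switch_y h) ^ (2 * l + 1) = - (switch_y h * switch_z h ^ l)" using 1 by simp
  have "2 * orbit_x h (switch_angle h) ^ i * orbit_y h (switch_angle h) ^ (2 * l + 1) = 2 * (switch_z h ^ m) ^ i * - (switch_y h * switch_z h ^ l)"
    unfolding switching_point[OF assms] 3 ..
  also have "\<dots> = - 2 * (switch_y h * ((switch_z h ^ m) ^ i * switch_z h ^ l))" by simp
  finally have "2 * orbit_x h (switch_angle h) ^ i * orbit_y h (switch_angle h) ^ (2 * l + 1) = - 2 * (switch_y h * switch_z h ^ (m * i + l))"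
    unfolding 2 .
  moreover have "switch_angle h \<ge> 0" using switch_angle_bounds[OF assms] by simp
  ultimately show ?thesis unfolding part_def arc_exact[OF assms \<open>switch_angle h \<ge> 0\<close>] by blast
qed

text \<open>The difference is the integral of \<open>x\<^sup>k y dx\<close> along the switching curve.\<close>

lemma part_incomplete:
  assumes "h \<in> energies"
  shows "part k 2 h = incomplete k h - 4 * real m / real (2 * (m * (k + 1)) + 1) * (switch_y h * switch_z h ^ (m * (k + 1)))"
proof -
  define N where "N = m * (k + 1)"
  have x: "xi_pow k (rho h * cos (switch_angle h)) = switch_z h ^ N / real (k + 1)"
    unfolding switch_angle_cos_sin[OF assms] xi_pow_def xi_switch_u[OF assms] N_def by (simp only: power_mult)
  have "part k 2 h = integral {0..switch_angle h} (angle_density k h) - 2 * (switch_z h ^ N / real (k + 1)) * switch_y h"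
    using arc_by_parts[OF assms, of "switch_angle h" k] switch_angle_bounds[OF assms] switching_point[OF assms]
    unfolding x by (simp add: part_def)
  also have "\<dots> = incomplete k h + (2 / (real (k + 1) * real (2 * N + 1)) - 2 / real (k + 1)) * (switch_y h * switch_z h ^ N)"
    unfolding incomplete_def N_def[symmetric] by (simp add: algebra_simps)
  also have "2 / (real (k + 1) * real (2 * N + 1)) - 2 / real (k + 1) = - (4 * real m / real (2 * N + 1))"
  proof -
    have "2 / (K * D) - 2 / K = - (2 * ((D - 1) / K) / D)" if "K > 0" "D > 0" for K D :: real
      using that by (simp add: field_simps)
    note aux = this
    have q: "(real (2 * N + 1) - 1) / real (k + 1) = 2 * real m" by (simp add: N_def field_simps)
    have "real (k + 1) > 0" "real (2 * N + 1) > 0" by simp_all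
    from aux[OF this] show ?thesis unfolding q by (simp only: mult_numeral_1_right mult.assoc[symmetric] numeral_times_numeral semiring_norm)
  qed
  finally show ?thesis by (simp add: N_def)
qed

lemma incomplete_deriv: assumes "h \<in> energies" shows "(incomplete k has_real_derivative part k 0 h) (at h)"
proof -
  define N where "N = m * (k + 1)"
  have N: "N \<ge> 1" using m by (simp add: N_def)
  obtain d where d: "(switch_angle has_real_derivative d) (at h)" "sin (switch_angle h) / rho h + switch_u h * d = deriv switch_y h"
    by (rule switch_angle_deriv[OF assms])
  have x: "xi_pow k (rho h * cos (switch_angle h)) = switch_z h ^ N / real (k + 1)"
    unfolding switch_angle_cos_sin[OF assms] xi_pow_def xi_switch_u[OF assms] N_def by (simp only: power_mult)
  have p: "angle_density k h (switch_angle h) = 2 * (switch_z h ^ N / real (k + 1)) * switch_u h"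
    unfolding angle_density_def x unfolding switch_angle_cos_sin[OF assms] ..
  have "((\<lambda>h. integral {0..switch_angle h} (angle_density k h)) has_real_derivative
      (part k 0 h + 2 * (switch_z h ^ N / real (k + 1)) * sin (switch_angle h) / rho h + 2 * (switch_z h ^ N / real (k + 1)) * switch_u h * d)) (at h)"
    using angle_density_integral_deriv[OF assms d(1) switch_angle_bounds(1)[OF assms], of k] unfolding x p part_def[symmetric] .
  also have "part k 0 h + 2 * (switch_z h ^ N / real (k + 1)) * sin (switch_angle h) / rho h + 2 * (switch_z h ^ N / real (k + 1)) * switch_u h * d
     = part k 0 h + 2 * (switch_z h ^ N / real (k + 1)) * (sin (switch_angle h) / rho h + switch_u h * d)"
    by (simp only: distrib_left add.assoc mult.assoc times_divide_eq_right)
  finally have 1: "((\<lambda>h. integral {0..switch_angle h} (angle_density k h)) has_real_derivative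
      (part k 0 h + 2 * (switch_z h ^ N / real (k + 1)) * deriv switch_y h)) (at h)" unfolding d(2) .
  have dz: "deriv switch_z h = 2 * switch_y h * deriv switch_y h"
    using DERIV_imp_deriv[OF switch_y_deriv[OF assms]] switch_y_pos[OF assms] by simp
  have "((\<lambda>h. switch_y h * switch_z h ^ N) has_real_derivative
      deriv switch_y h * switch_z h ^ N + (real N * (deriv switch_z h * switch_z h ^ (N - Suc 0))) * switch_y h) (at h)"
    by (rule DERIV_mult[OF smooth_has_deriv[OF smooth_switch_y assms] DERIV_power[OF smooth_has_deriv[OF smooth_switch_z assms]]])
  moreover have "deriv switch_y h * switch_z h ^ N + (real N * (deriv switch_z h * switch_z h ^ (N - Suc 0))) * switch_y h
      = real (2 * N + 1) * (switch_z h ^ N * deriv switch_y h)"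
  proof -
    have "real N * (deriv switch_z h * switch_z h ^ (N - Suc 0)) * switch_y h = real (2 * N) * (switch_z h * switch_z h ^ (N - Suc 0)) * deriv switch_y h"
      unfolding dz switch_y_square[OF assms, symmetric] by (simp add: power2_eq_square)
    moreover have "switch_z h * switch_z h ^ (N - Suc 0) = switch_z h ^ N" using N by (cases N) auto
    ultimately have a: "real N * (deriv switch_z h * switch_z h ^ (N - Suc 0)) * switch_y h = real (2 * N) * switch_z h ^ N * deriv switch_y h" by simp
    show ?thesis unfolding a by (simp add: algebra_simps)
  qed
  ultimately have "((\<lambda>h. switch_y h * switch_z h ^ N) has_real_derivative real (2 * N + 1) * (switch_z h ^ N * deriv switch_y h)) (at h)"
    by (rule back_subst)
  from DERIV_cmult[OF this, of "2 / (real (k + 1) * real (2 * N + 1))"]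
  have "((\<lambda>h. 2 / (real (k + 1) * real (2 * N + 1)) * (switch_y h * switch_z h ^ N)) has_real_derivative
      2 * (switch_z h ^ N / real (k + 1)) * deriv switch_y h) (at h)"
    by (simp add: mult.assoc del: of_nat_Suc of_nat_add of_nat_mult)
  from DERIV_diff[OF 1 this] show ?thesis by (simp add: incomplete_def[abs_def] N_def)
qed

text \<open>The boundary terms of the exact forms, together with those of \<open>part_incomplete\<close>, collected as
  \<open>v\<close> times a polynomial in \<open>z\<close>.\<close>

definition E0 :: "real poly" where "E0 = monom (4 - 5 * (4 * real m / real (2 * m + 1))) m - [:2:]"

definition E1 :: "real poly" where
  "E1 = monom (4 * real m / real (2 * m + 1) - 2) m + monom (4 - 7 * (4 * real m / real (4 * m + 1))) (2 * m) - [:2:]"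

definition e0 :: "real \<Rightarrow> real" where
  "e0 h = 1/6 * (poly [:-1, 6:] h * (switch_y h * poly E0 (switch_z h)) + switch_y h * poly E1 (switch_z h))"

definition e1 :: "real \<Rightarrow> real" where "e1 h = poly [:0, 1:] h * (switch_y h * poly E1 (switch_z h))"

lemma alg_e: "alg 0 (5 * m) e0" "alg 0 (5 * m) e1"
proof -
  have a0: "alg 0 m (\<lambda>h. switch_y h * poly E0 (switch_z h))" unfolding alg_def
    by (intro exI[of _ E0]) (auto simp: E0_def intro!: degree_diff_le degree_monom_le)
  have a1: "alg 0 (2 * m) (\<lambda>h. switch_y h * poly E1 (switch_z h))" unfolding alg_def
    by (intro exI[of _ E1]) (auto simp: E1_def intro!: degree_diff_le degree_add_le order_trans[OF degree_monom_le])
  show "alg 0 (5 * m) e0" unfolding e0_def[abs_def]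
    by (intro alg_cmult alg_add alg_mono[OF alg_poly_mult[OF a0, of _ 1]] alg_mono[OF a1]) auto
  show "alg 0 (5 * m) e1" unfolding e1_def[abs_def]
    by (rule alg_mono[OF alg_poly_mult[OF a1, of _ 1]]) auto
qed

lemma picard_fuchs_incomplete:
  assumes "h \<in> energies"
  shows "poly Delta h * part 0 0 h = (5 * h - 1) * incomplete 0 h + 7/6 * incomplete 1 h + e0 h"
    and "poly Delta h * part 1 0 h = - h * incomplete 0 h + 7 * h * incomplete 1 h + e1 h"
proof -
  define v z1 z2 c0 c1 where "v = switch_y h" and "z1 = switch_z h ^ m" and "z2 = switch_z h ^ (2 * m)"
    and "c0 = 4 * real m / real (2 * m + 1)" and "c1 = 4 * real m / real (4 * m + 1)"
  have 1: "part 2 0 h = part 1 0 h - 2 * v" using part_exact[OF assms, of 0 0] by (simp add: numeral_eq_Suc v_def)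
  have 2: "part 0 2 h = part 2 0 h - part 3 0 h - 2 * (v * z1)"
    using part_exact[OF assms, of 1 0] by (simp add: numeral_eq_Suc v_def z1_def)
  have 3: "2 * part 1 2 h = part 3 0 h - part 4 0 h - 2 * (v * z2)"
    using part_exact[OF assms, of 2 0] by (simp add: numeral_eq_Suc v_def z2_def mult.commute)
  have 4: "part 0 2 h = 2 * h * part 0 0 h - part 2 0 h + 2/3 * part 3 0 h"
    using part_energy[OF assms, of 0 0] by (simp add: numeral_eq_Suc)
  have 5: "part 1 2 h = 2 * h * part 1 0 h - part 3 0 h + 2/3 * part 4 0 h"
    using part_energy[OF assms, of 1 0] by (simp add: numeral_eq_Suc)
  have J0: "part 0 2 h = incomplete 0 h - c0 * (v * z1)"
    using part_incomplete[OF assms, of 0] by (simp add: c0_def v_def z1_def)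
  have "2 * (m * (1 + 1)) + 1 = 4 * m + 1" "m * (1 + 1) = 2 * m" by auto
  hence J1: "part 1 2 h = incomplete 1 h - c1 * (v * z2)"
    using part_incomplete[OF assms, of 1] by (simp only: c1_def v_def z2_def)
  have p0: "poly E0 (switch_z h) = (4 - 5 * c0) * z1 - 2" by (simp add: E0_def poly_monom c0_def z1_def)
  have p1: "poly E1 (switch_z h) = (c0 - 2) * z1 + (4 - 7 * c1) * z2 - 2"
    by (simp add: E1_def poly_monom c0_def c1_def z1_def z2_def)
  have 6: "(6 * h - 1) * part 1 0 h = 7 * incomplete 1 h - incomplete 0 h + v * poly E1 (switch_z h)"
    using 1 2 3 5 unfolding J0 J1 p1 by (simp add: algebra_simps)
  have 7: "6 * h * part 0 0 h = 5 * incomplete 0 h + part 1 0 h + v * poly E0 (switch_z h)"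
    using 1 2 4 unfolding J0 p0 by (simp add: algebra_simps)
  show "poly Delta h * part 1 0 h = - h * incomplete 0 h + 7 * h * incomplete 1 h + e1 h"
    using arg_cong[OF 6, of "\<lambda>x. h * x"] by (simp add: poly_Delta e1_def v_def algebra_simps)
  have "6 * (poly Delta h * part 0 0 h) = (6 * h - 1) * (6 * h * part 0 0 h)"
    by (simp add: poly_Delta algebra_simps)
  also have "\<dots> = (6 * h - 1) * (5 * incomplete 0 h) + (6 * h - 1) * part 1 0 h + (6 * h - 1) * (v * poly E0 (switch_z h))"
    unfolding 7 by (simp add: algebra_simps)
  also have "\<dots> = 6 * ((5 * h - 1) * incomplete 0 h + 7/6 * incomplete 1 h + e0 h)"
    unfolding 6 by (simp add: e0_def v_def algebra_simps)
  finally show "poly Delta h * part 0 0 h = (5 * h - 1) * incomplete 0 h + 7/6 * incomplete 1 h + e0 h" by simp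
qed

sublocale incomplete_picard_fuchs "full 0 2" "full 1 2" m switch_z switch_y "incomplete 0" "incomplete 1" e0 e1
proof
  show "smooth energies (incomplete 0)" "smooth energies (incomplete 1)"
    by (rule smooth_picard_fuchs[OF alg_smooth[OF alg_e(1)] alg_smooth[OF alg_e(2)] incomplete_deriv incomplete_deriv picard_fuchs_incomplete]; simp)+
  show "scaled_deriv (incomplete 0) h = (5 * h - 1) * incomplete 0 h + 7/6 * incomplete 1 h + e0 h"
    "scaled_deriv (incomplete 1) h = - h * incomplete 0 h + 7 * h * incomplete 1 h + e1 h" if "h \<in> energies" for h
    using DERIV_imp_deriv[OF incomplete_deriv[OF that]] picard_fuchs_incomplete[OF that] by (simp_all add: scaled_deriv_def)
qed (rule alg_e)+

end

section \<open>Reduction to two integrals\<close>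

lemma arc_odd': "odd j \<Longrightarrow> arc i j h c = 0"
  using arc_odd by (elim oddE) simp

text \<open>The relations between the integrals over the arc and those over the whole oval differ only in the
  boundary terms, which are multiples of \<open>V = v\<close> or of \<open>V = 0\<close>. The reduction is done for both at once.\<close>

locale arc_relations = exponent +
  fixes T :: "nat \<Rightarrow> nat \<Rightarrow> real \<Rightarrow> real" and V X0 X1 :: "real \<Rightarrow> real"
  assumes energy: "\<And>h i j. h \<in> energies \<Longrightarrow> T i (j + 2) h = 2 * h * T i j h - T (i + 2) j h + 2/3 * T (i + 3) j h"
    and exact: "\<And>h i l. h \<in> energies \<Longrightarrow> real i * T (i - 1) (2 * l + 2) h - real (2 * l + 1) * (T (i + 1) (2 * l) h - T (i + 2) (2 * l) h)
      = - 2 * (V h * switch_z h ^ (m * i + l))"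
    and odd: "\<And>h i j. odd j \<Longrightarrow> T i j h = 0"
    and base: "\<exists>c. \<forall>h\<in>energies. T 0 2 h = X0 h + c * (V h * switch_z h ^ m)"
      "\<exists>c. \<forall>h\<in>energies. T 1 2 h = X1 h + c * (V h * switch_z h ^ (2 * m))"
begin

text \<open>Combinations of the two basic integrals with polynomial coefficients of degree at most \<open>d\<close> in the
  energy, up to an algebraic function.\<close>

definition reducible :: "nat \<Rightarrow> nat \<Rightarrow> (real \<Rightarrow> real) \<Rightarrow> bool" where
  "reducible d \<rho> F \<longleftrightarrow> (\<exists>r N. deg_le d r \<and> degree N \<le> \<rho> \<and>
      (\<forall>h\<in>energies. F h = combine r X0 X1 h + V h * poly N (switch_z h)))"

lemma reducible_cong: "reducible d \<rho> F \<Longrightarrow> (\<And>h. h \<in> energies \<Longrightarrow> G h = F h) \<Longrightarrow> reducible d \<rho> G"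
  unfolding reducible_def by metis

lemma reducible_mono: "reducible d \<rho> F \<Longrightarrow> d \<le> d' \<Longrightarrow> \<rho> \<le> \<rho>' \<Longrightarrow> reducible d' \<rho>' F"
  unfolding reducible_def deg_le_def by (meson order_trans)

lemma reducible_add:
  assumes "reducible d \<rho> F" "reducible d \<rho> G" shows "reducible d \<rho> (\<lambda>h. F h + G h)"
proof -
  obtain r N s M where *: "deg_le d r" "degree N \<le> \<rho>" "\<And>h. h \<in> energies \<Longrightarrow> F h = combine r X0 X1 h + V h * poly N (switch_z h)"
     "deg_le d s" "degree M \<le> \<rho>" "\<And>h. h \<in> energies \<Longrightarrow> G h = combine s X0 X1 h + V h * poly M (switch_z h)"
    using assms unfolding reducible_def by metis
  let ?t = "(fst r + fst s, snd r + snd s)"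
  have "deg_le d ?t" using * by (auto simp: deg_le_def intro: degree_add_le)
  moreover have "degree (N + M) \<le> \<rho>" using * by (auto intro: degree_add_le)
  moreover have "F h + G h = combine ?t X0 X1 h + V h * poly (N + M) (switch_z h)" if "h \<in> energies" for h
    using *(3,6)[OF that] by (simp add: combine_def algebra_simps)
  ultimately show ?thesis unfolding reducible_def by blast
qed

lemma reducible_poly_mult:
  assumes "reducible d \<rho> F" "degree p \<le> c" shows "reducible (d + c) (\<rho> + 3 * m * c) (\<lambda>h. poly p h * F h)"
proof -
  obtain r N where *: "deg_le d r" "degree N \<le> \<rho>" "\<And>h. h \<in> energies \<Longrightarrow> F h = combine r X0 X1 h + V h * poly N (switch_z h)"
    using assms(1) unfolding reducible_def by metis
  let ?t = "(fst r * p, snd r * p)"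
  have "deg_le (d + c) ?t" using *(1) assms(2) by (auto simp: deg_le_def intro!: degree_mult_le_add)
  moreover have "degree (N * (p \<circ>\<^sub>p switch_energy m)) \<le> \<rho> + 3 * m * c"
  proof (rule degree_mult_le_add[OF *(2)])
    show "degree (p \<circ>\<^sub>p switch_energy m) \<le> 3 * m * c"
      using degree_pcompose_le[of p "switch_energy m"] mult_mono[OF assms(2) degree_switch_energy[OF m]] by (simp add: mult.commute)
  qed
  moreover have "poly p h * F h = combine ?t X0 X1 h + V h * poly (N * (p \<circ>\<^sub>p switch_energy m)) (switch_z h)" if "h \<in> energies" for h
    using *(3)[OF that] switch_z_energies(3)[OF that] by (simp add: combine_def poly_pcompose algebra_simps)
  ultimately show ?thesis unfolding reducible_def by blast
qed

lemma reducible_cmult: "reducible d \<rho> F \<Longrightarrow> reducible d \<rho> (\<lambda>h. c * F h)"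
  using reducible_poly_mult[of d \<rho> F "[:c:]" 0] by simp

lemma reducible_h_mult: "reducible d \<rho> F \<Longrightarrow> reducible (d + 1) (\<rho> + 3 * m) (\<lambda>h. h * F h)"
  using reducible_poly_mult[of d \<rho> F "[:0, 1:]" 1] by simp

lemma reducible_power: "k \<le> \<rho> \<Longrightarrow> reducible d \<rho> (\<lambda>h. V h * switch_z h ^ k)"
  unfolding reducible_def
  by (intro exI[of _ "(0, 0)"] exI[of _ "monom 1 k"])
     (auto simp: deg_le_def combine_def poly_monom intro: order_trans[OF degree_monom_le])

lemma reducible_zero: "reducible d \<rho> (\<lambda>_. 0)"
  using reducible_cmult[OF reducible_power[of 0], of \<rho> d 0] by simp

lemma reducible_sum: "(\<And>x. x \<in> A \<Longrightarrow> reducible d \<rho> (F x)) \<Longrightarrow> reducible d \<rho> (\<lambda>h. \<Sum>x\<in>A. F x h)"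
  by (induction A rule: infinite_finite_induct) (auto intro: reducible_zero reducible_add)

lemma reducible_base: "reducible 0 m (T 0 2)" "reducible 0 (2 * m) (T 1 2)"
proof -
  obtain c0 c1 where c: "\<And>h. h \<in> energies \<Longrightarrow> T 0 2 h = X0 h + c0 * (V h * switch_z h ^ m)"
    "\<And>h. h \<in> energies \<Longrightarrow> T 1 2 h = X1 h + c1 * (V h * switch_z h ^ (2 * m))" using base by blast
  have x: "reducible 0 \<rho> X0" "reducible 0 \<rho> X1" for \<rho>
    unfolding reducible_def
    by (rule exI[of _ "(1, 0)"], rule exI[of _ 0], simp add: deg_le_def combine_def)
       (rule exI[of _ "(0, 1)"], rule exI[of _ 0], simp add: deg_le_def combine_def)
  show "reducible 0 m (T 0 2)"
    by (rule reducible_cong[OF reducible_add[OF x(1) reducible_cmult[OF reducible_power]] c(1)]) auto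
  show "reducible 0 (2 * m) (T 1 2)"
    by (rule reducible_cong[OF reducible_add[OF x(2) reducible_cmult[OF reducible_power]] c(2)]) auto
qed

text \<open>The exact form \<open>d (x ^ i y\<^sup>3)\<close>, in which the energy relation removes \<open>y ^ 4\<close>, expresses the integral
  with \<open>x ^ (i + 2)\<close> by those with \<open>x ^ (i + 1)\<close> and \<open>h x ^ (i - 1)\<close>. Three powers of \<open>x\<close> cost one power
  of \<open>h\<close>, as \<open>h\<close> has the weight of \<open>x\<^sup>3\<close>.\<close>

lemma reducible_2: "reducible (k div 3) (m * (k + 1)) (T k 2)"
proof (induction k rule: less_induct)
  case (less k)
  consider "k = 0" | "k = 1" | i where "k = i + 2" by (metis One_nat_def add_2_eq_Suc' not0_implies_Suc)
  thus ?case
  proof cases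
    case 1 thus ?thesis using reducible_base(1) by simp
  next
    case 2
    have "m * (k + 1) = 2 * m" "k div 3 = 0" using 2 by auto
    thus ?thesis using reducible_base(2) 2 by (simp only:)
  next
    case (3 i)
    have rec: "T (i + 2) 2 h = (real i + 3) / (2/3 * real i + 3) * T (i + 1) 2 h
        + ((- 2 * real i / (2/3 * real i + 3)) * (h * T (i - 1) 2 h)
        + (- 2 / (2/3 * real i + 3)) * (V h * switch_z h ^ (m * i + 1)))" if h: "h \<in> energies" for h
    proof -
      have 1: "real i * T (i - 1) 4 h - 3 * (T (i + 1) 2 h - T (i + 2) 2 h) = - 2 * (V h * switch_z h ^ (m * i + 1))"
        using exact[OF h, of i 1] by (simp add: numeral_eq_Suc)
      have 2: "real i * T (i - 1) 4 h = real i * (2 * h * T (i - 1) 2 h - T (i + 1) 2 h + 2/3 * T (i + 2) 2 h)"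
        using energy[OF h, of "i - 1" 2] by (cases i) (simp_all add: numeral_eq_Suc)
      have "(2/3 * real i + 3) * T (i + 2) 2 h = (real i + 3) * T (i + 1) 2 h
         + (- 2 * real i * (h * T (i - 1) 2 h) + - 2 * (V h * switch_z h ^ (m * i + 1)))"
        using 1 unfolding 2 by (simp add: algebra_simps)
      moreover have "t = a / D * x + (b / D * y + c / D * w)" if "D * t = a * x + (b * y + c * w)" "D > 0"
        for t a b c x y w D :: real
        using that by (simp add: field_simps)
      moreover have "2/3 * real i + 3 > 0" by (simp add: add_nonneg_pos)
      ultimately show ?thesis by blast
    qed
    have "reducible ((i + 2) div 3) (m * (i + 2 + 1)) (\<lambda>h. (real i + 3) / (2/3 * real i + 3) * T (i + 1) 2 h)"
      using 3 by (intro reducible_cmult reducible_mono[OF less[of "i + 1"]]) auto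
    moreover have "reducible ((i + 2) div 3) (m * (i + 2 + 1)) (\<lambda>h. (- 2 * real i / (2/3 * real i + 3)) * (h * T (i - 1) 2 h))"
    proof (cases i)
      case 0 thus ?thesis using reducible_zero by simp
    next
      case (Suc i')
      show ?thesis
        by (intro reducible_cmult reducible_mono[OF reducible_h_mult[OF less[of "i - 1"]]])
           (use 3 Suc in \<open>auto simp: algebra_simps\<close>)
    qed
    moreover have "reducible ((i + 2) div 3) (m * (i + 2 + 1)) (\<lambda>h. (- 2 / (2/3 * real i + 3)) * (V h * switch_z h ^ (m * i + 1)))"
      by (intro reducible_cmult reducible_power) (use m in \<open>auto simp: algebra_simps\<close>)
    ultimately show ?thesis unfolding 3
      by (intro reducible_cong[OF _ rec] reducible_add)
  qed
qed

lemma reducible_even: "reducible (l + i div 3) (m * (i + 3 * l + 1)) (T i (2 * l + 2))"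
proof (induction l arbitrary: i)
  case 0
  have "0 + i div 3 = i div 3" "i + 3 * 0 + 1 = i + 1" "2 * 0 + 2 = (2::nat)" by auto
  thus ?case using reducible_2[of i] by (simp only:)
next
  case (Suc l)
  have rec: "T i (2 * Suc l + 2) h = 2 * (h * T i (2 * l + 2) h) + ((- 1) * T (i + 2) (2 * l + 2) h + 2/3 * T (i + 3) (2 * l + 2) h)"
    if "h \<in> energies" for h using energy[OF that, of i "2 * l + 2"] by simp
  show ?case
    by (rule reducible_cong[OF _ rec], intro reducible_add reducible_cmult
         reducible_mono[OF reducible_h_mult[OF Suc.IH[of i]]] reducible_mono[OF Suc.IH[of "i + 2"]] reducible_mono[OF Suc.IH[of "i + 3"]])
       (auto simp: algebra_simps)
qed

text \<open>The integral of \<open>q dx - p dy\<close> over the arc, as \<open>dx = y dt\<close> and \<open>dy = (x\<^sup>2 - x) dt\<close>; here \<open>a\<close> and \<open>b\<close>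
  are the coefficients of \<open>p\<close> and \<open>q\<close>.\<close>

definition arc_melnikov :: "nat \<Rightarrow> (nat \<Rightarrow> nat \<Rightarrow> real) \<Rightarrow> (nat \<Rightarrow> nat \<Rightarrow> real) \<Rightarrow> real \<Rightarrow> real" where
  "arc_melnikov n a b h = (\<Sum>(i, j) \<in> {(i, j). i + j \<le> n}.
      b i j * T i (j + 1) h + a i j * (T (i + 1) j h - T (i + 2) j h))"

text \<open>By symmetry only the odd powers of \<open>y\<close> contribute to \<open>q dx\<close> and the even ones to \<open>p dy\<close>; the latter
  become integrals of the former type by an exact form. So the integrals of \<open>x ^ i y ^ (2 l + 2) dt\<close> with
  \<open>i + 2 l + 1 \<le> n\<close> are left, for which \<open>l + i div 3 \<le> (n - 1) div 2\<close>.\<close>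

theorem reducible_arc_melnikov:
  assumes n: "n \<ge> 1" and d: "d = (n - 1) div 2"
  shows "reducible d ((3 * d + 2) * m) (arc_melnikov n a b)"
proof -
  have nd: "n \<le> 2 * d + 2" "2 * d + 1 \<le> n" using n d by auto
  have even: "reducible d ((3 * d + 2) * m) (T i (2 * l + 2))" if il: "i + 2 * l + 1 \<le> n" for i l
  proof (rule reducible_mono[OF reducible_even])
    show "l + i div 3 \<le> d" using il nd by linarith
    have "i + 3 * l + 1 \<le> 3 * d + 2" using il nd by linarith
    hence "m * (i + 3 * l + 1) \<le> m * (3 * d + 2)" by (rule mult_le_mono2)
    thus "m * (i + 3 * l + 1) \<le> (3 * d + 2) * m" by (simp only: mult.commute)
  qed
  have B: "reducible d ((3 * d + 2) * m) (T i (j + 1))" if ij: "i + j \<le> n" for i j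
  proof (cases "even j")
    case True
    thus ?thesis using reducible_zero by (intro reducible_cong[OF reducible_zero]) (auto simp: odd)
  next
    case False
    then obtain l where "j = 2 * l + 1" by (elim oddE)
    thus ?thesis using even[of i l] ij by simp
  qed
  have A: "reducible d ((3 * d + 2) * m) (\<lambda>h. T (i + 1) j h - T (i + 2) j h)" if ij: "i + j \<le> n" for i j
  proof (cases "even j")
    case False
    thus ?thesis by (intro reducible_cong[OF reducible_zero]) (auto simp: odd)
  next
    case True
    then obtain l where l: "j = 2 * l" by (elim evenE)
    have rec: "T (i + 1) j h - T (i + 2) j h = (real i / real (2 * l + 1)) * T (i - 1) (2 * l + 2) h
        + (2 / real (2 * l + 1)) * (V h * switch_z h ^ (m * i + l))" if "h \<in> energies" for h
    proof -
      have "x = (a / D) * t + (2 / D) * w" if "a * t - D * x = - 2 * w" "D > 0" for x a t w D :: real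
        using that by (simp add: field_simps)
      from this[OF exact[OF that, of i l]] show ?thesis unfolding l by simp
    qed
    have 1: "reducible d ((3 * d + 2) * m) (\<lambda>h. (real i / real (2 * l + 1)) * T (i - 1) (2 * l + 2) h)"
    proof (cases i)
      case 0 thus ?thesis using reducible_zero by simp
    next
      case (Suc i')
      thus ?thesis using ij l by (intro reducible_cmult even) auto
    qed
    have "m * i + l \<le> m * (i + l)" using m by (simp add: algebra_simps)
    also have "\<dots> \<le> m * (3 * d + 2)" using ij l nd by (intro mult_left_mono) auto
    finally have "m * i + l \<le> (3 * d + 2) * m" by (simp add: mult.commute)
    hence 2: "reducible d ((3 * d + 2) * m) (\<lambda>h. (2 / real (2 * l + 1)) * (V h * switch_z h ^ (m * i + l)))"
      by (intro reducible_cmult reducible_power)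
    show ?thesis by (rule reducible_cong[OF reducible_add[OF 1 2] rec])
  qed
  have "reducible d ((3 * d + 2) * m) (\<lambda>h. \<Sum>x \<in> {(i, j). i + j \<le> n}.
      (case x of (i, j) \<Rightarrow> (\<lambda>h. b i j * T i (j + 1) h + a i j * (T (i + 1) j h - T (i + 2) j h))) h)"
  proof (rule reducible_sum)
    fix x assume x: "x \<in> {(i, j). i + j \<le> n}"
    obtain i j where ij: "x = (i, j)" by (cases x)
    have "i + j \<le> n" using x ij by simp
    thus "reducible d ((3 * d + 2) * m)
       (case x of (i, j) \<Rightarrow> (\<lambda>h. b i j * T i (j + 1) h + a i j * (T (i + 1) j h - T (i + 2) j h)))"
      unfolding ij case_prod_conv by (intro reducible_add reducible_cmult A B)
  qed
  thus ?thesis by (rule reducible_cong) (simp add: arc_melnikov_def case_prod_unfold)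
qed

end

context exponent
begin

sublocale part: arc_relations m part switch_y "incomplete 0" "incomplete 1"
proof
  show "\<exists>c. \<forall>h\<in>energies. part 0 2 h = incomplete 0 h + c * (switch_y h * switch_z h ^ m)"
    using part_incomplete[of _ 0] by (intro exI[of _ "- (4 * real m / real (2 * m + 1))"]) simp
  show "\<exists>c. \<forall>h\<in>energies. part 1 2 h = incomplete 1 h + c * (switch_y h * switch_z h ^ (2 * m))"
  proof (intro exI[of _ "- (4 * real m / real (4 * m + 1))"] ballI)
    fix h assume h: "h \<in> energies"
    have e: "2 * (m * (1 + 1)) + 1 = 4 * m + 1" "m * (1 + 1) = 2 * m" "2 * (2 * m) + 1 = 4 * m + 1" by auto
    show "part 1 2 h = incomplete 1 h + - (4 * real m / real (4 * m + 1)) * (switch_y h * switch_z h ^ (2 * m))"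
      using part_incomplete[OF h, of 1] unfolding e by linarith
  qed
qed (use part_energy part_exact in \<open>auto simp: part_def arc_odd'\<close>)

sublocale full: arc_relations m full "\<lambda>_. 0" "full 0 2" "full 1 2"
  by unfold_locales (use full_energy full_exact in \<open>auto simp: full_def arc_odd'\<close>)

theorem zeros_le_arc_melnikov:
  assumes n: "n \<ge> 1" and d: "d = (n - 1) div 2"
    and M: "\<And>h. h \<in> energies \<Longrightarrow> M h = full.arc_melnikov n am bm h + (part.arc_melnikov n ap bp h - part.arc_melnikov n am bm h)"
    and nz: "\<exists>h\<in>energies. M h \<noteq> 0"
  shows "zeros_le energies M (27 * m * d + 62 * m + 32 * d + 38)"
proof -
  obtain r where r: "deg_le d r" "\<And>h. h \<in> energies \<Longrightarrow> full.arc_melnikov n am bm h = combine r (full 0 2) (full 1 2) h"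
    using full.reducible_arc_melnikov[OF n d, of am bm] unfolding full.reducible_def by auto
  have "part.reducible d ((3 * d + 2) * m) (\<lambda>h. part.arc_melnikov n ap bp h + (- 1) * part.arc_melnikov n am bm h)"
    by (intro part.reducible_add part.reducible_cmult part.reducible_arc_melnikov n d)
  then obtain s N where s: "deg_le d s" "degree N \<le> (3 * d + 2) * m"
    "\<And>h. h \<in> energies \<Longrightarrow> part.arc_melnikov n ap bp h + (- 1) * part.arc_melnikov n am bm h = combine s (incomplete 0) (incomplete 1) h + switch_y h * poly N (switch_z h)"
    unfolding part.reducible_def by blast
  have A: "alg 0 ((3 * d + 2) * m) (\<lambda>h. switch_y h * poly N (switch_z h))"
    unfolding alg_def using s(2) by (intro exI[of _ N]) auto
  show ?thesis
    by (rule zeros_le_melnikov_form[OF r(1) s(1) A _ nz]) (use M r(2) s(3) in simp)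
qed

end

section \<open>The closed orbits\<close>

definition orbit_curve :: "real \<Rightarrow> real \<Rightarrow> real \<times> real" where "orbit_curve h p = (orbit_x h p, orbit_y h p)"

definition oval :: "real \<Rightarrow> (real \<times> real) set" where
  "oval h = {w. bt_hamiltonian w = h \<and> fst w < 1}"

lemma orbit_x_bounds: "h \<in> energies \<Longrightarrow> - 1/2 < orbit_x h p" "h \<in> energies \<Longrightarrow> orbit_x h p < 1"
  unfolding orbit_x_def using xi[OF rho_cos_disc] by auto

lemma orbit_curve_in_oval: "h \<in> energies \<Longrightarrow> orbit_curve h p \<in> oval h"
  using orbit_energy[of h p] orbit_x_bounds[of h p] by (simp add: orbit_curve_def oval_def bt_hamiltonian_def field_simps)

text \<open>The polynomial \<open>1/6 - x\<^sup>2/2 + x\<^sup>3/3 = (x - 1)\<^sup>2 (2 x + 1) / 6\<close> is positive at points of energy below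
  \<open>1/6\<close>.\<close>

lemma oval_x_bounds:
  assumes "h < 1/6" "bt_hamiltonian (x, y) \<le> h" "x < 1" shows "- 1/2 < x"
proof -
  have "(x - 1)\<^sup>2 * (2 * x + 1) = 6 * (1/6 - (x\<^sup>2 / 2 - x ^ 3 / 3))"
    by (simp add: power2_eq_square power3_eq_cube algebra_simps)
  also have "x\<^sup>2 / 2 - x ^ 3 / 3 \<le> h"
    using assms(2) zero_le_power2[of y] unfolding bt_hamiltonian_def case_prod_conv by linarith
  hence "6 * (1/6 - (x\<^sup>2 / 2 - x ^ 3 / 3)) > 0" using assms(1) by simp
  finally have "2 * x + 1 > 0" by (simp add: zero_less_mult_iff)
  thus ?thesis by simp
qed

lemma oval_param:
  assumes h: "h \<in> energies" and w: "w \<in> oval h"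
  obtains p where "- pi \<le> p" "p \<le> pi" "orbit_curve h p = w"
proof -
  obtain x y where xy: "w = (x, y)" by (cases w)
  have x: "bt_hamiltonian (x, y) = h" "x < 1" using w xy by (auto simp: oval_def)
  have x2: "- 1/2 < x" by (rule oval_x_bounds[of h x y]) (use h x in auto)
  have r: "rho h > 0" by (rule rho_pos[OF h])
  have "(quad_coord x)\<^sup>2 + y\<^sup>2 = (rho h)\<^sup>2" using x quad_coord_square[of x] by (simp add: rho_square[OF h] bt_hamiltonian_def)
  hence "(quad_coord x / rho h)\<^sup>2 + (- y / rho h)\<^sup>2 = 1" using r by (simp add: field_simps)
  then obtain t where t: "0 \<le> t" "t < 2 * pi" "quad_coord x / rho h = cos t" "- y / rho h = sin t"
    by (rule sincos_total_2pi)
  have *: "orbit_curve h q = w" if "cos q = cos t" "sin q = sin t" for q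
  proof -
    have "rho h * cos q = quad_coord x" "rho h * sin q = - y"
      using t(3,4) r unfolding that by (simp_all add: field_simps)
    thus ?thesis using xi_quad_coord[OF x2 x(2)] by (simp add: orbit_curve_def orbit_x_def orbit_y_def xy)
  qed
  show thesis
  proof (cases "t \<le> pi")
    case True thus thesis using that[of t] t * by auto
  next
    case False
    have "cos (t - 2 * pi) = cos t" "sin (t - 2 * pi) = sin t" by (simp_all add: cos_diff sin_diff)
    thus thesis using that[of "t - 2 * pi"] t * False by auto
  qed
qed

lemma orbit_curve_inj:
  assumes h: "h \<in> energies" and "orbit_curve h p = orbit_curve h q"
  obtains k :: int where "p = q + 2 * pi * k"
proof -
  have "orbit_x h p = orbit_x h q" "orbit_y h p = orbit_y h q" using assms by (auto simp: orbit_curve_def)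
  hence "rho h * cos p = rho h * cos q" "rho h * sin p = rho h * sin q"
    using xi(3)[OF rho_cos_disc[OF h, of p]] xi(3)[OF rho_cos_disc[OF h, of q]] by (auto simp: orbit_x_def orbit_y_def)
  hence "cos p = cos q" "sin p = sin q" using rho_pos[OF h] by auto
  thus thesis using that sin_cos_eq_iff[of p q] by auto
qed

lemma continuous_hamiltonian: "continuous_on A bt_hamiltonian"
  unfolding bt_hamiltonian_def case_prod_unfold by (intro continuous_intros) simp_all

text \<open>The points of smaller energy to the left of the saddle form a bounded open set which contains the
  origin, and a connected set that avoids the oval cannot leave it.\<close>

lemma oval_inside: assumes h: "h \<in> energies" shows "(0, 0) \<in> inside (oval h)"
proof -
  define U V where "U = {w. bt_hamiltonian w < h} \<inter> {w. fst w < (1::real)}"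
    and "V = {w. h < bt_hamiltonian w} \<union> {w. (1::real) < fst w}"
  have o: "open U" "open V"
    unfolding U_def V_def
    by (intro open_Int open_Un open_Collect_less continuous_hamiltonian continuous_intros)+
  have at1: "bt_hamiltonian w > h" if "fst w = 1" for w
  proof -
    have "bt_hamiltonian w = 1/6 + (snd w)\<^sup>2 / 2" using that by (cases w) (simp add: bt_hamiltonian_def)
    moreover have "(snd w)\<^sup>2 / 2 \<ge> 0" by simp
    ultimately show ?thesis using h unfolding greaterThanLessThan_iff by linarith
  qed
  define C where "C = connected_component_set (- oval h) (0, 0)"
  have C: "connected C" "C \<subseteq> - oval h" unfolding C_def by (auto simp: connected_component_subset)
  have z: "(0, 0) \<in> - oval h" using h by (auto simp: oval_def bt_hamiltonian_def)
  hence "(0, 0) \<in> C" unfolding C_def by simp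
  moreover have "(0, 0) \<in> U" using h by (auto simp: U_def bt_hamiltonian_def)
  moreover have "- oval h \<subseteq> U \<union> V"
  proof
    fix w assume "w \<in> - oval h"
    thus "w \<in> U \<union> V" using at1[of w] by (auto simp: oval_def U_def V_def not_less le_less)
  qed
  moreover have "U \<inter> V = {}" by (auto simp: U_def V_def)
  ultimately have "C \<subseteq> U"
    using connectedD[OF C(1) o] C(2) by blast
  moreover have "bounded U"
  proof (rule bounded_subset)
    show "U \<subseteq> {-1/2..1} \<times> {-1..1}"
    proof
      fix w assume w: "w \<in> U"
      obtain x y where xy: "w = (x, y)" by (cases w)
      have x: "bt_hamiltonian (x, y) < h" "x < 1" using w xy by (auto simp: U_def)
      have x2: "- 1/2 < x" by (rule oval_x_bounds[of h x y]) (use h x in auto)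
      have "0 \<le> x\<^sup>2 * (3 - 2 * x)" using x by (intro mult_nonneg_nonneg) auto
      hence "x\<^sup>2 / 2 - x ^ 3 / 3 \<ge> 0" by (simp add: power2_eq_square power3_eq_cube algebra_simps)
      hence "y\<^sup>2 \<le> 1\<^sup>2" using x h by (simp add: bt_hamiltonian_def)
      hence "\<bar>y\<bar> \<le> 1" using abs_le_square_iff[of y 1] by simp
      thus "w \<in> {-1/2..1} \<times> {-1..1}" using xy x x2 by auto
    qed
  qed (intro bounded_Times; simp)
  ultimately have "bounded C" by (rule bounded_subset[rotated])
  thus ?thesis using z unfolding inside_def C_def by auto
qed

text \<open>An orbit of energy \<open>h\<close> that is not on the oval lies in the half plane \<open>x > 1\<close>, and then the origin
  belongs to an unbounded component of its complement.\<close>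

lemma level_component:
  fixes g :: "real \<Rightarrow> real \<times> real"
  assumes h: "h \<in> energies" and g: "continuous_on UNIV g" "range g \<subseteq> {w. bt_hamiltonian w = h}" "(0, 0) \<in> inside (range g)"
  shows "range g \<subseteq> oval h"
proof (rule ccontr)
  assume "\<not> range g \<subseteq> oval h"
  then obtain t where t: "\<not> fst (g t) < 1" using g(2) unfolding oval_def by blast
  have ne1: "fst (g s) \<noteq> 1" for s
  proof
    assume "fst (g s) = 1"
    moreover have "bt_hamiltonian (g s) = h" using g(2) by auto
    ultimately show False using h zero_le_power2[of "snd (g s)"] by (simp add: bt_hamiltonian_def case_prod_unfold)
  qed
  have "connected (fst ` range g)"
    by (intro connected_continuous_image connected_UNIV g continuous_intros)
  have gt: "fst (g s) > 1" for s
  proof (rule ccontr)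
    assume "\<not> 1 < fst (g s)"
    hence "1 \<in> fst ` range g"
      using connectedD_interval[OF \<open>connected (fst ` range g)\<close>, of "fst (g s)" "fst (g t)" 1] t by auto
    thus False using ne1 by force
  qed
  \<comment> \<open>A half plane that contains the origin and avoids the orbit.\<close>
  let ?H = "{..1::real} \<times> (UNIV :: real set)"
  have "convex ?H" by (intro convex_Times convex_real_interval convex_UNIV)
  moreover have "?H \<subseteq> - range g" using gt by (auto simp: not_le[symmetric]) (metis fst_conv gt not_le)
  ultimately have "?H \<subseteq> connected_component_set (- range g) (0, 0)"
    by (intro connected_component_maximal convex_connected) auto
  moreover have "bounded (connected_component_set (- range g) (0, 0))" using g(3) by (simp add: inside_def)
  ultimately have "bounded ?H" by (rule bounded_subset[rotated])
  hence "bounded (snd ` ?H)" by (rule bounded_snd)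
  moreover have "snd ` ?H = UNIV" by force
  ultimately show False using not_bounded_UNIV by simp
qed

text \<open>Every turn takes the same time, so the time is an increasing bijection of the real line. The
  solution of the system is obtained from its inverse, the angle as a function of the time.\<close>

lemma orbit_time:
  assumes h: "h \<in> energies"
  obtains \<tau> \<Theta> :: "real \<Rightarrow> real" where
    "\<And>p. (\<tau> has_real_derivative orbit_w h p) (at p)" "strict_mono \<tau>"
    "\<And>p. \<Theta> (\<tau> p) = p" "\<And>t. \<tau> (\<Theta> t) = t"
    "\<And>p (k::int). \<tau> (p + 2 * pi * k) = \<tau> p + k * (\<tau> (2 * pi) - \<tau> 0)"
    "\<And>t. (\<Theta> has_real_derivative inverse (orbit_w h (\<Theta> t))) (at t)"
proof -
  have "isCont (orbit_w h) p" for p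
    using continuous_orbit(3)[OF h, of UNIV] by (simp add: continuous_on_eq_continuous_at)
  then obtain \<tau> where "\<And>p. (\<tau> has_vector_derivative orbit_w h p) (at p)"
    using einterval_antiderivative[of "-\<infinity>" \<infinity> "orbit_w h"] by auto
  hence d: "(\<tau> has_real_derivative orbit_w h p) (at p)" for p
    by (simp add: has_real_derivative_iff_has_vector_derivative)
  have mono: "strict_mono \<tau>"
    by (rule strict_monoI, rule DERIV_pos_imp_increasing) (use d orbit_w_pos[OF h] in blast)+
  define T0 where "T0 = \<tau> (2 * pi) - \<tau> 0"
  have T0: "T0 > 0" using strict_monoD[OF mono, of 0 "2 * pi"] by (simp add: T0_def)
  have per: "\<tau> (p + 2 * pi) = \<tau> p + T0" for p
  proof -
    have "((\<lambda>p. \<tau> (p + 2 * pi) - \<tau> p) has_real_derivative 0) (at p)" for p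
    proof -
      have "((\<lambda>p. \<tau> (p + 2 * pi)) has_real_derivative orbit_w h (p + 2 * pi) * 1) (at p)"
        by (rule DERIV_chain2[OF d]) (auto intro!: derivative_eq_intros)
      from DERIV_diff[OF this d[of p]] show ?thesis by (simp add: orbit_w_def)
    qed
    hence "\<tau> (p + 2 * pi) - \<tau> p = \<tau> (0 + 2 * pi) - \<tau> 0" by (intro DERIV_isconst_all allI)
    thus ?thesis by (simp add: T0_def)
  qed
  have nat: "\<tau> (p + 2 * pi * real k) = \<tau> p + real k * T0" for p k
  proof (induction k)
    case (Suc k)
    have "\<tau> (p + 2 * pi * real (Suc k)) = \<tau> ((p + 2 * pi * real k) + 2 * pi)" by (simp add: algebra_simps)
    thus ?case unfolding per Suc by (simp add: algebra_simps)
  qed simp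
  have int: "\<tau> (p + 2 * pi * real_of_int k) = \<tau> p + real_of_int k * T0" for p and k :: int
  proof (cases "k \<ge> 0")
    case True thus ?thesis using nat[of p "nat k"] by simp
  next
    case False thus ?thesis using nat[of "p + 2 * pi * real_of_int k" "nat (- k)"] by (simp add: algebra_simps)
  qed
  have surj: "\<exists>p. \<tau> p = t" for t
  proof -
    \<comment> \<open>The time is unbounded in both directions because every turn takes the same time.\<close>
    obtain k :: nat where k: "\<bar>t - \<tau> 0\<bar> / T0 < real k" using reals_Archimedean2 by blast
    hence "\<bar>t - \<tau> 0\<bar> < real k * T0" using T0 by (simp add: field_simps)
    hence "\<tau> (0 + 2 * pi * real_of_int (- int k)) \<le> t" "t \<le> \<tau> (0 + 2 * pi * real_of_int (int k))"
      unfolding int by auto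
    moreover have "continuous_on {0 + 2 * pi * real_of_int (- int k)..0 + 2 * pi * real_of_int (int k)} \<tau>"
      by (intro continuous_at_imp_continuous_on ballI DERIV_isCont[OF d])
    moreover have "0 + 2 * pi * real_of_int (- int k) \<le> 0 + 2 * pi * real_of_int (int k)" by simp
    ultimately show ?thesis using IVT'[of \<tau> "0 + 2 * pi * real_of_int (- int k)" t "0 + 2 * pi * real_of_int (int k)"] by blast
  qed
  define \<Theta> where "\<Theta> = inv \<tau>"
  have Th: "\<tau> (\<Theta> t) = t" "\<Theta> (\<tau> p) = p" for t p
  proof -
    have "surj \<tau>" using surj unfolding surj_def by metis
    thus "\<tau> (\<Theta> t) = t" unfolding \<Theta>_def by (rule surj_f_inv_f)
    show "\<Theta> (\<tau> p) = p" unfolding \<Theta>_def by (rule inv_f_f[OF strict_mono_imp_inj_on[OF mono]])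
  qed
  have dT: "(\<Theta> has_real_derivative inverse (orbit_w h (\<Theta> t))) (at t)" for t
  proof -
    have "(\<Theta> has_real_derivative inverse (orbit_w h (\<Theta> t))) (at (\<tau> (\<Theta> t)))"
      by (rule deriv_of_inverse[where a = "\<Theta> t - 1" and b = "\<Theta> t + 1" and T = UNIV])
         (use Th d orbit_w_pos[OF h, of "\<Theta> t"] in auto)
    thus ?thesis by (simp add: Th)
  qed
  show thesis by (rule that[OF d mono Th(2,1) int[unfolded T0_def] dT])
qed

lemma orbit_curve_periodic: "orbit_curve h (p + 2 * pi) = orbit_curve h p"
  by (simp add: orbit_curve_def orbit_x_def orbit_y_def)

lemma orbit_curve_solution:
  assumes h: "h \<in> energies" and "(\<Theta> has_real_derivative inverse (orbit_w h (\<Theta> t))) (at t)"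
  shows "((\<lambda>t. orbit_curve h (\<Theta> t)) has_vector_derivative bt_field (orbit_curve h (\<Theta> t))) (at t)"
proof -
  have w: "orbit_w h (\<Theta> t) > 0" by (rule orbit_w_pos[OF h])
  have "((\<lambda>t. orbit_x h (\<Theta> t)) has_real_derivative orbit_y h (\<Theta> t)) (at t)"
    using DERIV_chain2[OF orbit_x_deriv[OF h] assms(2)] w by (simp add: mult.assoc)
  moreover have "((\<lambda>t. orbit_y h (\<Theta> t)) has_real_derivative - orbit_x h (\<Theta> t) + (orbit_x h (\<Theta> t))\<^sup>2) (at t)"
    using DERIV_chain2[OF orbit_y_deriv[OF h] assms(2)] w by (simp add: mult.assoc)
  ultimately show ?thesis unfolding orbit_curve_def bt_field_def
    by (auto simp: has_real_derivative_iff_has_vector_derivative intro!: has_vector_derivative_Pair)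
qed

lemma closed_orbit_exists:
  assumes h: "h \<in> energies" shows "\<exists>g T. closed_orbit h g T"
proof -
  obtain \<tau> \<Theta> where tau: "\<And>p. (\<tau> has_real_derivative orbit_w h p) (at p)" "strict_mono \<tau>"
    "\<And>p. \<Theta> (\<tau> p) = p" "\<And>t. \<tau> (\<Theta> t) = t"
    "\<And>p (k::int). \<tau> (p + 2 * pi * k) = \<tau> p + k * (\<tau> (2 * pi) - \<tau> 0)"
    "\<And>t. (\<Theta> has_real_derivative inverse (orbit_w h (\<Theta> t))) (at t)"
    by (rule orbit_time[OF h]) blast
  define T where "T = \<tau> (2 * pi) - \<tau> 0"
  let ?g = "\<lambda>t. orbit_curve h (\<Theta> t)"
  have T: "T > 0" using strict_monoD[OF tau(2), of 0 "2 * pi"] by (simp add: T_def)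
  have shift: "\<Theta> (t + real_of_int k * T) = \<Theta> t + 2 * pi * real_of_int k" for t k
    using tau(3)[of "\<Theta> t + 2 * pi * real_of_int k"] unfolding tau(5) tau(4) T_def by simp
  have "?g T = ?g 0" using shift[of 0 1] by (simp add: orbit_curve_periodic)
  moreover have "inj_on ?g {0..<T}"
  proof (rule inj_onI)
    fix s t assume st: "s \<in> {0..<T}" "t \<in> {0..<T}" "?g s = ?g t"
    obtain k :: int where "\<Theta> s = \<Theta> t + 2 * pi * real_of_int k" by (rule orbit_curve_inj[OF h st(3)])
    hence "\<tau> (\<Theta> s) = \<tau> (\<Theta> t) + real_of_int k * T" by (simp add: tau(5) T_def)
    hence e: "s = t + real_of_int k * T" by (simp add: tau(4))
    have "k = 0"
    proof (rule ccontr)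
      assume "k \<noteq> 0"
      hence "\<bar>real_of_int k\<bar> \<ge> 1" by linarith
      hence "\<bar>real_of_int k\<bar> * T \<ge> 1 * T" using T by (intro mult_right_mono) auto
      moreover have "\<bar>s - t\<bar> = \<bar>real_of_int k\<bar> * T" using e T by (simp add: abs_mult)
      moreover have "\<bar>s - t\<bar> < T" using st by auto
      ultimately show False by simp
    qed
    thus "s = t" using e by simp
  qed
  moreover have "range ?g = oval h"
  proof
    show "range ?g \<subseteq> oval h" using orbit_curve_in_oval[OF h] by auto
    show "oval h \<subseteq> range ?g"
    proof
      fix w assume "w \<in> oval h"
      then obtain p where "orbit_curve h p = w" by (rule oval_param[OF h])
      thus "w \<in> range ?g" using tau(3)[of p] by (metis rangeI)
    qed
  qed
  ultimately have "closed_orbit h ?g T"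
    using T orbit_curve_solution[OF h tau(6)] oval_inside[OF h] by (auto simp: closed_orbit_def oval_def)
  thus ?thesis by blast
qed

text \<open>On a strip \<open>\<bar>x\<bar> \<le> 1\<close> the vector field is Lipschitz, so the squared distance of two solutions
  grows at most like \<open>exp (2 t)\<close>.\<close>

lemma solution_unique:
  fixes f g :: "real \<Rightarrow> real \<times> real"
  assumes f: "\<And>t. (f has_vector_derivative bt_field (f t)) (at t)" "\<And>t. \<bar>fst (f t)\<bar> \<le> 1"
    and g: "\<And>t. (g has_vector_derivative bt_field (g t)) (at t)" "\<And>t. \<bar>fst (g t)\<bar> \<le> 1"
    and "f 0 = g 0" "t \<ge> 0"
  shows "f t = g t"
proof -
  define E where "E t = (fst (f t) - fst (g t))\<^sup>2 + (snd (f t) - snd (g t))\<^sup>2" for t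
  have df: "((\<lambda>t. fst (k t)) has_real_derivative snd (k t)) (at t)"
    "((\<lambda>t. snd (k t)) has_real_derivative - fst (k t) + (fst (k t))\<^sup>2) (at t)"
    if "(k has_vector_derivative bt_field (k t)) (at t)" for k :: "real \<Rightarrow> real \<times> real" and t
    using bounded_linear.has_vector_derivative[OF bounded_linear_fst that]
      bounded_linear.has_vector_derivative[OF bounded_linear_snd that]
    by (auto simp: bt_field_def case_prod_unfold has_real_derivative_iff_has_vector_derivative)
  let ?E' = "\<lambda>t. 2 * (fst (f t) - fst (g t)) * (snd (f t) - snd (g t)) * (fst (f t) + fst (g t))"
  have dE: "(E has_real_derivative ?E' t) (at t)" for t
  proof -
    have "(E has_real_derivative 2 * (fst (f t) - fst (g t)) * (snd (f t) - snd (g t))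
        + 2 * (snd (f t) - snd (g t)) * ((- fst (f t) + (fst (f t))\<^sup>2) - (- fst (g t) + (fst (g t))\<^sup>2))) (at t)"
      unfolding E_def[abs_def] using df[OF f(1)[of t]] df[OF g(1)[of t]]
      by (auto intro!: derivative_eq_intros simp: algebra_simps)
    moreover have "2 * (fst (f t) - fst (g t)) * (snd (f t) - snd (g t))
        + 2 * (snd (f t) - snd (g t)) * ((- fst (f t) + (fst (f t))\<^sup>2) - (- fst (g t) + (fst (g t))\<^sup>2)) = ?E' t"
      by (simp add: power2_eq_square algebra_simps)
    ultimately show ?thesis by simp
  qed
  have le: "?E' t \<le> 2 * E t" for t
  proof -
    define a b c where "a = fst (f t) - fst (g t)" and "b = snd (f t) - snd (g t)" and "c = fst (f t) + fst (g t)"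
    have "\<bar>c\<bar> \<le> 2" using f(2)[of t] g(2)[of t] by (simp add: c_def)
    have "2 * a * b * c \<le> \<bar>2 * a * b\<bar> * \<bar>c\<bar>" by (metis abs_ge_self abs_mult)
    also have "\<dots> \<le> \<bar>2 * a * b\<bar> * 2" using \<open>\<bar>c\<bar> \<le> 2\<close> by (intro mult_left_mono) auto
    also have "\<bar>2 * a * b\<bar> \<le> a\<^sup>2 + b\<^sup>2"
      using sum_squares_bound[of a b] sum_squares_bound[of a "- b"] by (simp add: abs_le_iff)
    finally show ?thesis by (simp add: a_def b_def c_def E_def)
  qed
  have "exp (- 2 * t) * E t \<le> exp (- 2 * 0) * E 0"
  proof (rule DERIV_nonpos_imp_nonincreasing[OF assms(6)])
    fix s assume "0 \<le> s" "s \<le> t"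
    have "((\<lambda>t. exp (- 2 * t) * E t) has_real_derivative exp (- 2 * s) * (?E' s - 2 * E s)) (at s)"
      by (rule derivative_eq_intros dE refl | simp add: algebra_simps)+
    moreover have "exp (- 2 * s) * (?E' s - 2 * E s) \<le> 0" using le[of s] by (intro mult_nonneg_nonpos) auto
    ultimately show "\<exists>y. ((\<lambda>t. exp (- 2 * t) * E t) has_real_derivative y) (at s) \<and> y \<le> 0" by blast
  qed
  moreover have "E 0 = 0" by (simp add: E_def assms(5))
  ultimately have "E t \<le> 0" by (simp add: mult_le_0_iff)
  hence "fst (f t) - fst (g t) = 0 \<and> snd (f t) - snd (g t) = 0" unfolding E_def by (simp add: sum_power2_le_zero_iff)
  thus ?thesis by (simp add: prod_eq_iff)
qed

section \<open>Integrals along a closed orbit\<close>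

text \<open>Every closed orbit, in particular the one chosen in the definition of the Melnikov function, is the
  oval with some starting angle \<open>p1\<close>, run through once.\<close>

lemma closed_orbit_param:
  assumes h: "h \<in> energies" and g: "closed_orbit h g T"
  obtains \<sigma> p1 where "- pi \<le> p1" "p1 \<le> pi" "\<And>p. (\<sigma> has_real_derivative orbit_w h p) (at p)" "strict_mono \<sigma>"
    "\<sigma> ` {p1..p1 + 2 * pi} = {0..T}" "\<And>p. p \<in> {p1..p1 + 2 * pi} \<Longrightarrow> g (\<sigma> p) = orbit_curve h p"
proof -
  obtain \<tau> \<Theta> where tau: "\<And>p. (\<tau> has_real_derivative orbit_w h p) (at p)" "strict_mono \<tau>"
    "\<And>p. \<Theta> (\<tau> p) = p" "\<And>t. \<tau> (\<Theta> t) = t"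
    "\<And>p (k::int). \<tau> (p + 2 * pi * k) = \<tau> p + k * (\<tau> (2 * pi) - \<tau> 0)"
    "\<And>t. (\<Theta> has_real_derivative inverse (orbit_w h (\<Theta> t))) (at t)"
    by (rule orbit_time[OF h]) blast
  have sol: "\<And>t. (g has_vector_derivative bt_field (g t)) (at t)" and T: "T > 0" "g T = g 0" "inj_on g {0..<T}"
    and lev: "range g \<subseteq> {z. bt_hamiltonian z = h}" "(0, 0) \<in> inside (range g)"
    using g by (auto simp: closed_orbit_def)
  have cont: "continuous_on UNIV g"
    by (intro continuous_at_imp_continuous_on ballI has_vector_derivative_continuous[OF sol])
  have ov: "range g \<subseteq> oval h" by (rule level_component[OF h cont lev])
  have x1: "\<bar>fst (g t)\<bar> \<le> 1" for t
  proof -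
    have "g t \<in> oval h" using ov by blast
    then obtain p where "orbit_curve h p = g t" by (rule oval_param[OF h])
    hence "fst (g t) = orbit_x h p" by (simp add: orbit_curve_def flip: \<open>orbit_curve h p = g t\<close>)
    thus ?thesis using orbit_x_bounds[OF h, of p] by simp
  qed
  obtain p1 where p1: "- pi \<le> p1" "p1 \<le> pi" "orbit_curve h p1 = g 0"
    using oval_param[OF h, of "g 0"] ov by blast
  define \<sigma> where "\<sigma> p = \<tau> p - \<tau> p1" for p
  have mono: "strict_mono \<sigma>" using tau(2) by (simp add: \<sigma>_def strict_mono_def)
  have ders: "(\<sigma> has_real_derivative orbit_w h p) (at p)" for p
    unfolding \<sigma>_def[abs_def] using tau(1)[of p] by (auto intro!: derivative_eq_intros)
  have eq: "g t = orbit_curve h (\<Theta> (t + \<tau> p1))" if t: "t \<ge> 0" for t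
  proof (rule solution_unique[OF sol x1 _ _ _ t])
    show "((\<lambda>t. orbit_curve h (\<Theta> (t + \<tau> p1))) has_vector_derivative bt_field (orbit_curve h (\<Theta> (t + \<tau> p1)))) (at t)" for t
    proof (rule orbit_curve_solution[OF h])
      have "((\<lambda>t. \<Theta> (t + \<tau> p1)) has_real_derivative inverse (orbit_w h (\<Theta> (t + \<tau> p1))) * 1) (at t)"
        by (rule DERIV_chain2[OF tau(6)]) (auto intro!: derivative_eq_intros)
      thus "((\<lambda>t. \<Theta> (t + \<tau> p1)) has_real_derivative inverse (orbit_w h (\<Theta> (t + \<tau> p1)))) (at t)" by simp
    qed
    show "\<bar>fst (orbit_curve h (\<Theta> (t + \<tau> p1)))\<bar> \<le> 1" for t
      using orbit_x_bounds[OF h, of "\<Theta> (t + \<tau> p1)"] by (simp add: orbit_curve_def)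
    show "g 0 = orbit_curve h (\<Theta> (0 + \<tau> p1))" by (simp add: tau(3) p1(3))
  qed
  have eq': "g (\<sigma> p) = orbit_curve h p" if "p \<ge> p1" for p
  proof -
    have "\<sigma> p \<ge> 0" using that strict_mono_less_eq[OF tau(2), of p1 p] by (simp add: \<sigma>_def)
    thus ?thesis using eq[of "\<sigma> p"] by (simp add: \<sigma>_def tau(3))
  qed
  have T: "T = \<sigma> (p1 + 2 * pi)"
  proof -
    define p2 where "p2 = \<Theta> (T + \<tau> p1)"
    have s2: "\<sigma> p2 = T" by (simp add: p2_def \<sigma>_def tau(4))
    have "\<sigma> p1 < \<sigma> p2" unfolding s2 using T by (simp add: \<sigma>_def)
    hence lt: "p1 < p2" using strict_mono_less[OF mono] by simp
    have "orbit_curve h p2 = orbit_curve h p1" using eq'[of p2] lt s2 T(2) p1(3) by simp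
    then obtain k :: int where k: "p2 = p1 + 2 * pi * k" by (rule orbit_curve_inj[OF h])
    have "k \<ge> 1"
    proof (rule ccontr)
      assume "\<not> 1 \<le> k"
      hence "real_of_int k \<le> 0" by simp
      hence "2 * pi * real_of_int k \<le> 0" by (intro mult_nonneg_nonpos) auto
      thus False using lt k by simp
    qed
    \<comment> \<open>Two turns would contradict the injectivity of \<open>g\<close> on one period.\<close>
    moreover have "\<not> k \<ge> 2"
    proof
      assume "k \<ge> 2"
      hence "2 * pi * 2 \<le> 2 * pi * real_of_int k" by (intro mult_left_mono) auto
      hence "p1 + 2 * pi < p2" using k pi_gt_zero by linarith
      hence s: "\<sigma> (p1 + 2 * pi) < T" using strict_mono_less[OF mono] s2 by metis
      have "\<sigma> (p1 + 2 * pi) > \<sigma> p1" using strict_mono_less[OF mono] by simp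
      hence s0: "\<sigma> (p1 + 2 * pi) > 0" by (simp add: \<sigma>_def)
      have "g (\<sigma> (p1 + 2 * pi)) = g 0" using eq'[of "p1 + 2 * pi"] p1(3) by (simp add: orbit_curve_periodic)
      thus False using inj_onD[OF T(3), of "\<sigma> (p1 + 2 * pi)" 0] s s0 T(1) by auto
    qed
    ultimately have "k = 1" by simp
    thus ?thesis using s2 k by simp
  qed
  have img: "\<sigma> ` {p1..p1 + 2 * pi} = {0..T}"
  proof
    show "\<sigma> ` {p1..p1 + 2 * pi} \<subseteq> {0..T}"
    proof
      fix t assume "t \<in> \<sigma> ` {p1..p1 + 2 * pi}"
      then obtain p where p: "p1 \<le> p" "p \<le> p1 + 2 * pi" "t = \<sigma> p" by auto
      have "\<sigma> p1 \<le> \<sigma> p" "\<sigma> p \<le> \<sigma> (p1 + 2 * pi)" using p strict_mono_less_eq[OF mono] by auto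
      thus "t \<in> {0..T}" unfolding T p(3) by (simp add: \<sigma>_def)
    qed
    show "{0..T} \<subseteq> \<sigma> ` {p1..p1 + 2 * pi}"
    proof
      fix t assume t: "t \<in> {0..T}"
      define p where "p = \<Theta> (t + \<tau> p1)"
      have s: "\<sigma> p = t" by (simp add: p_def \<sigma>_def tau(4))
      have "\<sigma> p1 \<le> \<sigma> p" "\<sigma> p \<le> \<sigma> (p1 + 2 * pi)" unfolding s using t T by (auto simp: \<sigma>_def)
      hence "p1 \<le> p" "p \<le> p1 + 2 * pi" using strict_mono_less_eq[OF mono] by auto
      thus "t \<in> \<sigma> ` {p1..p1 + 2 * pi}" using s by (intro image_eqI[of _ _ p]) auto
    qed
  qed
  show thesis by (rule that[OF p1(1,2) ders mono img]) (use eq' in auto)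
qed

lemma integral_periodic:
  fixes k :: "real \<Rightarrow> real"
  assumes int: "\<And>a b. k integrable_on {a..b}" and per: "\<And>p. k (p + 2 * pi) = k p"
    and a: "- pi \<le> a" "a \<le> pi"
  shows "integral {a..a + 2 * pi} k = integral {-pi..pi} k"
proof -
  have "(k has_integral integral {pi..a + 2 * pi} k) (cbox pi (a + 2 * pi))"
    using integrable_integral[OF int] by simp
  from has_integral_affinity[OF this, of 1 "2 * pi"]
  have "((\<lambda>x. k (x + 2 * pi)) has_integral integral {pi..a + 2 * pi} k) ((\<lambda>x. x - 2 * pi) ` {pi..a + 2 * pi})"
    by simp
  moreover have "(\<lambda>x. x - 2 * pi) ` {pi..a + 2 * pi} = {- pi..a}"
  proof (intro equalityI subsetI)
    show "x \<in> (\<lambda>x. x - 2 * pi) ` {pi..a + 2 * pi}" if "x \<in> {- pi..a}" for x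
      using that by (intro image_eqI[of _ _ "x + 2 * pi"]) auto
  qed auto
  ultimately have "integral {-pi..a} k = integral {pi..a + 2 * pi} k" by (simp add: per integral_unique)
  moreover have "integral {a..pi} k + integral {pi..a + 2 * pi} k = integral {a..a + 2 * pi} k"
    by (rule Henstock_Kurzweil_Integration.integral_combine) (use a int in auto)
  moreover have "integral {-pi..a} k + integral {a..pi} k = integral {-pi..pi} k"
    by (rule Henstock_Kurzweil_Integration.integral_combine) (use a int in auto)
  ultimately show ?thesis by simp
qed

text \<open>The pullback of \<open>P dx + Q dy\<close> under the parametrization by the angle.\<close>

definition orbit_form :: "(real \<times> real \<Rightarrow> real) \<Rightarrow> (real \<times> real \<Rightarrow> real) \<Rightarrow> real \<Rightarrow> real \<Rightarrow> real" where
  "orbit_form P Q h p = orbit_w h p * (P (orbit_curve h p) * orbit_y h p + Q (orbit_curve h p) * (- orbit_x h p + (orbit_x h p)\<^sup>2))"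

lemma continuous_orbit_curve: "h \<in> energies \<Longrightarrow> continuous_on A (orbit_curve h)"
  unfolding orbit_curve_def[abs_def] by (intro continuous_intros continuous_orbit)

lemma continuous_orbit_form:
  assumes "h \<in> energies" "continuous_on UNIV P" "continuous_on UNIV Q" shows "continuous_on A (orbit_form P Q h)"
proof -
  have "continuous_on A (\<lambda>p. P (orbit_curve h p))" "continuous_on A (\<lambda>p. Q (orbit_curve h p))"
    using continuous_on_compose2[OF assms(2) continuous_orbit_curve[OF assms(1)]]
      continuous_on_compose2[OF assms(3) continuous_orbit_curve[OF assms(1)]] by auto
  thus ?thesis unfolding orbit_form_def[abs_def] by (intro continuous_intros continuous_orbit assms)
qed

lemma curve_integral_orbit:
  assumes h: "h \<in> energies" and g: "closed_orbit h g T" and A: "open A"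
    and PQ: "continuous_on UNIV P" "continuous_on UNIV Q"
  shows "curve_integral g T A P Q = integral {-pi..pi} (\<lambda>p. if orbit_curve h p \<in> A then orbit_form P Q h p else 0)"
proof -
  obtain \<sigma> p1 where s: "- pi \<le> p1" "p1 \<le> pi" "\<And>p. (\<sigma> has_real_derivative orbit_w h p) (at p)" "strict_mono \<sigma>"
    "\<sigma> ` {p1..p1 + 2 * pi} = {0..T}" "\<And>p. p \<in> {p1..p1 + 2 * pi} \<Longrightarrow> g (\<sigma> p) = orbit_curve h p"
    by (rule closed_orbit_param[OF h g]) blast
  have vd: "vector_derivative g (at t) = bt_field (g t)" for t
    using g by (auto simp: closed_orbit_def intro: vector_derivative_at)
  define f where "f t = P (g t) * fst (vector_derivative g (at t)) + Q (g t) * snd (vector_derivative g (at t))" for t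
  have "open {p. orbit_curve h p \<in> A}"
    using open_vimage[OF A continuous_orbit_curve[OF h, of UNIV]] by (simp add: vimage_def)
  hence mA: "{p. orbit_curve h p \<in> A} \<in> sets lebesgue" by (intro sets_completionI_sets) auto
  have aint: "orbit_form P Q h absolutely_integrable_on ({p. orbit_curve h p \<in> A} \<inter> {a..b})" for a b
  proof (rule set_integrable_subset)
    show "orbit_form P Q h absolutely_integrable_on {a..b}"
      by (rule absolutely_integrable_continuous_real[OF continuous_orbit_form[OF h PQ]])
  qed (use mA in auto)
  let ?k = "\<lambda>p. if p \<in> {p. orbit_curve h p \<in> A} then orbit_form P Q h p else 0"
  have intk: "?k integrable_on {a..b}" for a b
    unfolding Henstock_Kurzweil_Integration.integrable_restrict_Int
    using aint by (rule set_lebesgue_integral_eq_integral(1))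
  define S where "S = {p. orbit_curve h p \<in> A} \<inter> {p1..p1 + 2 * pi}"
  have mS: "S \<in> sets lebesgue" unfolding S_def using mA by auto
  have fs: "\<bar>orbit_w h p\<bar> * f (\<sigma> p) = orbit_form P Q h p" if "p \<in> S" for p
    using s(6)[of p] that orbit_w_pos[OF h, of p]
    by (simp add: f_def vd orbit_form_def S_def bt_field_def orbit_curve_def)
  have "(\<lambda>p. \<bar>orbit_w h p\<bar> * f (\<sigma> p)) absolutely_integrable_on S"
    using aint[of p1 "p1 + 2 * pi"] unfolding S_def[symmetric] by (subst set_integrable_cong[OF refl refl fs])
  moreover have "integral S (\<lambda>p. \<bar>orbit_w h p\<bar> * f (\<sigma> p)) = integral S (orbit_form P Q h)"
    by (intro integral_cong fs)
  moreover have "(\<lambda>p. \<bar>orbit_w h p\<bar> * f (\<sigma> p)) absolutely_integrable_on S \<and>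
      integral S (\<lambda>p. \<bar>orbit_w h p\<bar> * f (\<sigma> p)) = integral S (orbit_form P Q h)
      \<longleftrightarrow> f absolutely_integrable_on (\<sigma> ` S) \<and> integral (\<sigma> ` S) f = integral S (orbit_form P Q h)"
    by (rule has_absolute_integral_change_of_variables_1'[OF mS])
      (use s(3) strict_mono_imp_inj_on[OF s(4)] in \<open>auto intro: has_field_derivative_at_within inj_on_subset\<close>)
  ultimately have 1: "integral (\<sigma> ` S) f = integral S (orbit_form P Q h)" by blast
  have "\<sigma> ` S = {t \<in> {0..T}. g t \<in> A}"
    unfolding s(5)[symmetric] S_def using s(6) by auto
  with 1 have "curve_integral g T A P Q = integral S (orbit_form P Q h)"
    by (simp add: curve_integral_def f_def[abs_def])
  also have "\<dots> = integral {p1..p1 + 2 * pi} ?k"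
    unfolding S_def by (rule Henstock_Kurzweil_Integration.integral_restrict_Int[symmetric])
  also have "\<dots> = integral {-pi..pi} ?k"
  proof (rule integral_periodic[OF intk _ s(1,2)])
    show "?k (p + 2 * pi) = ?k p" for p
      by (simp add: orbit_curve_periodic orbit_form_def orbit_x_def orbit_y_def orbit_w_def)
  qed
  finally show ?thesis by simp
qed

context exponent
begin

text \<open>In terms of \<open>u = rho cos p\<close>, the point lies to the right of the switching curve if and only if
  \<open>u\<close> exceeds its value at the switching points: on the right half of the circle \<open>x\<close> increases with \<open>u\<close>
  and \<open>y\<^sup>2 = 2 h - u\<^sup>2\<close> decreases, and on the left half \<open>x\<close> is not positive.\<close>

lemma region:
  assumes h: "h \<in> energies" and p: "p \<in> {-pi..pi}"
  shows "orbit_x h p > orbit_y h p ^ (2 * m) \<longleftrightarrow> \<bar>p\<bar> < switch_angle h"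
    and "orbit_x h p < orbit_y h p ^ (2 * m) \<longleftrightarrow> \<bar>p\<bar> > switch_angle h"
proof -
  define u where "u = rho h * cos p"
  have y2: "(orbit_y h p)\<^sup>2 = 2 * h - u\<^sup>2"
    using rho_square[OF h] by (simp add: orbit_y_def u_def power_mult_distrib sin_squared_eq algebra_simps)
  have y: "orbit_y h p ^ (2 * m) = (2 * h - u\<^sup>2) ^ m" by (simp add: power_mult y2)
  have x: "orbit_x h p = xi u" by (simp add: orbit_x_def u_def)
  have ud: "u\<^sup>2 < 1/3" unfolding u_def by (rule rho_cos_disc[OF h])
  have u0d: "(switch_u h)\<^sup>2 < 1/3" using rho_cos_disc[OF h, of "switch_angle h"] switch_angle_cos_sin[OF h] by simp
  have u0p: "switch_u h > 0" by (rule switch_u_eq(2)[OF h])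
  have zu: "switch_z h = 2 * h - (switch_u h)\<^sup>2" using switch_u_square[OF h] switch_y_square[OF h] by simp
  have nn: "2 * h - u\<^sup>2 \<ge> 0" using y2 zero_le_power2[of "orbit_y h p"] by simp
  have gt: "(2 * h - u\<^sup>2) ^ m < xi u" if "switch_u h < u"
  proof -
    have "(switch_u h)\<^sup>2 \<le> u\<^sup>2" using that u0p by (intro power_mono) auto
    hence "(2 * h - u\<^sup>2) ^ m \<le> switch_z h ^ m" unfolding zu using nn by (intro power_mono) auto
    also have "\<dots> < xi u" using xi_strict_mono[OF u0d ud that] xi_switch_u[OF h] by simp
    finally show ?thesis .
  qed
  have lt: "xi u < (2 * h - u\<^sup>2) ^ m" if "u < switch_u h"
  proof (cases "u \<ge> 0")
    case True
    have "u\<^sup>2 \<le> (switch_u h)\<^sup>2" using that True by (intro power_mono) auto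
    hence "switch_z h ^ m \<le> (2 * h - u\<^sup>2) ^ m" unfolding zu using switch_z_energies(1)[OF h] zu by (intro power_mono) auto
    thus ?thesis using xi_strict_mono[OF ud u0d that] xi_switch_u[OF h] by simp
  next
    case False
    have "xi u < 0" using xi_strict_mono[OF ud, of 0] False by (simp add: xi_0)
    thus ?thesis using zero_le_power[OF nn, of m] by linarith
  qed
  have eq: "xi u = (2 * h - u\<^sup>2) ^ m" if "u = switch_u h" using that xi_switch_u[OF h] zu by simp
  have b: "0 \<le> \<bar>p\<bar>" "\<bar>p\<bar> \<le> pi" "0 \<le> switch_angle h" "switch_angle h \<le> pi" using p switch_angle_bounds[OF h] by auto
  have c: "switch_u h < u \<longleftrightarrow> \<bar>p\<bar> < switch_angle h" "u < switch_u h \<longleftrightarrow> switch_angle h < \<bar>p\<bar>"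
    using cos_mono_less_eq[OF b(1,2) b(3,4)] cos_mono_less_eq[OF b(3,4) b(1,2)] rho_pos[OF h]
    unfolding u_def switch_angle_cos_sin(1)[OF h, symmetric] by simp_all
  show "orbit_x h p > orbit_y h p ^ (2 * m) \<longleftrightarrow> \<bar>p\<bar> < switch_angle h"
    "orbit_x h p < orbit_y h p ^ (2 * m) \<longleftrightarrow> \<bar>p\<bar> > switch_angle h"
    unfolding x y c[symmetric] using gt lt eq by (metis linorder_neqE_linordered_idom order_less_asym order_less_irrefl)+
qed

lemma curve_integral_plus:
  assumes h: "h \<in> energies" and g: "closed_orbit h g T" and PQ: "continuous_on UNIV P" "continuous_on UNIV Q"
  shows "curve_integral g T {(x, y). x > y ^ (2 * m)} P Q = integral {- switch_angle h..switch_angle h} (orbit_form P Q h)"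
proof -
  have "open {(x, y). (x::real) > y ^ (2 * m)}"
    unfolding case_prod_unfold by (intro open_Collect_less continuous_intros)
  from curve_integral_orbit[OF h g this PQ]
  have "curve_integral g T {(x, y). x > y ^ (2 * m)} P Q
     = integral {-pi..pi} (\<lambda>p. if orbit_curve h p \<in> {(x, y). x > y ^ (2 * m)} then orbit_form P Q h p else 0)" .
  also have "\<dots> = integral {-pi..pi} (\<lambda>p. if p \<in> {- switch_angle h<..<switch_angle h} then orbit_form P Q h p else 0)"
    by (rule integral_cong) (use region(1)[OF h] in \<open>auto simp: orbit_curve_def abs_less_iff\<close>)
  also have "\<dots> = integral ({- switch_angle h<..<switch_angle h} \<inter> {-pi..pi}) (orbit_form P Q h)"
    by (rule Henstock_Kurzweil_Integration.integral_restrict_Int)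
  also have "{- switch_angle h<..<switch_angle h} \<inter> {-pi..pi} = {- switch_angle h<..<switch_angle h}" using switch_angle_bounds[OF h] by auto
  finally show ?thesis by (simp add: integral_open_interval_real)
qed

lemma curve_integral_minus:
  assumes h: "h \<in> energies" and g: "closed_orbit h g T" and PQ: "continuous_on UNIV P" "continuous_on UNIV Q"
  shows "curve_integral g T {(x, y). x < y ^ (2 * m)} P Q
     = integral {-pi..pi} (orbit_form P Q h) - integral {- switch_angle h..switch_angle h} (orbit_form P Q h)"
proof -
  have "open {(x, y). (x::real) < y ^ (2 * m)}"
    unfolding case_prod_unfold by (intro open_Collect_less continuous_intros)
  from curve_integral_orbit[OF h g this PQ]
  have "curve_integral g T {(x, y). x < y ^ (2 * m)} P Q
     = integral {-pi..pi} (\<lambda>p. if orbit_curve h p \<in> {(x, y). x < y ^ (2 * m)} then orbit_form P Q h p else 0)" .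
  also have "\<dots> = integral {-pi..pi} (\<lambda>p. orbit_form P Q h p - (if p \<in> {- switch_angle h..switch_angle h} then orbit_form P Q h p else 0))"
    by (rule integral_cong) (use region(2)[OF h] in \<open>auto simp: orbit_curve_def abs_if split: if_splits\<close>)
  also have "\<dots> = integral {-pi..pi} (orbit_form P Q h) - integral {-pi..pi} (\<lambda>p. if p \<in> {- switch_angle h..switch_angle h} then orbit_form P Q h p else 0)"
  proof (rule integral_diff)
    have i: "orbit_form P Q h integrable_on {a..b}" for a b
      by (rule integrable_continuous_interval[OF continuous_orbit_form[OF h PQ]])
    show "orbit_form P Q h integrable_on {-pi..pi}" by (rule i)
    show "(\<lambda>p. if p \<in> {- switch_angle h..switch_angle h} then orbit_form P Q h p else 0) integrable_on {-pi..pi}"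
      unfolding Henstock_Kurzweil_Integration.integrable_restrict_Int Int_atLeastAtMost by (rule i)
  qed
  also have "integral {-pi..pi} (\<lambda>p. if p \<in> {- switch_angle h..switch_angle h} then orbit_form P Q h p else 0) = integral ({- switch_angle h..switch_angle h} \<inter> {-pi..pi}) (orbit_form P Q h)"
    by (rule Henstock_Kurzweil_Integration.integral_restrict_Int)
  also have "{- switch_angle h..switch_angle h} \<inter> {-pi..pi} = {- switch_angle h..switch_angle h}" using switch_angle_bounds[OF h] by auto
  finally show ?thesis .
qed

end

lemma finite_degree_set: "finite {(i, j). i + j \<le> (n::nat)}"
  by (rule finite_subset[of _ "{..n} \<times> {..n}"]) auto

lemma continuous_bipoly: "continuous_on A (bipoly n a)"
  unfolding bipoly_def case_prod_unfold by (intro continuous_intros)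

lemma integral_orbit_form_bipoly:
  assumes h: "h \<in> energies"
  shows "integral {-c..c} (orbit_form (bipoly n b) (\<lambda>z. - bipoly n a z) h) = (\<Sum>(i, j) \<in> {(i, j). i + j \<le> n}.
      b i j * arc i (j + 1) h c + a i j * (arc (i + 1) j h c - arc (i + 2) j h c))"
proof -
  let ?I = "{(i, j). i + j \<le> n}"
  have "orbit_form (bipoly n b) (\<lambda>z. - bipoly n a z) h p = (\<Sum>x\<in>?I. b (fst x) (snd x) * monom_fun (fst x) (snd x + 1) h p
      + a (fst x) (snd x) * (monom_fun (fst x + 1) (snd x) h p - monom_fun (fst x + 2) (snd x) h p))" for p
    unfolding orbit_form_def bipoly_def orbit_curve_def case_prod_unfold fst_conv snd_conv
    by (simp add: sum_distrib_left sum_distrib_right sum.distrib[symmetric] sum_subtractf[symmetric] sum_negf[symmetric]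
         monom_fun_def power2_eq_square algebra_simps)
  hence "orbit_form (bipoly n b) (\<lambda>z. - bipoly n a z) h = (\<lambda>p. \<Sum>x\<in>?I. b (fst x) (snd x) * monom_fun (fst x) (snd x + 1) h p
      + a (fst x) (snd x) * (monom_fun (fst x + 1) (snd x) h p - monom_fun (fst x + 2) (snd x) h p))" by blast
  hence "(orbit_form (bipoly n b) (\<lambda>z. - bipoly n a z) h has_integral (\<Sum>x\<in>?I. b (fst x) (snd x) * arc (fst x) (snd x + 1) h c
      + a (fst x) (snd x) * (arc (fst x + 1) (snd x) h c - arc (fst x + 2) (snd x) h c))) {-c..c}"
    unfolding arc_def
    by (simp only:) (intro has_integral_sum finite_degree_set has_integral_add has_integral_diff has_integral_mult_right
         integrable_integral integrable_monom_fun h)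
  thus ?thesis by (simp add: integral_unique case_prod_unfold)
qed

section \<open>The bound\<close>

lemma (in exponent) melnikov_eq:
  assumes h: "h \<in> energies"
  shows "melnikov m n ap bp am bm h =
    full.arc_melnikov n am bm h + (part.arc_melnikov n ap bp h - part.arc_melnikov n am bm h)"
proof -
  \<comment> \<open>The choice is resolved by the existence of a closed orbit; the integrals below do not depend on it.\<close>
  define gT where "gT = (SOME (g, T). closed_orbit h g T)"
  obtain g T where gT2: "gT = (g, T)" by (cases gT)
  have "\<exists>gT. case gT of (g, T) \<Rightarrow> closed_orbit h g T" using closed_orbit_exists[OF h] by auto
  from someI_ex[OF this] have g: "closed_orbit h g T" using gT2 by (simp add: gT_def)
  have c: "continuous_on UNIV (bipoly n a)" "continuous_on UNIV (\<lambda>z. - bipoly n a z)" for a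
    by (intro continuous_intros continuous_bipoly)+
  have "melnikov m n ap bp am bm h =
     curve_integral g T {(x, y). x > y ^ (2 * m)} (bipoly n bp) (\<lambda>z. - bipoly n ap z) +
     curve_integral g T {(x, y). x < y ^ (2 * m)} (bipoly n bm) (\<lambda>z. - bipoly n am z)"
    unfolding melnikov_def gT_def[symmetric] gT2 by simp
  also have "\<dots> = integral {- switch_angle h..switch_angle h} (orbit_form (bipoly n bp) (\<lambda>z. - bipoly n ap z) h)
     + (integral {-pi..pi} (orbit_form (bipoly n bm) (\<lambda>z. - bipoly n am z) h)
        - integral {- switch_angle h..switch_angle h} (orbit_form (bipoly n bm) (\<lambda>z. - bipoly n am z) h))"
    unfolding curve_integral_plus[OF h g c] curve_integral_minus[OF h g c] ..
  finally show ?thesis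
    unfolding integral_orbit_form_bipoly[OF h] full.arc_melnikov_def part.arc_melnikov_def full_def part_def by simp
qed

theorem theorem1p1:
  fixes m n :: nat
  assumes "m \<ge> 1" and "n \<ge> 1"
  shows "(m = 1 \<longrightarrow> melnikov_cyclicity m n \<le> enat (50 * n + 52)) \<and>
         (m \<ge> 2 \<longrightarrow> melnikov_cyclicity m n \<le> enat ((39 * m + 36) * n + 77 * m + 21))"
proof -
  interpret exponent m by unfold_locales (rule assms(1))
  define d where "d = (n - 1) div 2"
  have nd: "2 * d + 1 \<le> n" using assms(2) by (auto simp: d_def)
  have bound: "melnikov_cyclicity m n \<le> enat (27 * m * d + 62 * m + 32 * d + 38)"
    unfolding melnikov_cyclicity_def
  proof (rule Sup_least)
    fix x assume "x \<in> {zero_count (melnikov m n ap bp am bm) {0<..<1/6} | ap bp am bm.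
            \<exists>h \<in> {0<..<1/6}. melnikov m n ap bp am bm h \<noteq> 0}"
    then obtain ap bp am bm where x: "x = zero_count (melnikov m n ap bp am bm) energies"
      and nz: "\<exists>h\<in>energies. melnikov m n ap bp am bm h \<noteq> 0" by blast
    show "x \<le> enat (27 * m * d + 62 * m + 32 * d + 38)"
      unfolding x by (rule zeros_le_imp_zero_count[OF zeros_le_arc_melnikov[OF assms(2) d_def melnikov_eq nz]])
  qed
  have "27 * m * d + 62 * m + 32 * d + 38 \<le> 50 * n + 52" if "m = 1"
    using nd that by simp
  moreover have "27 * m * d + 62 * m + 32 * d + 38 \<le> (39 * m + 36) * n + 77 * m + 21"
  proof -
    have "(39 * m + 36) * (2 * d + 1) \<le> (39 * m + 36) * n" by (rule mult_le_mono2[OF nd])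
    thus ?thesis by (simp add: algebra_simps)
  qed
  ultimately show ?thesis using order_trans[OF bound] by auto
qed

end
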